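(* Let $T=(V(T),E(T))$ be a rooted tree with $n$ vertices and let $\mathcal{A}=(Q,\Sigma,Q_{\text{init}},\Delta)$ be a non-deterministic top-down tree automaton over $\Sigma=\{0,1\}$ with diversity of transitions $\delta(n)$. Let $p(u)\in\mathbb{R}_{\ge 0}$ and $w(u)\in\mathbb{Z}_{\ge 0}$ for each $u\in V(T)$, and let $C\in\mathbb{Z}_{\ge 0}$. Then there is an algorithm that solves the automaton constrained tree knapsack problem $$\text{maximize } p(X) \text{ subject to } w(X)\le C,\ X\in\mathcal{F}(\mathcal{A})$$ in $O(n^{\log_2(1+\delta(n))}\,C)$ time. In particular, if $\delta(n)=O(1)$, the algorithm runs in $O(\mathrm{poly}(n)\,C)$ time.
   Context: A non-deterministic top-down tree automaton is a tuple $\mathcal{A}=(Q,\Sigma,Q_{\text{init}},\Delta)$ where $Q$ is a finite set of states (assumed throughout to have constant size, $|Q|=O(1)$), $\Sigma$ is an alphabet, $Q_{\text{init}}\subseteq Q$ is the set of initial states, and $\Delta$ is a set of rewriting rules of the form $(q,\sigma)\mapsto(q_1,\ldots,q_d)$ with $q,q_1,\dots,q_d\in Q$, $\sigma\in\Sigma$, $d\ge 0$. Given a rooted tree $T$ whose vertices have ordered children and a labeling $\sigma:V(T)\to\Sigma$, a run assigns a state to each vertex, top-down: the root receives a state in $Q_{\text{init}}$, and if vertex $u$ has state $q$ and children $v_1,\dots,v_d$, one chooses a rule $(q,\sigma(u))\mapsto(q_1,\ldots,q_d)\in\Delta$ and assigns $q_i$ to $v_i$ (the run fails if no such rule exists;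 leaves need a rule with $d=0$). $\mathcal{A}$ accepts the labeled tree if there is a successful run on the whole tree. For $X\subseteq V(T)$ let $\sigma_X(u)=1$ if $u\in X$ and $0$ otherwise, and $\mathcal{F}(\mathcal{A})=\{X\subseteq V(T):\mathcal{A}\text{ accepts }T\text{ with labels }\sigma_X\}$. Also $p(X)=\sum_{u\in X}p(u)$, $w(X)=\sum_{u\in X}w(u)$. The diversity of transitions is $\delta(n)=\max_{m\le n}\bigl|\{(q_1,\ldots,q_m): (q,\sigma)\mapsto(q_1,\ldots,q_m)\in\Delta \text{ for some } q,\sigma\}\bigr|$. Logarithms are base $2$. *)

theory Defs
  imports Complex_Main
begin

section \<open>Rooted trees with ordered children\<close>

record 'v rooted_tree =
  verts :: "'v set"
  root :: 'v
  children :: "'v \<Rightarrow> 'v list"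

definition edges :: "'v rooted_tree \<Rightarrow> ('v \<times> 'v) set" where
  "edges T = {(u, v). u \<in> verts T \<and> v \<in> set (children T u)}"

definition is_rooted_tree :: "'v rooted_tree \<Rightarrow> bool" where
  "is_rooted_tree T \<longleftrightarrow>
     finite (verts T) \<and> root T \<in> verts T \<and>
     (\<forall>u \<in> verts T. distinct (children T u) \<and> set (children T u) \<subseteq> verts T) \<and>
     (\<forall>u. (u, root T) \<notin> edges T) \<and>
     (\<forall>v \<in> verts T - {root T}. \<exists>!u. (u, v) \<in> edges T) \<and>
     (\<forall>v \<in> verts T. (root T, v) \<in> (edges T)\<^sup>*)"


section \<open>Non-deterministic top-down tree automata\<close>

text \<open>
  A triple \<open>(q, a, qs)\<close> in \<open>rules A\<close> is the rewriting rule \<open>(q, a) \<mapsto> (qs ! 0, ..., qs ! (d - 1))\<close>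
  with \<open>d = length qs\<close>.  The arities of the rules need not be bounded, so \<open>rules A\<close> may be infinite.
\<close>

record ('q, 'a) tree_automaton =
  states :: "'q set"
  alphabet :: "'a set"
  initial :: "'q set"
  rules :: "('q \<times> 'a \<times> 'q list) set"

definition is_tree_automaton :: "('q, 'a) tree_automaton \<Rightarrow> bool" where
  "is_tree_automaton A \<longleftrightarrow>
     finite (states A) \<and> initial A \<subseteq> states A \<and>
     (\<forall>(q, a, qs) \<in> rules A. q \<in> states A \<and> a \<in> alphabet A \<and> set qs \<subseteq> states A)"

definition successful_run ::
    "('q, 'a) tree_automaton \<Rightarrow> 'v rooted_tree \<Rightarrow> ('v \<Rightarrow> 'a) \<Rightarrow> ('v \<Rightarrow> 'q) \<Rightarrow> bool" where
  "successful_run A T lab \<rho> \<longleftrightarrow>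
     \<rho> (root T) \<in> initial A \<and>
     (\<forall>u \<in> verts T. (\<rho> u, lab u, map \<rho> (children T u)) \<in> rules A)"

definition accepts :: "('q, 'a) tree_automaton \<Rightarrow> 'v rooted_tree \<Rightarrow> ('v \<Rightarrow> 'a) \<Rightarrow> bool" where
  "accepts A T lab \<longleftrightarrow> (\<exists>\<rho>. successful_run A T lab \<rho>)"

definition labelling :: "'v set \<Rightarrow> 'v \<Rightarrow> nat" where
  "labelling X u = (if u \<in> X then 1 else 0)"

definition accepted_sets :: "('q, nat) tree_automaton \<Rightarrow> 'v rooted_tree \<Rightarrow> 'v set set" where
  "accepted_sets A T = {X. X \<subseteq> verts T \<and> accepts A T (labelling X)}"

definition diversity :: "('q, 'a) tree_automaton \<Rightarrow> nat \<Rightarrow> nat" where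
  "diversity A n =
     Max ((\<lambda>m. card {qs. length qs = m \<and> (\<exists>q a. (q, a, qs) \<in> rules A)}) ` {..n})"


section \<open>The automaton constrained tree knapsack problem\<close>

text \<open>
  To be given as input to a machine, the vertices and the states are numbered:
  they are \<open>0, ..., n - 1\<close> (in no particular order) and \<open>0, ..., |Q| - 1\<close>.
\<close>

record knapsack =
  tree :: "nat rooted_tree"
  automaton :: "(nat, nat) tree_automaton"
  profit :: "nat \<Rightarrow> real"
  weight :: "nat \<Rightarrow> nat"
  capacity :: nat

definition num_verts :: "knapsack \<Rightarrow> nat" where
  "num_verts I = card (verts (tree I))"

definition num_states :: "knapsack \<Rightarrow> nat" where
  "num_states I = card (states (automaton I))"

definition is_knapsack :: "knapsack \<Rightarrow> bool" where
  "is_knapsack I \<longleftrightarrow>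
     is_rooted_tree (tree I) \<and> verts (tree I) = {..<num_verts I} \<and>
     is_tree_automaton (automaton I) \<and> states (automaton I) = {..<num_states I} \<and>
     alphabet (automaton I) = {0, 1} \<and>
     (\<forall>u \<in> verts (tree I). profit I u \<ge> 0)"

definition feasible :: "knapsack \<Rightarrow> nat set \<Rightarrow> bool" where
  "feasible I X \<longleftrightarrow>
     X \<in> accepted_sets (automaton I) (tree I) \<and> (\<Sum>u\<in>X. weight I u) \<le> capacity I"

definition optimal :: "knapsack \<Rightarrow> nat set \<Rightarrow> bool" where
  "optimal I X \<longleftrightarrow>
     feasible I X \<and> (\<forall>Y. feasible I Y \<longrightarrow> (\<Sum>u\<in>Y. profit I u) \<le> (\<Sum>u\<in>X. profit I u))"


section \<open>Machine model\<close>

text \<open>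
  Algorithms are programs of a random access machine with structured control flow.  The memory
  consists of natural number registers and of unbounded arrays of natural numbers and of real
  numbers, all addressed by name; a program mentions only finitely many names.  Natural numbers
  can be added, subtracted (truncating at zero) and compared; there is deliberately no unit-cost
  multiplication.  Real numbers can only be copied, added and compared.
\<close>

type_synonym vname = string

datatype nexp =
    Const nat
  | Reg vname
  | Get vname nexp
  | Add nexp nexp
  | Sub nexp nexp

datatype rexp =
    RGet vname nexp
  | RAdd rexp rexp

datatype bexp =
    Less nexp nexp
  | RLess rexp rexp
  | BNot bexp
  | BAnd bexp bexp

datatype com =
    Skip
  | Assign vname nexp
  | Put vname nexp nexp
  | RPut vname nexp rexp
  | Seq com com
  | If bexp com com
  | While bexp com

record memory =
  reg :: "vname \<Rightarrow> nat"
  narr :: "vname \<Rightarrow> nat \<Rightarrow> nat"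
  rarr :: "vname \<Rightarrow> nat \<Rightarrow> real"

fun nval :: "nexp \<Rightarrow> memory \<Rightarrow> nat" where
  "nval (Const k) s = k"
| "nval (Reg x) s = reg s x"
| "nval (Get a e) s = narr s a (nval e s)"
| "nval (Add e1 e2) s = nval e1 s + nval e2 s"
| "nval (Sub e1 e2) s = nval e1 s - nval e2 s"

fun rval :: "rexp \<Rightarrow> memory \<Rightarrow> real" where
  "rval (RGet a e) s = rarr s a (nval e s)"
| "rval (RAdd e1 e2) s = rval e1 s + rval e2 s"

fun bval :: "bexp \<Rightarrow> memory \<Rightarrow> bool" where
  "bval (Less e1 e2) s \<longleftrightarrow> nval e1 s < nval e2 s"
| "bval (RLess e1 e2) s \<longleftrightarrow> rval e1 s < rval e2 s"
| "bval (BNot b) s \<longleftrightarrow> \<not> bval b s"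
| "bval (BAnd b1 b2) s \<longleftrightarrow> bval b1 s \<and> bval b2 s"

text \<open>
  \<open>exec c s t s'\<close>: started in memory \<open>s\<close>, the program \<open>c\<close> terminates after \<open>t\<close> steps in memory \<open>s'\<close>.
  Every assignment and every test counts as one step.  As the expressions occurring in a program
  have a fixed size, this agrees with counting single operations up to a constant factor that
  depends on the program only.
\<close>

inductive exec :: "com \<Rightarrow> memory \<Rightarrow> nat \<Rightarrow> memory \<Rightarrow> bool" where
  Skip: "exec Skip s 1 s"
| Assign: "exec (Assign x e) s 1 (s\<lparr>reg := (reg s)(x := nval e s)\<rparr>)"
| Put: "exec (Put a i e) s 1
    (s\<lparr>narr := (narr s)(a := (narr s a)(nval i s := nval e s))\<rparr>)"
| RPut: "exec (RPut a i e) s 1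
    (s\<lparr>rarr := (rarr s)(a := (rarr s a)(nval i s := rval e s))\<rparr>)"
| Seq: "exec c1 s1 t1 s2 \<Longrightarrow> exec c2 s2 t2 s3 \<Longrightarrow> exec (Seq c1 c2) s1 (t1 + t2) s3"
| IfTrue: "bval b s \<Longrightarrow> exec c1 s t s' \<Longrightarrow> exec (If b c1 c2) s (1 + t) s'"
| IfFalse: "\<not> bval b s \<Longrightarrow> exec c2 s t s' \<Longrightarrow> exec (If b c1 c2) s (1 + t) s'"
| WhileFalse: "\<not> bval b s \<Longrightarrow> exec (While b c) s 1 s"
| WhileTrue: "bval b s1 \<Longrightarrow> exec c s1 t1 s2 \<Longrightarrow> exec (While b c) s2 t2 s3 \<Longrightarrow>
    exec (While b c) s1 (1 + t1 + t2) s3"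

inductive_cases exec_SkipE: "exec Skip s t s'"
inductive_cases exec_AssignE: "exec (Assign x e) s t s'"
inductive_cases exec_PutE: "exec (Put a i e) s t s'"
inductive_cases exec_RPutE: "exec (RPut a i e) s t s'"
inductive_cases exec_SeqE: "exec (Seq c1 c2) s t s'"
inductive_cases exec_IfE: "exec (If b c1 c2) s t s'"
inductive_cases exec_WhileE: "exec (While b c) s t s'"

lemma exec_deterministic:
  "exec c s t s' \<Longrightarrow> exec c s u s'' \<Longrightarrow> u = t \<and> s'' = s'"
proof (induction arbitrary: u s'' rule: exec.induct)
  case (Seq c1 s1 t1 s2 c2 t2 s3)
  from Seq.prems obtain v1 r v2
    where "u = v1 + v2" and r: "exec c1 s1 v1 r" "exec c2 r v2 s''"
    by (rule exec_SeqE)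
  moreover from r(1) have "v1 = t1 \<and> r = s2" by (rule Seq.IH(1))
  moreover from this r(2) have "v2 = t2 \<and> s'' = s3" by (intro Seq.IH(2)) simp
  ultimately show ?case by simp
next
  case (IfTrue b s c1 t s' c2)
  from IfTrue.prems IfTrue.hyps obtain v where "u = 1 + v" "exec c1 s v s''"
    by (auto elim: exec_IfE)
  with IfTrue.IH show ?case by simp
next
  case (IfFalse b s c2 t s' c1)
  from IfFalse.prems IfFalse.hyps obtain v where "u = 1 + v" "exec c2 s v s''"
    by (auto elim: exec_IfE)
  with IfFalse.IH show ?case by simp
next
  case (WhileFalse b s c)
  from WhileFalse.prems WhileFalse.hyps show ?case
    by (auto elim: exec_WhileE)
next
  case (WhileTrue b s1 c t1 s2 t2 s3)
  from WhileTrue.prems obtain v1 r v2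
    where "u = 1 + v1 + v2" and r: "exec c s1 v1 r" "exec (While b c) r v2 s''"
    by (rule exec_WhileE) (use WhileTrue.hyps(1) in simp_all)
  moreover from r(1) have "v1 = t1 \<and> r = s2" by (rule WhileTrue.IH(1))
  moreover from this r(2) have "v2 = t2 \<and> s'' = s3" by (intro WhileTrue.IH(2)) simp
  ultimately show ?case by simp
qed (auto elim: exec_SkipE exec_AssignE exec_PutE exec_RPutE)


section \<open>Input format and correctness\<close>

definition array :: "'a::zero list \<Rightarrow> nat \<Rightarrow> 'a" where
  "array xs i = (if i < length xs then xs ! i else 0)"

text \<open>
  A list of lists \<open>xss\<close> is stored as the array of the entries of \<open>concat xss\<close>, together with the
  array of offsets: \<open>xss ! i\<close> occupies the positions from \<open>offsets xss ! i\<close> up to (and excluding)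
  \<open>offsets xss ! (i + 1)\<close>.
\<close>

definition offsets :: "'a list list \<Rightarrow> nat list" where
  "offsets xss = map (\<lambda>i. length (concat (take i xss))) [0..<length xss + 1]"

text \<open>
  The rules are stored as a list, in an arbitrary order and without repetitions.  Only rules of
  arity at most \<open>n\<close> are listed (there are finitely many of them); no other rule can be used in a
  run on a tree with \<open>n\<close> vertices.
\<close>

definition lists_rules :: "(nat \<times> nat \<times> nat list) list \<Rightarrow> knapsack \<Rightarrow> bool" where
  "lists_rules rs I \<longleftrightarrow>
     distinct rs \<and> set rs = {(q, a, qs) \<in> rules (automaton I). length qs \<le> num_verts I}"

definition input_memory :: "knapsack \<Rightarrow> (nat \<times> nat \<times> nat list) list \<Rightarrow> memory" where
  "input_memory I rs =
    (let vs = [0..<num_verts I];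
         chs = map (children (tree I)) vs;
         rhss = map (\<lambda>(q, a, qs). qs) rs
     in \<lparr> reg = (\<lambda>_. 0)
            (''n'' := num_verts I,
             ''root'' := root (tree I),
             ''num_states'' := num_states I,
             ''num_rules'' := length rs,
             ''capacity'' := capacity I),
          narr = (\<lambda>_ _. 0)
            (''child_offset'' := array (offsets chs),
             ''child'' := array (concat chs),
             ''initial'' := array (map (\<lambda>q. if q \<in> initial (automaton I) then 1 else 0)
                                      [0..<num_states I]),
             ''rule_state'' := array (map (\<lambda>(q, a, qs). q) rs),
             ''rule_symbol'' := array (map (\<lambda>(q, a, qs). a) rs),
             ''rule_offset'' := array (offsets rhss),
             ''rule_rhs'' := array (concat rhss),
             ''weight'' := array (map (weight I) vs)),
          rarr = (\<lambda>_ _. 0)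
            (''profit'' := array (map (profit I) vs)) \<rparr>)"

definition output_set :: "knapsack \<Rightarrow> memory \<Rightarrow> nat set" where
  "output_set I s = {u \<in> verts (tree I). narr s ''solution'' u = 1}"

text \<open>
  The program must report whether there is a feasible set at all, and in this case it must
  return an optimal one.
\<close>

definition correct_output :: "knapsack \<Rightarrow> memory \<Rightarrow> bool" where
  "correct_output I s \<longleftrightarrow>
     (if \<exists>X. feasible I X
      then reg s ''feasible'' = 1 \<and> optimal I (output_set I s)
      else reg s ''feasible'' = 0)"

definition solves_within ::
    "com \<Rightarrow> knapsack \<Rightarrow> (nat \<times> nat \<times> nat list) list \<Rightarrow> real \<Rightarrow> bool" where
  "solves_within prog I rs B \<longleftrightarrow>
     (\<exists>t s. exec prog (input_memory I rs) t s \<and> real t \<le> B \<and> correct_output I s)"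

end

theory Submission
  imports Defs "HOL-Library.Multiset"
begin

text \<open>
  The vertices are visited in preorder, the child with the largest subtree last.  A run of the
  automaton is then a run of a pushdown machine whose stack holds the states of the vertices waiting
  to be visited, and the knapsack table (maximal profit for every weight up to \<open>C\<close>) is kept for each
  reachable stack.  While a subtree is being visited, the part of the stack belonging to waiting
  siblings is determined by one right-hand side per ancestor that was entered through a light edge,
  so at a vertex below \<open>k\<close> light edges there are at most \<open>|Q| * \<delta> ^ k\<close> stacks.  With
  \<open>a = log 2 (1 + \<delta>)\<close>, the inequality \<open>x ^ a + \<delta> * y ^ a \<le> (x + y) ^ a\<close> for \<open>y \<le> x\<close> shows that
  \<open>\<delta> ^ k\<close> summed over all vertices is at most \<open>n ^ a\<close>.  Every table cell holds a pointer to an immutable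
  linked list of the labels chosen so far, from which an optimal set is read off in linear time.
\<close>

section \<open>Weakest preconditions with elapsed time\<close>

text \<open>The familiar bottom-up scheme merges the tables of siblings by a convolution, which is
  quadratic in \<open>C\<close>. Walking through the vertices one at a time replaces merging by
  adding one labelled vertex to a table, in time linear in \<open>C\<close>; the price is that the
  states promised to waiting siblings must be remembered, and this is what the stacks are for. A
  bound on the number of stacks is not yet a bound on the time: each stack meets all rules of the
  arity \<open>d\<close> of its vertex, and pushing a right-hand side takes about
  \<open>d + 1\<close> steps. The slack comes from subtracting a constant from the share of
  \<open>n ^ a\<close> that a subtree receives: a vertex gets this constant back
  \<open>\<delta>\<close> times for each light child. The machine has no multiplication, so table
  addresses are built by repeated addition and stored. Its arrays start as zero, so 0 is the null
  value of all data structures, pointers and marks are shifted away from 0, and nothing is ever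
  cleared.\<close>

definition wp :: "com \<Rightarrow> (memory \<Rightarrow> nat \<Rightarrow> bool) \<Rightarrow> memory \<Rightarrow> nat \<Rightarrow> bool" where
  "wp c Q s m \<longleftrightarrow> (\<exists>t s'. exec c s t s' \<and> Q s' (m + t))"

lemma wp_Skip [simp]: "wp Skip Q s m \<longleftrightarrow> Q s (m + 1)"
  by (auto simp: wp_def elim!: exec_SkipE) (intro exI conjI, rule exec.Skip, simp)

lemma wp_Assign [simp]:
  "wp (Assign x e) Q s m \<longleftrightarrow> Q (s\<lparr>reg := (reg s)(x := nval e s)\<rparr>) (m + 1)"
  by (auto simp: wp_def elim!: exec_AssignE) (intro exI conjI, rule exec.Assign, simp)

lemma wp_Put [simp]:
  "wp (Put a i e) Q s m \<longleftrightarrow>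
     Q (s\<lparr>narr := (narr s)(a := (narr s a)(nval i s := nval e s))\<rparr>) (m + 1)"
  by (auto simp: wp_def elim!: exec_PutE) (intro exI conjI, rule exec.Put, simp)

lemma wp_RPut [simp]:
  "wp (RPut a i e) Q s m \<longleftrightarrow>
     Q (s\<lparr>rarr := (rarr s)(a := (rarr s a)(nval i s := rval e s))\<rparr>) (m + 1)"
  by (auto simp: wp_def elim!: exec_RPutE) (intro exI conjI, rule exec.RPut, simp)

lemma wp_Seq [simp]: "wp (Seq c1 c2) Q s m \<longleftrightarrow> wp c1 (wp c2 Q) s m"
  by (auto simp: wp_def add.assoc elim!: exec_SeqE) (blast intro: exec.Seq)+

lemma wp_If [simp]:
  "wp (If b c1 c2) Q s m \<longleftrightarrow> (if bval b s then wp c1 Q s (m + 1) else wp c2 Q s (m + 1))"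
  by (auto simp: wp_def elim!: exec_IfE intro: exec.IfTrue exec.IfFalse)
    (metis add.assoc exec.IfTrue exec.IfFalse plus_1_eq_Suc add_Suc_right add_Suc)+

lemma wp_mono: "wp c P s m \<Longrightarrow> (\<And>s' m'. P s' m' \<Longrightarrow> Q s' m') \<Longrightarrow> wp c Q s m"
  unfolding wp_def by blast

fun wregs :: "com \<Rightarrow> vname set" where
  "wregs (Assign x e) = {x}"
| "wregs (Seq c1 c2) = wregs c1 \<union> wregs c2"
| "wregs (If b c1 c2) = wregs c1 \<union> wregs c2"
| "wregs (While b c) = wregs c"
| "wregs _ = {}"

fun wnarrs :: "com \<Rightarrow> vname set" where
  "wnarrs (Put a i e) = {a}"
| "wnarrs (Seq c1 c2) = wnarrs c1 \<union> wnarrs c2"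
| "wnarrs (If b c1 c2) = wnarrs c1 \<union> wnarrs c2"
| "wnarrs (While b c) = wnarrs c"
| "wnarrs _ = {}"

fun wrarrs :: "com \<Rightarrow> vname set" where
  "wrarrs (RPut a i e) = {a}"
| "wrarrs (Seq c1 c2) = wrarrs c1 \<union> wrarrs c2"
| "wrarrs (If b c1 c2) = wrarrs c1 \<union> wrarrs c2"
| "wrarrs (While b c) = wrarrs c"
| "wrarrs _ = {}"

text \<open>A purely syntactic frame condition. Invariants mention only what changes; everything
  else, in particular the input, is recovered through \<open>agree\<close>.\<close>

definition agree :: "com \<Rightarrow> memory \<Rightarrow> memory \<Rightarrow> bool" where
  "agree c s s' \<longleftrightarrow> (\<forall>x. x \<notin> wregs c \<longrightarrow> reg s' x = reg s x) \<and>
     (\<forall>a. a \<notin> wnarrs c \<longrightarrow> narr s' a = narr s a) \<and> (\<forall>a. a \<notin> wrarrs c \<longrightarrow> rarr s' a = rarr s a)"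

lemma agree_reg: "agree c s s' \<Longrightarrow> x \<notin> wregs c \<Longrightarrow> reg s' x = reg s x"
  and agree_narr: "agree c s s' \<Longrightarrow> a \<notin> wnarrs c \<Longrightarrow> narr s' a = narr s a"
  and agree_rarr: "agree c s s' \<Longrightarrow> a \<notin> wrarrs c \<Longrightarrow> rarr s' a = rarr s a"
  by (auto simp: agree_def)

lemmas agreeD = agree_reg agree_narr agree_rarr

lemma exec_agree: "exec c s t s' \<Longrightarrow> agree c s s'"
  by (induction rule: exec.induct) (auto simp: agree_def)

lemma wp_conseq:
  assumes "wp c P s m" "\<And>s' m'. P s' m' \<Longrightarrow> agree c s s' \<Longrightarrow> Q s' m'"
  shows "wp c Q s m"
  using assms exec_agree unfolding wp_def by blast

text \<open>\<open>exec\<close> relates only terminating runs, so the invariant carries a natural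
  number that drops in each round. \<open>step\<close> and \<open>exit\<close> may also use the
  frame condition relative to the memory before the loop.\<close>

lemma wp_While:
  fixes k :: nat
  assumes "Inv k s m"
    and step: "\<And>k s' m'. Inv k s' m' \<Longrightarrow> agree c s s' \<Longrightarrow> bval b s' \<Longrightarrow>
      wp c (\<lambda>s'' m''. \<exists>k'<k. Inv k' s'' m'') s' (m' + 1)"
    and exit: "\<And>k s' m'. Inv k s' m' \<Longrightarrow> agree c s s' \<Longrightarrow> \<not> bval b s' \<Longrightarrow> Q s' (m' + 1)"
  shows "wp (While b c) Q s m"
proof -
  have "Inv k s' m' \<Longrightarrow> agree c s s' \<Longrightarrow> wp (While b c) Q s' m'" for k :: nat and s' m'
  proof (induction k arbitrary: s' m' rule: less_induct)
    case (less k)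
    show ?case
    proof (cases "bval b s'")
      case True
      from step[OF less.prems True] obtain t1 s2 k'
        where t1: "exec c s' t1 s2" "k' < k" "Inv k' s2 (m' + 1 + t1)"
        by (auto simp: wp_def)
      have "agree c s s2"
        using less.prems(2) exec_agree[OF t1(1)] by (auto simp: agree_def)
      from less.IH[OF t1(2,3) this] obtain t2 s3
        where "exec (While b c) s2 t2 s3" "Q s3 (m' + 1 + t1 + t2)" by (auto simp: wp_def)
      with t1(1) True show ?thesis
        unfolding wp_def by (metis add.assoc exec.WhileTrue)
    next
      case False
      with exit[OF less.prems] show ?thesis
        unfolding wp_def by (blast intro: exec.WhileFalse)
    qed
  qed
  with assms(1) show ?thesis by (simp add: agree_def)
qed

definition For :: "vname \<Rightarrow> nexp \<Rightarrow> com \<Rightarrow> com" where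
  "For x e c = Seq (Assign x (Const 0))
     (While (Less (Reg x) e) (Seq c (Assign x (Add (Reg x) (Const 1)))))"

lemma writes_For [simp]: "wregs (For x e c) = insert x (wregs c)"
  "wnarrs (For x e c) = wnarrs c" "wrarrs (For x e c) = wrarrs c"
  by (auto simp: For_def)

text \<open>The invariant gets the round number as an argument instead of reading the counter, hence
  \<open>indep\<close>. The two increments of the time account for the test before the body and for
  the counter update after it.\<close>

lemma wp_For:
  assumes indep: "\<And>k s m v. Inv k (s\<lparr>reg := (reg s)(x := v)\<rparr>) m \<longleftrightarrow> Inv k s m"
    and x: "x \<notin> wregs c"
    and e: "\<And>s'. agree (For x e c) s s' \<Longrightarrow> nval e s' = N"
    and init: "Inv 0 s (m + 1)"
    and step: "\<And>k s' m'. Inv k s' m' \<Longrightarrow> k < N \<Longrightarrow> reg s' x = k \<Longrightarrow> agree (For x e c) s s' \<Longrightarrow>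
      wp c (\<lambda>s'' m''. Inv (Suc k) s'' (m'' + 1)) s' (m' + 1)"
    and exit: "\<And>s' m'. Inv N s' m' \<Longrightarrow> reg s' x = N \<Longrightarrow> agree (For x e c) s s' \<Longrightarrow> Q s' (m' + 1)"
  shows "wp (For x e c) Q s m"
proof -
  let ?s0 = "s\<lparr>reg := (reg s)(x := 0)\<rparr>"
  let ?c = "Seq c (Assign x (Add (Reg x) (Const 1)))"
  have ag: "agree (For x e c) s s'" if "agree ?c ?s0 s'" for s'
    using that by (auto simp: agree_def)
  have "wp (While (Less (Reg x) e) ?c) Q ?s0 (m + 1)"
  proof (rule wp_While[where k = N and Inv = "\<lambda>k s m. k + reg s x = N \<and> Inv (reg s x) s m"])
    show "N + reg ?s0 x = N \<and> Inv (reg ?s0 x) ?s0 (m + 1)"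
      using init indep by simp
  next
    fix k s' m'
    assume *: "k + reg s' x = N \<and> Inv (reg s' x) s' m'" "agree ?c ?s0 s'" "bval (Less (Reg x) e) s'"
    have N: "reg s' x < N" using *(3) e[OF ag[OF *(2)]] by simp
    have "wp c (\<lambda>s'' m''. Inv (Suc (reg s' x)) s'' (m'' + 1)) s' (m' + 1)"
      by (rule step) (use * N ag in auto)
    then have "wp c (wp (Assign x (Add (Reg x) (Const 1)))
        (\<lambda>s'' m''. \<exists>k'<k. k' + reg s'' x = N \<and> Inv (reg s'' x) s'' m'')) s' (m' + 1)"
      by (rule wp_conseq) (use N x * in \<open>auto simp: indep agree_reg intro!: exI[of _ "k - 1"]\<close>)
    then show "wp ?c (\<lambda>s'' m''. \<exists>k'<k. k' + reg s'' x = N \<and> Inv (reg s'' x) s'' m'') s' (m' + 1)"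
      by simp
  next
    fix k s' m'
    assume *: "k + reg s' x = N \<and> Inv (reg s' x) s' m'" "agree ?c ?s0 s'" "\<not> bval (Less (Reg x) e) s'"
    then have "reg s' x = N" using e[OF ag[OF *(2)]] by auto
    with *(1) have "Inv N s' m'" "reg s' x = N" by auto
    then show "Q s' (m' + 1)" using exit ag[OF *(2)] by blast
  qed
  then show ?thesis by (simp add: For_def)
qed

abbreviation seq :: "com \<Rightarrow> com \<Rightarrow> com" (infixr \<open>;;\<close> 60) where "c1 ;; c2 \<equiv> Seq c1 c2"
abbreviation assign :: "vname \<Rightarrow> nexp \<Rightarrow> com" (infix \<open>::=\<close> 61) where "x ::= e \<equiv> Assign x e"


section \<open>Traversals of a rooted tree with a list of pending vertices\<close>

locale traversal =
  fixes T :: "'v rooted_tree" and pend :: "nat \<Rightarrow> 'v list"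
  assumes tree: "is_rooted_tree T"
    and pend_0: "pend 0 = [root T]"
    and pend_Suc: "pend i \<noteq> [] \<Longrightarrow>
      mset (pend (Suc i)) = mset (children T (hd (pend i))) + mset (tl (pend i))"
begin

definition visit :: "nat \<Rightarrow> 'v" where "visit i = hd (pend i)"

text \<open>One visit extends this list, up to order, by the children of the visited vertex. As
  \<open>pend_Suc\<close> fixes only the multiset, the same facts serve a stack (preorder) and a
  queue (breadth-first order).\<close>

definition seen :: "nat \<Rightarrow> 'v list" where "seen i = map visit [0..<i] @ pend i"

lemma mset_seen_Suc:
  assumes "pend i \<noteq> []"
  shows "mset (seen (Suc i)) = mset (seen i @ children T (visit i))"
proof -
  have "mset (pend i) = add_mset (visit i) (mset (tl (pend i)))"
    using assms by (cases "pend i") (auto simp: visit_def)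
  then show ?thesis using pend_Suc[OF assms] by (simp add: seen_def visit_def)
qed

text \<open>The last conjunct drives the induction: a child of the next vertex that had been seen
  before would be the root or have a second parent. Hence the seen vertices stay distinct.\<close>

lemma seen_invariant:
  assumes "\<And>j. j < i \<Longrightarrow> pend j \<noteq> []"
  shows "distinct (seen i) \<and> set (seen i) \<subseteq> verts T \<and> root T \<in> set (seen i) \<and>
    (\<forall>j<i. set (children T (visit j)) \<subseteq> set (seen i)) \<and>
    (\<forall>v\<in>set (seen i). v = root T \<or> (\<exists>j<i. v \<in> set (children T (visit j))))"
  using assms
proof (induction i)
  case 0
  then show ?case using tree by (simp add: seen_def pend_0 is_rooted_tree_def)
next
  case (Suc i)
  have ne: "pend i \<noteq> []" using Suc.prems by simp
  note IH = Suc.IH[OF Suc.prems, OF less_SucI]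
  have set_eq: "set (seen (Suc i)) = set (seen i) \<union> set (children T (visit i))"
    using mset_eq_setD[OF mset_seen_Suc[OF ne]] by simp
  have vi: "visit i \<in> set (pend i)" using ne by (simp add: visit_def)
  have viV: "visit i \<in> verts T" using IH vi by (auto simp: seen_def)
  have new: "c \<notin> set (seen i)" if c: "c \<in> set (children T (visit i))" for c
  proof
    assume "c \<in> set (seen i)"
    then consider "c = root T" | j where "j < i" "c \<in> set (children T (visit j))" using IH by blast
    then show False
    proof cases
      case 1
      then show False using c viV tree by (auto simp: is_rooted_tree_def edges_def)
    next
      case 2
      have vj: "visit j \<in> set (map visit [0..<i])" using 2 by simp
      then have vjV: "visit j \<in> verts T" using IH by (auto simp: seen_def)
      have e: "(visit j, c) \<in> edges T" "(visit i, c) \<in> edges T"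
        using vjV viV 2 c by (auto simp: edges_def)
      have "c \<in> verts T" using c viV tree by (auto simp: is_rooted_tree_def)
      moreover have "c \<noteq> root T" using e tree by (auto simp: is_rooted_tree_def)
      ultimately have "visit j = visit i"
        using e tree unfolding is_rooted_tree_def by (metis Diff_iff singletonD)
      then show False using vj vi IH by (auto simp: seen_def)
    qed
  qed
  have "distinct (seen i @ children T (visit i))"
    using IH new viV tree by (auto simp: is_rooted_tree_def)
  then have "distinct (seen (Suc i))"
    using mset_eq_imp_distinct_iff[OF mset_seen_Suc[OF ne]] by blast
  moreover have "set (seen (Suc i)) \<subseteq> verts T"
    using IH set_eq viV tree by (auto simp: is_rooted_tree_def)
  ultimately show ?case using IH set_eq by (auto simp: less_Suc_eq)
qed

text \<open>If the pending list ran empty early, the visited vertices would contain the root and be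
  closed under edges, hence be all of \<open>verts T\<close>, which has more than \<open>i\<close>
  elements.\<close>

lemma pend_nonempty: "i < card (verts T) \<Longrightarrow> pend i \<noteq> []"
proof (induction i rule: less_induct)
  case (less i)
  have fin: "finite (verts T)" using tree by (simp add: is_rooted_tree_def)
  have "\<And>j. j < i \<Longrightarrow> pend j \<noteq> []" using less by simp
  note inv = seen_invariant[of i, OF this]
  show ?case
  proof
    assume e: "pend i = []"
    have s: "set (seen i) = visit ` {..<i}" using e by (auto simp: seen_def)
    have closed: "v \<in> set (seen i)" if "u \<in> set (seen i)" "(u, v) \<in> edges T" for u v
      using inv that unfolding s edges_def by auto
    have "v \<in> set (seen i)" if "(root T, v) \<in> (edges T)\<^sup>*" for v
      using that by induction (use inv closed in auto)
    then have "verts T \<subseteq> visit ` {..<i}" using tree s by (auto simp: is_rooted_tree_def)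
    then have "card (verts T) \<le> i"
      by (metis card_image_le card_lessThan card_mono finite_imageI finite_lessThan le_trans)
    with less.prems show False by simp
  qed
qed

lemma
  assumes "i \<le> card (verts T)"
  shows distinct_seen: "distinct (seen i)"
    and seen_verts: "set (seen i) \<subseteq> verts T"
    and children_seen: "j < i \<Longrightarrow> set (children T (visit j)) \<subseteq> set (seen i)"
proof -
  have "\<And>j. j < i \<Longrightarrow> pend j \<noteq> []" using assms pend_nonempty by simp
  from seen_invariant[OF this] show "distinct (seen i)" "set (seen i) \<subseteq> verts T"
    "j < i \<Longrightarrow> set (children T (visit j)) \<subseteq> set (seen i)" by auto
qed

lemma seen_all: "set (map visit [0..<card (verts T)]) = verts T"
  and pend_all: "pend (card (verts T)) = []"
proof -
  let ?n = "card (verts T)"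
  have fin: "finite (verts T)" using tree by (simp add: is_rooted_tree_def)
  have d: "distinct (seen ?n)" and s: "set (seen ?n) \<subseteq> verts T"
    using distinct_seen seen_verts by auto
  have "card (set (map visit [0..<?n])) = ?n"
    using d distinct_card[of "map visit [0..<?n]"] by (simp add: seen_def)
  then show *: "set (map visit [0..<?n]) = verts T"
    using s card_subset_eq[OF fin] by (simp add: seen_def)
  show "pend ?n = []"
  proof (rule ccontr)
    assume "pend ?n \<noteq> []"
    then have "hd (pend ?n) \<in> set (pend ?n)" by simp
    then show False using d s * by (auto simp: seen_def)
  qed
qed

lemma visit_verts: "i < card (verts T) \<Longrightarrow> visit i \<in> verts T"
  using seen_all by (metis atLeast0LessThan imageI lessThan_iff list.set_map set_upt)

lemma visit_inj: "i < card (verts T) \<Longrightarrow> j < card (verts T) \<Longrightarrow> visit i = visit j \<Longrightarrow> i = j"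
  using distinct_seen[of "card (verts T)"]
  by (auto simp: seen_def distinct_map inj_on_def)

lemma visit_obtain:
  assumes "v \<in> verts T" obtains k where "k < card (verts T)" "v = visit k"
proof -
  have "v \<in> visit ` {..<card (verts T)}" using assms seen_all by (simp add: atLeast0LessThan)
  then show ?thesis using that by blast
qed

text \<open>The reversed order of visits is therefore bottom-up; this allows subtree sizes to be
  computed without recursion.\<close>

lemma child_visited_later:
  assumes "i < card (verts T)" "v \<in> set (children T (visit i))"
  obtains k where "i < k" "k < card (verts T)" "v = visit k"
proof -
  have ne: "pend i \<noteq> []" using pend_nonempty assms(1) .
  have "v \<in> set (pend (Suc i))"
    using assms(2) mset_eq_setD[OF pend_Suc[OF ne, folded mset_append]] by (simp add: visit_def)
  moreover have "set (map visit [0..<Suc i]) \<inter> set (pend (Suc i)) = {}"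
    using distinct_seen[of "Suc i"] assms(1) by (simp only: seen_def distinct_append Suc_le_eq)
  ultimately have "v \<notin> visit ` {..<Suc i}" by (simp only: list.set_map set_upt atLeast0LessThan) blast
  moreover have "v \<in> verts T"
    using \<open>v \<in> set (pend (Suc i))\<close> seen_verts[of "Suc i"] assms(1) by (auto simp: seen_def)
  moreover obtain k where "k < card (verts T)" "v = visit k"
    using visit_obtain[OF \<open>v \<in> verts T\<close>] .
  ultimately show ?thesis by (intro that[of k]) (auto simp: not_less_eq[symmetric])
qed

text \<open>The number of visits plus the values of the pending vertices is constant, because
  replacing a vertex by its children loses exactly 1. So any solution of the recursion takes the
  right value at the root.\<close>

lemma sum_children:
  assumes "\<And>u. u \<in> verts T \<Longrightarrow> sz u = 1 + (\<Sum>v\<leftarrow>children T u. sz v)"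
  shows "sz (root T) = card (verts T)"
proof -
  have "i \<le> card (verts T) \<Longrightarrow> (\<Sum>v\<leftarrow>pend i. sz v) + i = sz (root T)" for i
  proof (induction i)
    case (Suc i)
    then have ne: "pend i \<noteq> []" and v: "visit i \<in> verts T"
      using pend_nonempty visit_verts by auto
    have "(\<Sum>v\<leftarrow>pend (Suc i). sz v) = sum_mset (image_mset sz (mset (pend (Suc i))))"
      by (metis mset_map sum_mset_sum_list)
    also have "\<dots> = (\<Sum>v\<leftarrow>children T (visit i). sz v) + (\<Sum>v\<leftarrow>tl (pend i). sz v)"
      using pend_Suc[OF ne] by (simp add: visit_def flip: sum_mset_sum_list)
    also have "\<dots> + Suc i = (\<Sum>v\<leftarrow>pend i. sz v) + i"
      using assms[OF v] ne by (cases "pend i") (auto simp: visit_def)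
    finally show ?case using Suc by simp
  qed (simp add: pend_0)
  from this[of "card (verts T)"] show ?thesis by (simp add: pend_all)
qed

text \<open>Each visit removes one pending vertex and adds its children; the inequality is strict
  because the root is pending without being a child. Work proportional to the degrees is thereby
  linear in total.\<close>

lemma sum_length_children: "(\<Sum>i<card (verts T). length (children T (visit i))) < card (verts T)"
proof -
  have n: "0 < card (verts T)" using tree by (auto simp: is_rooted_tree_def card_gt_0_iff)
  have "i \<le> card (verts T) \<Longrightarrow> length (pend i) + i = Suc (\<Sum>j<i. length (children T (visit j)))" for i
  proof (induction i)
    case (Suc i)
    then have ne: "pend i \<noteq> []" using pend_nonempty by simp
    have "length (pend (Suc i)) = length (children T (visit i)) + length (tl (pend i))"
      using arg_cong[OF pend_Suc[OF ne], of size] by (simp add: visit_def)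
    with Suc ne show ?case by (cases "pend i") auto
  qed (simp add: pend_0)
  from this[of "card (verts T)"] show ?thesis using n by (simp add: pend_all)
qed

end


section \<open>Growth of powers\<close>

text \<open>Division by \<open>y\<close> reduces the claim to \<open>y = 1\<close>, where
  \<open>(t + 1) powr a - t powr a\<close> grows with \<open>t\<close> and equals
  \<open>\<delta>\<close> at \<open>t = 1\<close>. So \<open>a\<close> is the exponent for which two
  subtrees of equal size give equality.\<close>

lemma powr_add_ge:
  fixes a x y \<delta> :: real
  assumes a: "1 \<le> a" and \<delta>: "1 + \<delta> = 2 powr a" and y: "0 \<le> y" "y \<le> x"
  shows "x powr a + \<delta> * y powr a \<le> (x + y) powr a"
proof (cases "y = 0")
  case False
  define s where "s = x / y"
  have s: "1 \<le> s" "x = s * y" and y0: "0 < y" using False y by (auto simp: s_def field_simps)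
  have "(1 + 1) powr a - 1 powr a \<le> (s + 1) powr a - s powr a"
  proof (rule DERIV_nonneg_imp_nondecreasing[OF s(1), where f = "\<lambda>t. (t + 1) powr a - t powr a"])
    fix t :: real assume t: "1 \<le> t"
    have "((\<lambda>t. (t + 1) powr a - t powr a) has_real_derivative
        a * (t + 1) powr (a - 1) - a * t powr (a - 1)) (at t)"
      using t by (auto intro!: derivative_eq_intros)
    moreover have "0 \<le> a * (t + 1) powr (a - 1) - a * t powr (a - 1)"
      using a t by (simp add: mult_left_mono powr_mono2)
    ultimately show "\<exists>D. ((\<lambda>t. (t + 1) powr a - t powr a) has_real_derivative D) (at t) \<and> 0 \<le> D"
      by blast
  qed
  then have "s powr a + \<delta> \<le> (s + 1) powr a" using \<delta> by simp
  then have "(s powr a + \<delta>) * y powr a \<le> (s + 1) powr a * y powr a"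
    by (rule mult_right_mono) simp
  also have "\<dots> = ((s + 1) * y) powr a" using s y0 by (simp add: powr_mult)
  finally show ?thesis using s y0 by (simp add: powr_mult algebra_simps)
qed (use a in simp)

text \<open>The light parts are added one at a time: each is at most \<open>x\<close>, hence at most
  the sum accumulated so far, which is the larger argument of \<open>powr_add_ge\<close>.\<close>

lemma powr_add_sum_ge:
  fixes a x \<delta> :: real
  assumes a: "1 \<le> a" and \<delta>: "1 + \<delta> = 2 powr a"
    and "finite J" "\<And>j. j \<in> J \<Longrightarrow> 0 \<le> y j \<and> y j \<le> x" "0 \<le> x"
  shows "x powr a + \<delta> * (\<Sum>j\<in>J. y j powr a) \<le> (x + (\<Sum>j\<in>J. y j)) powr a"
  using assms(3,4,5)
proof (induction J rule: finite_induct)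
  case (insert k J)
  let ?z = "x + (\<Sum>j\<in>J. y j)"
  have "0 \<le> (\<Sum>j\<in>J. y j)" using insert by (intro sum_nonneg) auto
  then have "y k \<le> ?z" using insert(4)[of k] by simp
  then have "?z powr a + \<delta> * y k powr a \<le> (?z + y k) powr a"
    using powr_add_ge[OF a \<delta>] insert(4)[of k] by simp
  moreover have "x powr a + \<delta> * (\<Sum>j\<in>J. y j powr a) \<le> ?z powr a" using insert by simp
  ultimately show ?case using insert by (simp add: algebra_simps)
qed simp


section \<open>The instance and the number of its rules\<close>

locale knap =
  fixes I :: knapsack and rs :: "(nat \<times> nat \<times> nat list) list"
  assumes is_knapsack: "is_knapsack I" and lists_rules: "lists_rules rs I"
begin

abbreviation n where "n \<equiv> num_verts I"
abbreviation B where "B \<equiv> num_states I"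
abbreviation C where "C \<equiv> capacity I"
abbreviation ch where "ch \<equiv> children (tree I)"
abbreviation \<delta> where "\<delta> \<equiv> diversity (automaton I) n"
abbreviation inits where "inits \<equiv> initial (automaton I)"

definition rhss :: "nat \<Rightarrow> nat list set" where
  "rhss d = {qs. length qs = d \<and> (\<exists>q a. (q, a, qs) \<in> rules (automaton I))}"

lemma is_tree: "is_rooted_tree (tree I)"
  and verts: "verts (tree I) = {..<n}"
  and states: "states (automaton I) = {..<B}"
  using is_knapsack by (auto simp: is_knapsack_def)

lemma card_verts [simp]: "card (verts (tree I)) = n"
  by (simp add: num_verts_def)

lemma root_less: "root (tree I) < n" and n_pos: "0 < n"
  using is_tree verts by (auto simp: is_rooted_tree_def)

lemma distinct_ch: "u < n \<Longrightarrow> distinct (ch u)"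
  and ch_less: "u < n \<Longrightarrow> v \<in> set (ch u) \<Longrightarrow> v < n"
  using is_tree verts by (auto simp: is_rooted_tree_def)

lemma length_ch: assumes "u < n" shows "length (ch u) \<le> n"
proof -
  have "card (set (ch u)) \<le> card {..<n}"
    using ch_less[OF assms] by (intro card_mono) auto
  then show ?thesis using distinct_card[OF distinct_ch[OF assms]] by simp
qed

lemma inits_less: "q \<in> inits \<Longrightarrow> q < B"
  using is_knapsack by (auto simp: is_knapsack_def is_tree_automaton_def)

lemma rule_in_range:
  assumes "(q, a, qs) \<in> rules (automaton I)"
  shows "q < B" "a = 0 \<or> a = 1" "set qs \<subseteq> {..<B}"
proof -
  have "is_tree_automaton (automaton I)" "alphabet (automaton I) = {0, 1}"
    using is_knapsack by (simp_all add: is_knapsack_def)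
  then have "q \<in> {..<B} \<and> a \<in> {0, 1} \<and> set qs \<subseteq> {..<B}"
    using assms unfolding is_tree_automaton_def states by blast
  then show "q < B" "a = 0 \<or> a = 1" "set qs \<subseteq> {..<B}" by auto
qed

lemma set_rs: "(q, a, qs) \<in> set rs \<longleftrightarrow> (q, a, qs) \<in> rules (automaton I) \<and> length qs \<le> n"
  and distinct_rs: "distinct rs"
  using lists_rules by (auto simp: lists_rules_def)

lemma finite_rhss: "finite (rhss d)"
  by (rule finite_subset[OF _ finite_lists_length_eq[of "{..<B}" d]])
    (auto simp: rhss_def dest: rule_in_range(3))

lemma card_rhss_le_diversity: "d \<le> n \<Longrightarrow> card (rhss d) \<le> \<delta>"
  unfolding diversity_def rhss_def by (intro Max_ge) auto

text \<open>Serves for arities 0 and 1: such a vertex has no light child to which a factor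
  \<open>\<delta>\<close> could be charged, so a bound in terms of \<open>B\<close> alone is
  wanted.\<close>

lemma card_rhss_le_power: "card (rhss d) \<le> B ^ d"
proof -
  have "card (rhss d) \<le> card {xs. set xs \<subseteq> {..<B} \<and> length xs = d}"
    by (rule card_mono[OF finite_lists_length_eq])
      (auto simp: rhss_def dest: rule_in_range(3))
  then show ?thesis by (simp add: card_lists_length_eq)
qed

text \<open>Separates off the degenerate case without rules. Afterwards the exponent
  \<open>log 2 (1 + \<delta>)\<close> is at least 1, as the power inequalities demand.\<close>

lemma nonempty_rs:
  assumes "rs \<noteq> []"
  shows states_pos: "0 < B" and diversity_pos: "1 \<le> \<delta>"
proof -
  obtain q a qs where r: "(q, a, qs) \<in> set rs" using assms by (metis list.set_intros(1) neq_Nil_conv prod_cases3)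
  then show "0 < B" using set_rs rule_in_range by fastforce
  have "qs \<in> rhss (length qs)" using r set_rs by (auto simp: rhss_def)
  then have "1 \<le> card (rhss (length qs))"
    using finite_rhss[of "length qs"] by (metis One_nat_def Suc_leI card_gt_0_iff empty_iff)
  then show "1 \<le> \<delta>" using card_rhss_le_diversity[of "length qs"] r set_rs by (meson le_trans)
qed

text \<open>Indexing is injective because \<open>rs\<close> is distinct; the factor 2 counts the
  symbols.\<close>

lemma card_rules_of_arity:
  "card {r. r < length rs \<and> length (snd (snd (rs ! r))) = d} \<le> 2 * B * card (rhss d)"
proof -
  have "card {r. r < length rs \<and> length (snd (snd (rs ! r))) = d}
      \<le> card ({..<B} \<times> {0, 1 :: nat} \<times> rhss d)"
  proof (rule card_inj_on_le[where f = "(!) rs"])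
    show "inj_on ((!) rs) {r. r < length rs \<and> length (snd (snd (rs ! r))) = d}"
      using distinct_rs by (auto simp: inj_on_def nth_eq_iff_index_eq)
    have "rs ! r \<in> {..<B} \<times> {0, 1} \<times> rhss d" if "r < length rs" "length (snd (snd (rs ! r))) = d" for r
    proof -
      obtain q a qs where e: "rs ! r = (q, a, qs)" by (cases "rs ! r")
      then have "(q, a, qs) \<in> rules (automaton I)" using that set_rs by (metis nth_mem)
      from rule_in_range[OF this] this show ?thesis using e that by (auto simp: rhss_def)
    qed
    then show "(!) rs ` {r. r < length rs \<and> length (snd (snd (rs ! r))) = d} \<subseteq> {..<B} \<times> {0, 1} \<times> rhss d"
      by blast
    show "finite ({..<B} \<times> {0, 1 :: nat} \<times> rhss d)" using finite_rhss by simp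
  qed
  then show ?thesis by (simp add: card_cartesian_product algebra_simps)
qed

end


section \<open>The pushdown machine that visits the vertices in preorder\<close>

locale heavy_knap = knap +
  fixes sz hv :: "nat \<Rightarrow> nat"
  assumes sz: "u < n \<Longrightarrow> sz u = 1 + (\<Sum>v\<leftarrow>ch u. sz v)"
    and hv_less: "u < n \<Longrightarrow> ch u \<noteq> [] \<Longrightarrow> hv u < length (ch u)"
    and hv_max: "u < n \<Longrightarrow> v \<in> set (ch u) \<Longrightarrow> sz v \<le> sz (ch u ! hv u)"
begin

text \<open>The heavy child is pushed first, hence visited last.\<close>

definition pos :: "nat \<Rightarrow> nat list" where
  "pos u = (if ch u = [] then [] else hv u # filter (\<lambda>j. j \<noteq> hv u) [0..<length (ch u)])"

text \<open>Brings data indexed by the children into stack order, top first. Vertices and states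
  undergo the same rearrangement, so their stacks stay aligned; the heavy child, first in
  \<open>pos\<close>, ends up at the bottom.\<close>

definition piece :: "nat \<Rightarrow> 'a list \<Rightarrow> 'a list" where
  "piece u xs = rev (map ((!) xs) (pos u))"

primrec vst :: "nat \<Rightarrow> nat list" where
  "vst 0 = [root (tree I)]"
| "vst (Suc i) = (case vst i of [] \<Rightarrow> [] | u # us \<Rightarrow> piece u (ch u) @ us)"

definition conf_step :: "nat \<Rightarrow> ((nat \<times> nat) list \<times> nat list) set \<Rightarrow> ((nat \<times> nat) list \<times> nat list) set" where
  "conf_step u F = {((u, a) # l, piece u qs @ rest) | l q rest a qs.
     (l, q # rest) \<in> F \<and> (q, a, qs) \<in> set rs \<and> length qs = length (ch u)}"

text \<open>
  A pair \<open>(l, st)\<close> in \<open>conf i\<close> says that the first \<open>i\<close> visited vertices can be given the labels \<open>l\<close>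
  such that the vertices \<open>vst i\<close> waiting to be visited receive the states \<open>st\<close>.
\<close>

primrec conf :: "nat \<Rightarrow> ((nat \<times> nat) list \<times> nat list) set" where
  "conf 0 = {([], [q]) | q. q \<in> inits}"
| "conf (Suc i) = conf_step (hd (vst i)) (conf i)"

lemma set_pos: "u < n \<Longrightarrow> set (pos u) = {..<length (ch u)}"
  using hv_less by (auto simp: pos_def)

lemma distinct_pos: "distinct (pos u)"
  by (auto simp: pos_def)

lemma length_pos: "u < n \<Longrightarrow> length (pos u) = length (ch u)"
  using distinct_card[OF distinct_pos[of u]] set_pos by simp

lemma length_piece [simp]: "u < n \<Longrightarrow> length (piece u xs) = length (ch u)"
  by (simp add: piece_def length_pos)

lemma mset_piece: "u < n \<Longrightarrow> length xs = length (ch u) \<Longrightarrow> mset (piece u xs) = mset xs"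
proof -
  assume u: "u < n" "length xs = length (ch u)"
  have "mset (pos u) = mset [0..<length xs]"
    using u set_pos distinct_pos by (subst set_eq_iff_mset_eq_distinct[symmetric]) auto
  then have "mset (map ((!) xs) (pos u)) = mset (map ((!) xs) [0..<length xs])"
    by (simp only: mset_map)
  then show ?thesis by (simp add: piece_def map_nth)
qed

lemma map_piece: "u < n \<Longrightarrow> length xs = length (ch u) \<Longrightarrow> map f (piece u xs) = piece u (map f xs)"
  using set_pos by (auto simp: piece_def rev_map)

lemma vst_less: "x \<in> set (vst i) \<Longrightarrow> x < n"
proof (induction i arbitrary: x)
  case (Suc i)
  show ?case
  proof (cases "vst i")
    case (Cons u us)
    then have "u < n" using Suc.IH by simp
    then show ?thesis
      using Suc Cons ch_less mset_eq_setD[OF mset_piece[of u "ch u"]] by auto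
  qed (use Suc in simp)
qed (use root_less in simp)

sublocale traversal "tree I" vst
proof
  fix i assume ne: "vst i \<noteq> []"
  then obtain u us where e: "vst i = u # us" by (cases "vst i") auto
  then have "u < n" using vst_less[of u i] by simp
  then show "mset (vst (Suc i)) = mset (ch (hd (vst i))) + mset (tl (vst i))"
    using e by (simp add: mset_piece)
qed (use is_tree in auto)

end


section \<open>Complete configurations and feasible sets\<close>

definition selected :: "(nat \<times> nat) list \<Rightarrow> nat set" where
  "selected l = {u. (u, 1) \<in> set l}"

definition total :: "(nat \<Rightarrow> 'a::comm_monoid_add) \<Rightarrow> (nat \<times> nat) list \<Rightarrow> 'a" where
  "total f l = (\<Sum>(u, a)\<leftarrow>l. if a = 1 then f u else 0)"

lemma total_simps [simp]: "total f [] = 0"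
  "total f ((u, a) # l) = (if a = 1 then f u else 0) + total f l"
  by (simp_all add: total_def)

lemma sum_selected: "distinct (map fst l) \<Longrightarrow> sum f (selected l) = total f l"
proof (induction l)
  case (Cons x l)
  obtain u a where x: "x = (u, a)" by (cases x)
  have "selected (x # l) = (if a = 1 then insert u (selected l) else selected l)"
    using x by (auto simp: selected_def)
  moreover have "u \<notin> selected l" using Cons.prems x by (force simp: selected_def)
  moreover have "finite (selected l)"
    by (rule finite_subset[of _ "fst ` set l"]) (force simp: selected_def)+
  ultimately show ?case using Cons x by simp
qed (simp add: selected_def)

context heavy_knap
begin

declare conf.simps(2) [simp del] vst.simps(2) [simp del]

lemma vst_eq:
  assumes "i < n"
  shows "vst i = visit i # tl (vst i)" "visit i < n"
    "vst (Suc i) = piece (visit i) (ch (visit i)) @ tl (vst i)"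
    "conf (Suc i) = conf_step (visit i) (conf i)"
proof -
  have "vst i \<noteq> []" using pend_nonempty assms by simp
  then show *: "vst i = visit i # tl (vst i)" by (simp add: visit_def)
  then show "vst (Suc i) = piece (visit i) (ch (visit i)) @ tl (vst i)"
    by (metis list.simps(5) vst.simps(2))
  show "visit i < n" using visit_verts assms verts by auto
  show "conf (Suc i) = conf_step (visit i) (conf i)" by (simp add: visit_def conf.simps(2))
qed

lemma children_unseen: assumes "i < n" shows "set (ch (visit i)) \<inter> set (seen i) = {}"
proof -
  have "distinct (seen (Suc i))" using distinct_seen assms by simp
  moreover have "vst i \<noteq> []" using vst_eq(1)[OF assms] by force
  ultimately have "distinct (seen i @ ch (visit i))"
    using mset_eq_imp_distinct_iff[OF mset_seen_Suc] by blast
  then show ?thesis by auto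
qed

text \<open>The machine guesses a run vertex by vertex. Extending a partial run changes
  \<open>\<rho>\<close> only at the children of the vertex being visited; these are unseen, so they
  occur in no rule applied earlier.\<close>

lemma conf_iff_run:
  assumes "i \<le> n"
  shows "(l, st) \<in> conf i \<longleftrightarrow> (\<exists>\<rho>. \<rho> (root (tree I)) \<in> inits \<and>
    map fst l = rev (map visit [0..<i]) \<and>
    (\<forall>(u, a)\<in>set l. (\<rho> u, a, map \<rho> (ch u)) \<in> set rs) \<and> st = map \<rho> (vst i))"
    (is "_ \<longleftrightarrow> (\<exists>\<rho>. ?run i l st \<rho>)")
  using assms
proof (induction i arbitrary: l st)
  case 0
  show ?case
  proof
    assume "(l, st) \<in> conf 0"
    then obtain q where "q \<in> inits" "l = []" "st = [q]" by auto
    then show "\<exists>\<rho>. ?run 0 l st \<rho>" by (intro exI[of _ "\<lambda>_. q"]) simp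
  qed auto
next
  case (Suc i)
  define u where "u = visit i"
  have i: "i < n" using Suc.prems by simp
  note vst = vst_eq[OF i, folded u_def]
  note IH = Suc.IH[OF less_imp_le[OF i]]
  have lch: "length (ch u) \<le> n" using length_ch vst(2) by simp
  show ?case
  proof
    assume "(l, st) \<in> conf (Suc i)"
    then obtain l' q rest a qs where l: "l = (u, a) # l'" "st = piece u qs @ rest"
      and c: "(l', q # rest) \<in> conf i" and r: "(q, a, qs) \<in> set rs" "length qs = length (ch u)"
      by (auto simp: vst(4) conf_step_def)
    obtain \<rho> where \<rho>: "?run i l' (q # rest) \<rho>"
      using c unfolding IH by (elim exE)
    define \<rho>' where "\<rho>' v = (case map_of (zip (ch u) qs) v of Some q' \<Rightarrow> q' | None \<Rightarrow> \<rho> v)" for v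
    have same: "\<rho>' v = \<rho> v" if "v \<in> set (seen i)" for v
    proof -
      have "v \<notin> set (ch u)" using that children_unseen[OF i] u_def by blast
      then have "map_of (zip (ch u) qs) v = None" using r(2) by (simp add: map_of_zip_is_None)
      then show ?thesis by (simp add: \<rho>'_def)
    qed
    have "map \<rho>' (ch u) = qs"
      using distinct_ch[OF vst(2)] r(2)
      by (intro nth_equalityI) (auto simp: \<rho>'_def map_of_zip_nth)
    moreover have heads: "\<rho>' u = q" "map \<rho>' (tl (vst i)) = rest"
    proof -
      have st: "q # rest = map \<rho> (u # tl (vst i))" using \<rho> vst(1) by simp
      moreover have sub: "set (u # tl (vst i)) \<subseteq> set (seen i)" using vst(1) by (simp add: seen_def)
      ultimately show "\<rho>' u = q" "map \<rho>' (tl (vst i)) = rest"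
        by (auto simp: same)
    qed
    ultimately have st: "st = map \<rho>' (vst (Suc i))"
      using l(2) vst(3) map_piece[OF vst(2) refl, of \<rho>'] by simp
    have inv: "root (tree I) \<in> set (seen i)"
      using seen_invariant[of i] pend_nonempty i by auto
    have "(\<rho>' u', a', map \<rho>' (ch u')) \<in> set rs" if "(u', a') \<in> set l" for u' a'
    proof (cases "(u', a') \<in> set l'")
      case True
      then have "u' \<in> set (map fst l')" by force
      then obtain j where j: "j < i" "u' = visit j" using \<rho> by auto
      have "set (ch u') \<subseteq> set (seen i)" "u' \<in> set (seen i)"
        using children_seen[of i j] j i by (auto simp: seen_def)
      then have *: "\<rho>' u' = \<rho> u'" "map \<rho>' (ch u') = map \<rho> (ch u')" using same by auto
      have "(\<rho> u', a', map \<rho> (ch u')) \<in> set rs" using \<rho> True by blast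
      then show ?thesis by (simp only: *)
    next
      case False
      then have "u' = u" "a' = a" using that l by auto
      then show ?thesis using r heads \<open>map \<rho>' (ch u) = qs\<close> by simp
    qed
    moreover have "map fst l = rev (map visit [0..<Suc i])" using \<rho> l u_def by simp
    ultimately have "?run (Suc i) l st \<rho>'" using st \<rho> same[OF inv] by auto
    then show "\<exists>\<rho>. ?run (Suc i) l st \<rho>" by blast
  next
    assume "\<exists>\<rho>. ?run (Suc i) l st \<rho>"
    then obtain \<rho> where \<rho>: "?run (Suc i) l st \<rho>" by blast
    then have "map fst l = u # rev (map visit [0..<i])" by (simp add: u_def)
    then obtain a l' where l: "l = (u, a) # l'" "map fst l' = rev (map visit [0..<i])"
      by (cases l) auto
    have "(l', map \<rho> (vst i)) \<in> conf i" using IH \<rho> l by auto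
    then have "(l', \<rho> u # map \<rho> (tl (vst i))) \<in> conf i" using vst(1) by (metis list.simps(9))
    moreover have "(\<rho> u, a, map \<rho> (ch u)) \<in> set rs" using \<rho> l by auto
    moreover have "st = piece u (map \<rho> (ch u)) @ map \<rho> (tl (vst i))"
      using \<rho> vst(3) map_piece[OF vst(2) refl, of \<rho>] by simp
    ultimately show "(l, st) \<in> conf (Suc i)"
      unfolding vst(4) conf_step_def l(1) by force
  qed
qed

lemma conf_fst:
  assumes "i \<le> n" "(l, st) \<in> conf i" shows "map fst l = rev (map visit [0..<i])"
  using assms(2) unfolding conf_iff_run[OF assms(1)] by blast

lemma conf_final_distinct: "(l, st) \<in> conf n \<Longrightarrow> distinct (map fst l)"
  using conf_fst[of n] distinct_seen[of n] by (simp add: seen_def)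

lemma conf_labels:
  assumes "(l, st) \<in> conf n" "(u, a) \<in> set l" shows "a = 0 \<or> a = 1"
proof -
  obtain \<rho> where "(\<rho> u, a, map \<rho> (ch u)) \<in> set rs"
    using assms unfolding conf_iff_run[OF order_refl] by blast
  then show ?thesis using set_rs rule_in_range(2) by blast
qed

text \<open>Each vertex has exactly one entry in \<open>l\<close> and its label is 0 or 1, so
  \<open>labelling (selected l)\<close> gives back the labels with which the run was built.\<close>

lemma conf_accepted:
  assumes "(l, st) \<in> conf n" shows "selected l \<in> accepted_sets (automaton I) (tree I)"
proof -
  obtain \<rho> where \<rho>: "\<rho> (root (tree I)) \<in> inits"
    "\<forall>(u, a)\<in>set l. (\<rho> u, a, map \<rho> (ch u)) \<in> set rs"
    using assms conf_iff_run[of n] by blast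
  have fst: "fst ` set l = {..<n}"
    using conf_fst[OF _ assms] seen_all verts by (metis card_verts dual_order.refl list.set_map set_rev)
  have "(\<rho> u, labelling (selected l) u, map \<rho> (ch u)) \<in> rules (automaton I)" if u: "u < n" for u
  proof -
    have "u \<in> fst ` set l" using fst u by simp
    then obtain a where a: "(u, a) \<in> set l" by auto
    have "labelling (selected l) u = a"
      using conf_labels[OF assms a] a conf_final_distinct[OF assms] eq_key_imp_eq_value
      by (fastforce simp: labelling_def selected_def)
    then show ?thesis using \<rho>(2) a set_rs by fastforce
  qed
  then have "accepts (automaton I) (tree I) (labelling (selected l))"
    using \<rho>(1) verts unfolding accepts_def successful_run_def by auto
  moreover have "selected l \<subseteq> {..<n}" using fst by (force simp: selected_def)
  ultimately show ?thesis by (simp add: accepted_sets_def verts)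
qed

lemma accepted_conf:
  assumes "X \<in> accepted_sets (automaton I) (tree I)"
  obtains l where "(l, []) \<in> conf n" "selected l = X"
proof -
  from assms obtain \<rho> where X: "X \<subseteq> {..<n}" and \<rho>: "\<rho> (root (tree I)) \<in> inits"
    "\<And>u. u < n \<Longrightarrow> (\<rho> u, labelling X u, map \<rho> (ch u)) \<in> rules (automaton I)"
    by (auto simp: accepted_sets_def accepts_def successful_run_def verts)
  define l where "l = map (\<lambda>i. (visit i, labelling X (visit i))) (rev [0..<n])"
  have v: "visit i < n" if "i < n" for i using visit_verts that verts by auto
  have "(\<rho> u, a, map \<rho> (ch u)) \<in> set rs" if "(u, a) \<in> set l" for u a
    using that \<rho>(2) v length_ch by (auto simp: l_def set_rs)
  moreover have "map fst l = rev (map visit [0..<n])" by (simp add: l_def rev_map)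
  moreover have "vst n = []" using pend_all by simp
  ultimately have "(l, []) \<in> conf n" using \<rho>(1) by (auto simp: conf_iff_run)
  moreover have "selected l = X"
  proof
    show "selected l \<subseteq> X" by (auto simp: selected_def l_def labelling_def split: if_splits)
    show "X \<subseteq> selected l"
    proof
      fix u assume u: "u \<in> X"
      then obtain k where "k < n" "u = visit k" using X visit_obtain[of u] verts by auto
      then show "u \<in> selected l" using u by (auto simp: selected_def l_def labelling_def)
    qed
  qed
  ultimately show ?thesis using that by blast
qed

lemma feasible_iff:
  "feasible I X \<longleftrightarrow> (\<exists>l. (l, []) \<in> conf n \<and> selected l = X \<and> total (weight I) l \<le> C)"
  using conf_accepted accepted_conf sum_selected conf_final_distinct
  unfolding feasible_def by (metis (no_types, lifting))

lemma optimalI: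
  assumes "(l, []) \<in> conf n" "total (weight I) l \<le> C"
    and "\<And>l'. (l', []) \<in> conf n \<Longrightarrow> total (weight I) l' \<le> C \<Longrightarrow> total (profit I) l' \<le> total (profit I) l"
  shows "optimal I (selected l)"
  using assms sum_selected[of _ "profit I"] conf_final_distinct
  unfolding optimal_def feasible_iff by metis


section \<open>Counting the configurations\<close>

definition stacks :: "nat \<Rightarrow> nat list set" where "stacks i = snd ` conf i"

text \<open>For each pending vertex, \<open>\<delta>\<close> to the number of light edges above it.
  Carrying these numbers along a stack of their own avoids any talk about paths in the tree.\<close>

primrec copies :: "nat \<Rightarrow> nat list" where
  "copies 0 = [1]"
| "copies (Suc i) = piece (visit i)
     (map (\<lambda>j. if j = hv (visit i) then hd (copies i) else \<delta> * hd (copies i)) [0..<length (ch (visit i))])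
     @ tl (copies i)"

lemma length_copies: "i \<le> n \<Longrightarrow> length (copies i) = length (vst i)"
proof (induction i)
  case (Suc i)
  then show ?case using vst_eq[of i] by simp
qed simp

lemma length_stack: "i \<le> n \<Longrightarrow> st \<in> stacks i \<Longrightarrow> length st = length (vst i)"
  using conf_iff_run by (fastforce simp: stacks_def)

lemma stacks_Suc:
  assumes "i < n"
  shows "stacks (Suc i) = {piece (visit i) qs @ rest | q rest a qs.
    q # rest \<in> stacks i \<and> (q, a, qs) \<in> set rs \<and> length qs = length (ch (visit i))}"
proof -
  have *: "q # rest \<in> stacks i \<longleftrightarrow> (\<exists>l. (l, q # rest) \<in> conf i)" for q rest
    by (force simp: stacks_def)
  show ?thesis
    unfolding * by (force simp: stacks_def vst_eq(4)[OF assms] conf_step_def)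
qed

lemma stack_less: "i \<le> n \<Longrightarrow> st \<in> stacks i \<Longrightarrow> q \<in> set st \<Longrightarrow> q < B"
proof (induction i arbitrary: st)
  case 0
  then show ?case using inits_less by (auto simp: stacks_def)
next
  case (Suc i)
  then obtain q' rest a qs where *: "st = piece (visit i) qs @ rest" "q' # rest \<in> stacks i"
    "(q', a, qs) \<in> set rs" "length qs = length (ch (visit i))"
    using stacks_Suc[of i] by force
  have "mset (piece (visit i) qs) = mset qs"
    using mset_piece[of "visit i" qs] vst_eq(2)[of i] *(4) Suc.prems by simp
  then have "set (piece (visit i) qs) = set qs" by (metis mset_eq_setD)
  then consider "q \<in> set qs" | "q \<in> set (q' # rest)" using Suc.prems(3) *(1) by auto
  then show ?case
  proof cases
    case 1
    then show ?thesis using rule_in_range(3)[of q' a qs] *(3) set_rs by blast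
  next
    case 2
    then show ?thesis using Suc.IH[of "q' # rest"] *(2) Suc.prems(1) by simp
  qed
qed

lemma finite_stacks: "i \<le> n \<Longrightarrow> finite (stacks i)"
  by (rule finite_subset[OF _ finite_lists_length_eq[of "{..<B}" "length (vst i)"]])
    (use length_stack stack_less in auto)

text \<open>
  Below the state of a pending vertex, the stack is determined by one right-hand side for every
  light edge on the path to this vertex; below a heavy child no sibling is waiting.
\<close>

lemma card_tails:
  "i \<le> n \<Longrightarrow> k < length (vst i) \<Longrightarrow> card (drop (Suc k) ` stacks i) \<le> copies i ! k"
proof (induction i arbitrary: k)
  case 0
  then have "drop (Suc k) ` stacks 0 \<subseteq> {[]}" by (auto simp: stacks_def)
  from card_mono[OF _ this] show ?case using 0 by simp
next
  case (Suc i)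
  define u where "u = visit i"
  define d where "d = length (ch u)"
  have i: "i < n" using Suc.prems by simp
  note vst = vst_eq[OF i, folded u_def]
  have fin: "finite (drop k' ` stacks i)" for k' using finite_stacks i by simp
  have dn: "d \<le> n" using length_ch vst(2) by (simp add: d_def)
  have copies_ne: "copies i = hd (copies i) # tl (copies i)"
    using length_copies[of i] i vst(1) by (metis Zero_neq_Suc length_Cons less_imp_le list.collapse list.size(3))
  have IH: "k < length (vst i) \<Longrightarrow> card (drop (Suc k) ` stacks i) \<le> copies i ! k" for k
    using Suc.IH[of k] i by simp
  have IH0: "card (drop 1 ` stacks i) \<le> hd (copies i)"
    using IH[of 0] copies_ne vst(1) by (metis One_nat_def length_greater_0_conv list.distinct(1) nth_Cons_0)
  define G where "G = (\<lambda>j. if j = hv u then hd (copies i) else \<delta> * hd (copies i))"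
  have copiesS: "copies (Suc i) = piece u (map G [0..<d]) @ tl (copies i)"
    by (simp add: u_def G_def d_def)
  have lp: "length (piece u xs) = d" for xs :: "nat list" using vst(2) by (simp add: d_def)
  have rest: "rest \<in> drop 1 ` stacks i" if "q # rest \<in> stacks i" for q rest
    using that by force
  show ?case
  proof (cases "k < d")
    case True
    then have ne: "ch u \<noteq> []" by (auto simp: d_def)
    have "copies (Suc i) ! k = piece u (map G [0..<d]) ! k"
      unfolding copiesS using True lp by (simp add: nth_append)
    also have "\<dots> = map G [0..<d] ! (rev (pos u) ! k)"
      using True length_pos[OF vst(2)] by (simp add: piece_def rev_map d_def)
    also have "\<dots> = G (rev (pos u) ! k)"
    proof -
      have "rev (pos u) ! k \<in> set (rev (pos u))"
        using True length_pos[OF vst(2)] by (intro nth_mem) (simp add: d_def)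
      then show ?thesis using set_pos[OF vst(2)] by (simp add: d_def)
    qed
    finally have G: "copies (Suc i) ! k = G (rev (pos u) ! k)" .
    show ?thesis
    proof (cases "Suc k = d")
      case True
      \<comment> \<open>The last position of the pushed block belongs to the heavy child. Beneath it
        lies only the old tail, so no new factor appears.\<close>
      have "rev (pos u) ! k = pos u ! 0"
        using True length_pos[OF vst(2)] \<open>k < d\<close> by (subst rev_nth) (auto simp: d_def)
      then have "rev (pos u) ! k = hv u" using ne by (simp add: pos_def)
      then have m: "copies (Suc i) ! k = hd (copies i)" using G by (simp add: G_def)
      have "drop (Suc k) ` stacks (Suc i) \<subseteq> drop 1 ` stacks i"
        using stacks_Suc[OF i] True lp rest by (auto simp: u_def)
      from card_mono[OF fin this] show ?thesis using IH0 m by simp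
    next
      case False
      have "rev (pos u) ! k \<noteq> hv u"
      proof
        assume *: "rev (pos u) ! k = hv u"
        have "rev (pos u) ! (d - 1) = pos u ! 0"
          using length_pos[OF vst(2)] \<open>k < d\<close> by (subst rev_nth) (auto simp: d_def)
        then have "rev (pos u) ! (d - 1) = hv u" using ne by (simp add: pos_def)
        then have "k = d - 1"
          using * nth_eq_iff_index_eq[of "rev (pos u)" k "d - 1"] distinct_pos[of u]
            length_pos[OF vst(2)] \<open>k < d\<close> by (simp add: d_def)
        then show False using False \<open>k < d\<close> by simp
      qed
      then have m: "copies (Suc i) ! k = \<delta> * hd (copies i)" using G by (simp add: G_def)
      let ?f = "\<lambda>(qs, rest). drop (Suc k) (piece u qs) @ rest"
      \<comment> \<open>Beneath a light child other entries of the block are waiting; the right-hand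
        side alone determines them, whatever state and symbol its rule has.\<close>
      have "drop (Suc k) ` stacks (Suc i) \<subseteq> ?f ` (rhss d \<times> drop 1 ` stacks i)"
      proof
        fix t assume "t \<in> drop (Suc k) ` stacks (Suc i)"
        then obtain q rest' a qs where t: "t = drop (Suc k) (piece u qs @ rest')"
          "q # rest' \<in> stacks i" "(q, a, qs) \<in> set rs" "length qs = d"
          using stacks_Suc[OF i] by (auto simp: u_def d_def)
        have "t = ?f (qs, rest')" using t(1) True lp by simp
        moreover have "qs \<in> rhss d" using t set_rs by (auto simp: rhss_def)
        ultimately show "t \<in> ?f ` (rhss d \<times> drop 1 ` stacks i)" using rest[OF t(2)] by blast
      qed
      then have "card (drop (Suc k) ` stacks (Suc i)) \<le> card (?f ` (rhss d \<times> drop 1 ` stacks i))"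
        using finite_rhss fin by (intro card_mono) auto
      also have "\<dots> \<le> card (rhss d \<times> drop 1 ` stacks i)"
        using finite_rhss fin by (intro card_image_le) auto
      also have "\<dots> \<le> \<delta> * hd (copies i)"
        using card_rhss_le_diversity[OF dn] IH0 by (simp add: card_cartesian_product mult_mono)
      finally show ?thesis using m by simp
    qed
  next
    case False
    \<comment> \<open>A position \<open>k\<close> beneath the pushed block was position
      \<open>k - d + 1\<close> before, since \<open>u\<close> has been popped from the top.\<close>
    define k' where "k' = Suc (k - d)"
    have k': "k' < length (vst i)" using Suc.prems(2) False vst lp
      by (cases "vst i") (auto simp: k'_def)
    have "drop (Suc k) ` stacks (Suc i) \<subseteq> drop (Suc k') ` stacks i"
    proof
      fix t assume "t \<in> drop (Suc k) ` stacks (Suc i)"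
      then obtain q rest' a qs where t: "t = drop (Suc k) (piece u qs @ rest')" "q # rest' \<in> stacks i"
        using stacks_Suc[OF i] by (auto simp: u_def)
      then have "t = drop (Suc k') (q # rest')" using False lp by (simp add: k'_def Suc_diff_le)
      then show "t \<in> drop (Suc k') ` stacks i" using t(2) by blast
    qed
    from card_mono[OF fin this] have "card (drop (Suc k) ` stacks (Suc i)) \<le> copies i ! k'"
      using IH[OF k'] by simp
    also have "copies i ! k' = copies (Suc i) ! k"
      unfolding copiesS using False lp by (subst copies_ne) (simp add: nth_append k'_def)
    finally show ?thesis .
  qed
qed

text \<open>On top of a tail only the state of the next vertex is free, whence the factor
  \<open>B\<close>.\<close>

lemma card_stacks: assumes "i < n" shows "card (stacks i) \<le> B * hd (copies i)"
proof -
  have ne: "copies i \<noteq> []" "0 < length (vst i)"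
    using length_copies[of i] vst_eq(1)[OF assms] assms by (metis le_eq_less_or_eq length_0_conv length_greater_0_conv list.distinct(1))+
  have fin: "finite (stacks i)" using finite_stacks assms by simp
  have "stacks i \<subseteq> (\<lambda>(q, r). q # r) ` ({..<B} \<times> drop 1 ` stacks i)"
  proof
    fix st assume st: "st \<in> stacks i"
    then have "length st = length (vst i)" using length_stack assms by simp
    then obtain q r where e: "st = q # r" using ne(2) by (cases st) auto
    then have "q < B" using stack_less[of i st q] st assms by simp
    moreover have "r \<in> drop 1 ` stacks i" using st e by force
    ultimately show "st \<in> (\<lambda>(q, r). q # r) ` ({..<B} \<times> drop 1 ` stacks i)" using e by auto
  qed
  then have "card (stacks i) \<le> card ((\<lambda>(q, r). q # r) ` ({..<B} \<times> drop 1 ` stacks i))"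
    using fin by (intro card_mono) auto
  also have "\<dots> \<le> B * card (drop 1 ` stacks i)"
    using card_image_le[of "{..<B} \<times> drop 1 ` stacks i" "\<lambda>(q, r). q # r"] fin
    by (simp add: card_cartesian_product)
  also have "\<dots> \<le> B * hd (copies i)"
    using card_tails[of i 0] assms ne by (simp add: hd_conv_nth)
  finally show ?thesis .
qed

end


section \<open>The amortised cost of branching\<close>

context heavy_knap
begin

definition expo :: real where "expo = log 2 (1 + real \<delta>)"

text \<open>Must cover the \<open>branch_cost\<close> of a unary vertex, at most
  \<open>1 + 2 * B\<close>, and leave a leaf, whose \<open>charge\<close> is
  \<open>rate - 3\<close>, with at least its \<open>branch_cost\<close> of 2.\<close>

definition rate :: real where "rate = 2 * real B + 6"

definition charge :: "nat \<Rightarrow> real" where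
  "charge v = rate * real (sz v) powr expo - 3"

text \<open>The time spent on one stack, up to a factor depending on \<open>B\<close> and
  \<open>C\<close>: each right-hand side of fitting arity takes time proportional to its length plus
  one, and the summand 1 absorbs the overhead of the stack.\<close>

definition branch_cost :: "nat \<Rightarrow> nat" where
  "branch_cost u = 1 + (length (ch u) + 1) * card (rhss (length (ch u)))"

context
  assumes delta: "1 \<le> \<delta>"
begin

lemma expo_ge_1: "1 \<le> expo"
proof -
  have "log 2 2 \<le> log 2 (1 + real \<delta>)" using delta by (subst log_le_cancel_iff) auto
  then show ?thesis by (simp add: expo_def)
qed

lemma two_powr_expo: "1 + real \<delta> = 2 powr expo"
  by (simp add: expo_def)

lemma sz_pos: "u < n \<Longrightarrow> 1 \<le> sz u"
  using sz by simp

lemma sum_ch: "(\<Sum>v\<leftarrow>ch u. f v) = (\<Sum>j<length (ch u). f (ch u ! j))"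
  by (simp add: sum_list_sum_nth atLeast0LessThan)

text \<open>
  The superadditivity of \<open>x powr expo\<close> pays for the node itself, and the constant in \<open>charge\<close>,
  which grows with every light child, pays for enumerating the right-hand sides.
\<close>

lemma charge_children:
  assumes u: "u < n"
  shows "real (branch_cost u)
      + (\<Sum>j<length (ch u). (if j = hv u then 1 else real \<delta>) * charge (ch u ! j)) \<le> charge u"
proof (cases "ch u = []")
  case True
  have "card (rhss 0) \<le> 1" using card_rhss_le_power[of 0] by simp
  then show ?thesis using sz[OF u] True by (simp add: charge_def rate_def branch_cost_def)
next
  case False
  define d where "d = length (ch u)"
  define J where "J = {..<d} - {hv u}"
  define x where "x j = real (sz (ch u ! j))" for j
  have hv: "hv u < d" using hv_less[OF u False] by (simp add: d_def)
  have J: "finite J" "hv u \<notin> J" "{..<d} = insert (hv u) J" "card J = d - 1"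
    using hv by (auto simp: J_def)
  have split: "(\<Sum>j<d. g j) = g (hv u) + (\<Sum>j\<in>J. g j)" for g :: "nat \<Rightarrow> real"
    using J by simp
  have xJ: "0 \<le> x j \<and> x j \<le> x (hv u)" if "j \<in> J" for j
    using that hv_max[OF u, of "ch u ! j"] J_def by (auto simp: x_def d_def)
  have x_ge: "1 \<le> x j" if "j < d" for j
    using that sz_pos[OF ch_less[OF u, of "ch u ! j"]] by (simp add: x_def d_def)
  let ?z = "x (hv u) + (\<Sum>j\<in>J. x j)"
  have z: "real (sz u) = 1 + ?z"
    using sz[OF u] split[of x] by (simp add: sum_ch d_def x_def)
  have "0 \<le> (\<Sum>j\<in>J. x j)" using xJ by (intro sum_nonneg) auto
  then have z1: "1 \<le> ?z" using x_ge[OF hv] by simp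
  \<comment> \<open>The smaller argument is the vertex itself. As \<open>1 \<le> \<delta>\<close>,
    one unit of the power becomes free, worth \<open>rate\<close> after scaling.\<close>
  have "?z powr expo + real \<delta> * 1 powr expo \<le> (?z + 1) powr expo"
    by (rule powr_add_ge[OF expo_ge_1 two_powr_expo]) (use z1 in auto)
  then have "?z powr expo + 1 \<le> real (sz u) powr expo"
    using delta z by (simp add: add.commute)
  moreover have "x (hv u) powr expo + real \<delta> * (\<Sum>j\<in>J. x j powr expo) \<le> ?z powr expo"
    by (rule powr_add_sum_ge[OF expo_ge_1 two_powr_expo J(1)]) (use xJ in \<open>auto simp: x_def\<close>)
  ultimately have "1 + x (hv u) powr expo + real \<delta> * (\<Sum>j\<in>J. x j powr expo) \<le> real (sz u) powr expo"
    by simp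
  then have 1: "rate * (1 + x (hv u) powr expo + real \<delta> * (\<Sum>j\<in>J. x j powr expo))
      \<le> rate * real (sz u) powr expo"
    by (rule mult_left_mono) (simp add: rate_def)
  have "(\<Sum>j<d. (if j = hv u then 1 else real \<delta>) * charge (ch u ! j))
      = charge (ch u ! hv u) + (\<Sum>j\<in>J. real \<delta> * charge (ch u ! j))"
    using J(2) by (subst split) (simp, intro sum.cong, auto)
  also have "\<dots> = rate * (x (hv u) powr expo + real \<delta> * (\<Sum>j\<in>J. x j powr expo))
      - 3 - 3 * real \<delta> * real (d - 1)"
    using J(4) by (simp add: charge_def x_def sum_subtractf algebra_simps sum_distrib_left)
  finally have 2: "(\<Sum>j<d. (if j = hv u then 1 else real \<delta>) * charge (ch u ! j))
    = rate * (x (hv u) powr expo + real \<delta> * (\<Sum>j\<in>J. x j powr expo)) - 3 - 3 * real \<delta> * real (d - 1)" .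
  \<comment> \<open>For \<open>d \<ge> 2\<close> the light children return
    \<open>3 * \<delta>\<close> each, enough because \<open>d + 1 \<le> 3 * (d - 1)\<close>. This is
    the origin of the 3 in \<open>charge\<close>. A unary vertex has no light child and lives on
    \<open>rate\<close> alone.\<close>
  have 3: "real (branch_cost u) \<le> rate + 3 * real \<delta> * real (d - 1)"
  proof (cases "d = 1")
    case True
    have "card (rhss 1) \<le> B" using card_rhss_le_power[of 1] by simp
    then have "real (card (rhss 1)) \<le> real B" by linarith
    then show ?thesis using True by (simp add: branch_cost_def d_def rate_def)
  next
    case False
    then have d2: "2 \<le> d" using hv by simp
    have "card (rhss d) \<le> \<delta>" using length_ch[OF u] by (intro card_rhss_le_diversity) (simp add: d_def)
    then have "(d + 1) * card (rhss d) \<le> 3 * (d - 1) * \<delta>"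
      using d2 by (intro mult_le_mono) auto
    then have "branch_cost u \<le> 1 + 3 * (d - 1) * \<delta>" by (simp add: branch_cost_def d_def)
    then have "real (branch_cost u) \<le> real (1 + 3 * (d - 1) * \<delta>)" by (rule of_nat_mono)
    also have "\<dots> \<le> rate + 3 * real \<delta> * real (d - 1)" by (simp add: rate_def)
    finally show ?thesis .
  qed
  show ?thesis using 1 2 3 unfolding charge_def d_def by (simp add: algebra_simps)
qed

lemma sum_list_map2_rev:
  "length xs = length ys \<Longrightarrow> sum_list (map2 f (rev xs) (rev ys)) = sum_list (map2 f xs ys)"
  for f :: "'a \<Rightarrow> 'b \<Rightarrow> real"
  by (simp add: zip_rev rev_map[symmetric])

text \<open>A potential argument: every pending vertex holds its \<open>charge\<close>, once for
  each of its \<open>copies\<close>. By \<open>charge_children\<close> a visit pays its cost out of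
  the potential, which starts as the \<open>charge\<close> of the root, a vertex of size
  \<open>n\<close>.\<close>

lemma sum_branch_cost:
  "(\<Sum>i<n. real (hd (copies i)) * real (branch_cost (visit i))) \<le> rate * real n powr expo"
proof -
  let ?\<Phi> = "\<lambda>i. sum_list (map2 (\<lambda>g v. real g * charge v) (copies i) (vst i))"
  have "(\<Sum>j<i. real (hd (copies j)) * real (branch_cost (visit j))) + ?\<Phi> i \<le> charge (root (tree I))"
    if "i \<le> n" for i
    using that
  proof (induction i)
    case 0
    show ?case by simp
  next
    case (Suc i)
    define u where "u = visit i"
    define d where "d = length (ch u)"
    have i: "i < n" using Suc.prems by simp
    note vst = vst_eq[OF i, folded u_def]
    have "copies i \<noteq> []"
      using length_copies[of i] i vst(1) by (metis length_0_conv less_imp_le list.distinct(1))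
    then obtain g gs where g: "copies i = g # gs" by (cases "copies i") auto
    define G where "G = (\<lambda>j. if j = hv u then hd (copies i) else \<delta> * hd (copies i))"
    have len: "length gs = length (tl (vst i))" using length_copies[of i] i g by simp
    have multS: "copies (Suc i) = piece u (map G [0..<d]) @ gs"
      by (simp add: u_def G_def d_def g)
    have "?\<Phi> (Suc i) = sum_list (map2 (\<lambda>g v. real g * charge v) (piece u (map G [0..<d])) (piece u (ch u)))
        + sum_list (map2 (\<lambda>g v. real g * charge v) gs (tl (vst i)))"
      unfolding multS vst(3) using vst(2) by (simp add: zip_append)
    also have "sum_list (map2 (\<lambda>g v. real g * charge v) (piece u (map G [0..<d])) (piece u (ch u)))
        = (\<Sum>j\<leftarrow>pos u. real (map G [0..<d] ! j) * charge (ch u ! j))"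
      unfolding piece_def by (subst sum_list_map2_rev) (simp_all add: zip_map_map comp_def map2_map_map zip_same_conv_map)
    also have "\<dots> = (\<Sum>j\<in>set (pos u). real (map G [0..<d] ! j) * charge (ch u ! j))"
      using distinct_pos by (simp add: sum_list_distinct_conv_sum_set)
    also have "\<dots> = (\<Sum>j<d. real (G j) * charge (ch u ! j))"
      unfolding set_pos[OF vst(2)] by (simp add: d_def)
    also have "\<dots> = real g * (\<Sum>j<d. (if j = hv u then 1 else real \<delta>) * charge (ch u ! j))"
      unfolding sum_distrib_left by (intro sum.cong) (auto simp: G_def g)
    finally have \<Phi>: "?\<Phi> (Suc i) = real g * (\<Sum>j<d. (if j = hv u then 1 else real \<delta>) * charge (ch u ! j))
      + sum_list (map2 (\<lambda>g v. real g * charge v) gs (tl (vst i)))" .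
    have "real g * (real (branch_cost u)
      + (\<Sum>j<d. (if j = hv u then 1 else real \<delta>) * charge (ch u ! j))) \<le> real g * charge u"
      using charge_children[OF vst(2)] unfolding d_def by (intro mult_left_mono) auto
    moreover have "?\<Phi> i = real g * charge u + sum_list (map2 (\<lambda>g v. real g * charge v) gs (tl (vst i)))"
      unfolding g by (subst vst(1)) simp
    ultimately show ?case
      using Suc.IH i \<Phi> g by (simp add: u_def[symmetric] distrib_left del: copies.simps)
  qed
  from this[of n] have "(\<Sum>i<n. real (hd (copies i)) * real (branch_cost (visit i))) \<le> charge (root (tree I))"
    using pend_all by simp
  also have "sz (root (tree I)) = n" using sum_children[of sz] sz verts by simp
  then have "charge (root (tree I)) \<le> rate * real n powr expo" by (simp add: charge_def)
  finally show ?thesis .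
qed

end

end


section \<open>Access to the stored input\<close>

lemma array_nth [simp]: "i < length xs \<Longrightarrow> array xs i = xs ! i"
  by (simp add: array_def)

lemma offsets_nth: "i \<le> length xss \<Longrightarrow> offsets xss ! i = length (concat (take i xss))"
  unfolding offsets_def by (subst nth_map) (auto simp del: upt_Suc)

lemma length_offsets [simp]: "length (offsets xss) = Suc (length xss)"
  by (simp add: offsets_def)

lemma offsets_Suc:
  "i < length xss \<Longrightarrow> offsets xss ! Suc i = offsets xss ! i + length (xss ! i)"
  by (simp add: offsets_nth take_Suc_conv_app_nth)

lemma nth_concat_offsets:
  assumes "i < length xss" "j < length (xss ! i)"
  shows "offsets xss ! i + j < length (concat xss)" "concat xss ! (offsets xss ! i + j) = xss ! i ! j"
proof -
  have "concat xss = concat (take i xss) @ xss ! i @ concat (drop (Suc i) xss)"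
    using assms(1) by (metis concat.simps(2) concat_append id_take_nth_drop)
  then show "offsets xss ! i + j < length (concat xss)"
    "concat xss ! (offsets xss ! i + j) = xss ! i ! j"
    using assms by (simp_all add: offsets_nth nth_append)
qed

context knap
begin

abbreviation mem where "mem \<equiv> input_memory I rs"

abbreviation "inp_regs \<equiv> {''n'', ''root'', ''num_states'', ''num_rules'', ''capacity''}"
abbreviation "inp_narrs \<equiv> {''child_offset'', ''child'', ''initial'', ''rule_state'', ''rule_symbol'',
        ''rule_offset'', ''rule_rhs'', ''weight''}"

text \<open>The part of the memory that no program below writes. By \<open>inp_agree\<close> its
  preservation is a check of names.\<close>

definition inp :: "memory \<Rightarrow> bool" where
  "inp s \<longleftrightarrow> (\<forall>x\<in>inp_regs. reg s x = reg mem x) \<and> (\<forall>a\<in>inp_narrs. narr s a = narr mem a) \<and>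
     rarr s ''profit'' = rarr mem ''profit''"

lemma inp_agree:
  assumes "inp s" "agree c s s'"
    "wregs c \<inter> inp_regs = {}" "wnarrs c \<inter> inp_narrs = {}" "''profit'' \<notin> wrarrs c"
  shows "inp s'"
proof -
  have "reg s' x = reg s x" if "x \<in> inp_regs" for x
    using agree_reg[OF assms(2)] assms(3) that by blast
  moreover have "narr s' a = narr s a" if "a \<in> inp_narrs" for a
    using agree_narr[OF assms(2)] assms(4) that by blast
  moreover have "rarr s' ''profit'' = rarr s ''profit''"
    using agree_rarr[OF assms(2)] assms(5) by blast
  ultimately show ?thesis using assms(1) unfolding inp_def by simp
qed

abbreviation arity :: "nat \<Rightarrow> nat" where "arity r \<equiv> length (snd (snd (rs ! r)))"

lemma inp_mem: "inp mem"
  by (simp add: inp_def)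

lemma mem_reg:
  "reg mem ''n'' = n" "reg mem ''root'' = root (tree I)" "reg mem ''num_states'' = B"
  "reg mem ''num_rules'' = length rs" "reg mem ''capacity'' = C"
  by (simp_all add: input_memory_def Let_def)

lemma mem_arrays:
  "narr mem ''child_offset'' = array (offsets (map ch [0..<n]))"
  "narr mem ''child'' = array (concat (map ch [0..<n]))"
  "narr mem ''initial'' = array (map (\<lambda>q. if q \<in> inits then 1 else 0) [0..<B])"
  "narr mem ''rule_state'' = array (map fst rs)"
  "narr mem ''rule_symbol'' = array (map (\<lambda>r. fst (snd r)) rs)"
  "narr mem ''rule_offset'' = array (offsets (map (\<lambda>r. snd (snd r)) rs))"
  "narr mem ''rule_rhs'' = array (concat (map (\<lambda>r. snd (snd r)) rs))"
  "narr mem ''weight'' = array (map (weight I) [0..<n])"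
  "rarr mem ''profit'' = array (map (profit I) [0..<n])"
  by (simp_all add: input_memory_def Let_def split_beta' fst_def[symmetric])

lemma inp_reg:
  assumes "inp s"
  shows "reg s ''n'' = n" "reg s ''root'' = root (tree I)" "reg s ''num_states'' = B"
    "reg s ''num_rules'' = length rs" "reg s ''capacity'' = C"
  using assms by (simp_all add: inp_def mem_reg)

lemma inp_children:
  assumes "inp s" "u < n"
  shows "narr s ''child_offset'' (Suc u) = narr s ''child_offset'' u + length (ch u)"
    "j < length (ch u) \<Longrightarrow> narr s ''child'' (narr s ''child_offset'' u + j) = ch u ! j"
  using assms nth_concat_offsets[of u "map ch [0..<n]" j]
  by (simp_all add: inp_def mem_arrays offsets_Suc del: upt_Suc)

lemma inp_rules:
  assumes "inp s" "r < length rs"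
  shows "narr s ''rule_offset'' (Suc r) = narr s ''rule_offset'' r + arity r"
    "j < arity r \<Longrightarrow> narr s ''rule_rhs'' (narr s ''rule_offset'' r + j) = snd (snd (rs ! r)) ! j"
    "narr s ''rule_state'' r = fst (rs ! r)" "narr s ''rule_symbol'' r = fst (snd (rs ! r))"
  using assms nth_concat_offsets[of r "map (\<lambda>r. snd (snd r)) rs" j]
  by (simp_all add: inp_def mem_arrays offsets_Suc)

lemma inp_vertices:
  assumes "inp s" "u < n"
  shows "narr s ''weight'' u = weight I u" "rarr s ''profit'' u = profit I u"
  using assms by (simp_all add: inp_def mem_arrays)

lemma inp_initial:
  assumes "inp s" "q < B"
  shows "narr s ''initial'' q = (if q \<in> inits then 1 else 0)"
  using assms by (simp add: inp_def mem_arrays)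

lemmas inpD = inp_reg inp_children inp_rules inp_vertices inp_initial


section \<open>Breadth-first order\<close>

text \<open>The queue is never shortened: \<open>bfs i\<close> keeps the \<open>i\<close> vertices
  already taken out, just as the array \<open>ord\<close> does, so its final value is the order of
  visits itself.\<close>

primrec bfs :: "nat \<Rightarrow> nat list" where
  "bfs 0 = [root (tree I)]"
| "bfs (Suc i) = bfs i @ (if i < length (bfs i) then ch (bfs i ! i) else [])"

sublocale bfs: traversal "tree I" "\<lambda>i. drop i (bfs i)"
proof
  fix i assume ne: "drop i (bfs i) \<noteq> []"
  then have "i < length (bfs i)" by simp
  then show "mset (drop (Suc i) (bfs (Suc i))) = mset (ch (hd (drop i (bfs i)))) + mset (tl (drop i (bfs i)))"
    by (simp add: hd_drop_conv_nth drop_Suc tl_drop)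
qed (use is_tree in auto)

lemma bfs_prefix:
  assumes "i < n"
  shows "i < length (bfs i)" "bfs.visit i = bfs i ! i" "bfs.visit i < n"
proof -
  show "i < length (bfs i)" using bfs.pend_nonempty[of i] assms by simp
  then show "bfs.visit i = bfs i ! i" by (simp add: bfs.visit_def hd_drop_conv_nth)
  show "bfs.visit i < n" using bfs.visit_verts[of i] assms verts by auto
qed

lemma bfs_take: "i \<le> n \<Longrightarrow> take i (bfs i) = map bfs.visit [0..<i]"
proof (induction i)
  case (Suc i)
  then show ?case
    using bfs_prefix[of i] by (simp add: take_Suc_conv_app_nth nth_append)
qed simp

lemma bfs_final: "bfs n = map bfs.visit [0..<n]"
  using bfs_take[of n] bfs.pend_all by simp

definition order_prog :: com where
  "order_prog =
     Put ''ord'' (Const 0) (Reg ''root'') ;;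
     ''e'' ::= Const 1 ;;
     For ''i'' (Reg ''n'') (
       ''u'' ::= Get ''ord'' (Reg ''i'') ;;
       ''o'' ::= Get ''child_offset'' (Reg ''u'') ;;
       For ''j'' (Sub (Get ''child_offset'' (Add (Reg ''u'') (Const 1))) (Reg ''o'')) (
         Put ''ord'' (Reg ''e'') (Get ''child'' (Add (Reg ''o'') (Reg ''j''))) ;;
         ''e'' ::= Add (Reg ''e'') (Const 1)))"

lemma order_prog_wp:
  assumes "inp s"
  shows "wp order_prog (\<lambda>s' m'. (\<forall>i<n. narr s' ''ord'' i = bfs.visit i) \<and> m' \<le> m + 20 * n) s m"
proof -
  define Inv where "Inv i s m' \<longleftrightarrow> map (narr s ''ord'') [0..<reg s ''e''] = bfs i \<and>
    m' \<le> m + 3 + 6 * i + 5 * length (bfs i)" for i m' and s :: memory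
  let ?s = "s\<lparr>narr := (narr s)(''ord'' := (narr s ''ord'')(0 := reg s ''root'')),
    reg := (reg s)(''e'' := 1)\<rparr>"
  have inp0: "inp ?s" using assms by (simp add: inp_def)
  show ?thesis
    unfolding order_prog_def
    apply simp
    apply (rule wp_For[where Inv = Inv and N = n])
    subgoal by (simp add: Inv_def)
    subgoal by simp
    subgoal using assms by (simp add: agreeD inpD)
    subgoal using assms by (simp add: Inv_def inpD)
    subgoal premises p for k s' m'
    proof -
      have i': "inp s'" by (rule inp_agree[OF inp0]) (use p in \<open>auto\<close>)
      note k = bfs_prefix[OF p(2)]
      let ?u = "bfs.visit k"
      have mp': "map (narr s' ''ord'') [0..<reg s' ''e''] = bfs k" using p(1) by (simp add: Inv_def)
      from arg_cong[OF this, of length] have e: "reg s' ''e'' = length (bfs k)" by simp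
      note mp = mp'[unfolded e]
      have u: "narr s' ''ord'' k = ?u" using arg_cong[OF mp, of "\<lambda>xs. xs ! k"] k by simp
      show ?thesis
        apply (simp add: p u)
        apply (rule wp_For[where N = "length (ch ?u)" and Inv = "\<lambda>j s m''.
            reg s ''e'' = length (bfs k) + j \<and>
            map (narr s ''ord'') [0..<length (bfs k) + j] = bfs k @ take j (ch ?u) \<and>
            m'' \<le> m' + 4 + 4 * j"])
        subgoal by simp
        subgoal by simp
        subgoal using i' k by (simp add: agreeD inpD)
        subgoal using e mp by simp
        subgoal premises q for j s'' m''
          using q i' k by (simp add: agreeD inpD take_Suc_conv_app_nth)
        subgoal premises q for s'' m''
          using q k p(1) by (simp add: Inv_def)
        done
    qed
    subgoal premises p for s' m'
    proof -
      have "map (narr s' ''ord'') [0..<reg s' ''e''] = map bfs.visit [0..<n]" "m' \<le> m + 3 + 6 * n + 5 * n"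
        using p(1) bfs_final by (simp_all add: Inv_def)
      moreover from arg_cong[OF this(1), of length] have "reg s' ''e'' = n" by simp
      ultimately show ?thesis using n_pos by simp
    qed
    done
qed

end


text \<open>Linked lists of indices. An index \<open>x\<close> is stored as \<open>Suc x\<close>, so
  that the initial 0 of an array entry reads as the empty list.\<close>

fun chain :: "(nat \<Rightarrow> nat) \<Rightarrow> nat \<Rightarrow> nat list \<Rightarrow> bool" where
  "chain nx p [] \<longleftrightarrow> p = 0"
| "chain nx p (x # xs) \<longleftrightarrow> p = Suc x \<and> chain nx (nx x) xs"

lemma chain_upd [simp]: "x \<notin> set xs \<Longrightarrow> chain (nx(x := v)) p xs = chain nx p xs"
  by (induction nx p xs rule: chain.induct) auto

context knap
begin

section \<open>Subtree sizes and heavy children\<close>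

definition sizes_prog :: com where
  "sizes_prog =
     For ''i'' (Reg ''n'') (
       ''u'' ::= Get ''ord'' (Sub (Sub (Reg ''n'') (Const 1)) (Reg ''i'')) ;;
       ''o'' ::= Get ''child_offset'' (Reg ''u'') ;;
       ''s'' ::= Const 1 ;;
       ''best'' ::= Const 0 ;;
       ''h'' ::= Const 0 ;;
       For ''j'' (Sub (Get ''child_offset'' (Add (Reg ''u'') (Const 1))) (Reg ''o'')) (
         ''z'' ::= Get ''size'' (Get ''child'' (Add (Reg ''o'') (Reg ''j''))) ;;
         ''s'' ::= Add (Reg ''s'') (Reg ''z'') ;;
         If (Less (Reg ''best'') (Reg ''z'')) (''best'' ::= Reg ''z'' ;; ''h'' ::= Reg ''j'') Skip) ;;
       Put ''size'' (Reg ''u'') (Reg ''s'') ;;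
       Put ''heavy'' (Reg ''u'') (Reg ''h''))"

definition size_ok :: "(nat \<Rightarrow> nat) \<Rightarrow> (nat \<Rightarrow> nat) \<Rightarrow> nat \<Rightarrow> bool" where
  "size_ok sz hv u \<longleftrightarrow> sz u = 1 + (\<Sum>v\<leftarrow>ch u. sz v) \<and>
     (ch u \<noteq> [] \<longrightarrow> hv u < length (ch u) \<and> (\<forall>v\<in>set (ch u). sz v \<le> sz (ch u ! hv u)))"

text \<open>The vertices are handled in reversed breadth-first order, so the sizes of all children
  are final when their parent is reached.\<close>

lemma sizes_prog_wp:
  assumes "inp s" "\<forall>i<n. narr s ''ord'' i = bfs.visit i"
  shows "wp sizes_prog (\<lambda>s' m'. (\<forall>u<n. size_ok (narr s' ''size'') (narr s' ''heavy'') u) \<and>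
    m' \<le> m + 30 * n) s m"
proof -
  let ?d = "\<lambda>k. length (ch (bfs.visit k))"
  define Inv where "Inv i s m' \<longleftrightarrow>
    (\<forall>k<n. n - i \<le> k \<longrightarrow> size_ok (narr s ''size'') (narr s ''heavy'') (bfs.visit k)) \<and>
    m' \<le> m + 1 + (\<Sum>k\<in>{n-i..<n}. 12 + 7 * ?d k)" for i m' and s :: memory
  show ?thesis
    unfolding sizes_prog_def
    apply (rule wp_For[where Inv = Inv and N = n])
    subgoal by (simp add: Inv_def)
    subgoal by simp
    subgoal using assms by (simp add: agreeD inpD)
    subgoal using assms by (simp add: Inv_def)
    subgoal premises p for i s' m'
    proof -
      have i': "inp s'" by (rule inp_agree[OF assms(1)]) (use p in \<open>auto\<close>)
      define k where "k = n - 1 - i"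
      define u where "u = bfs.visit k"
      have k: "k < n" "n - i = Suc k" "n - Suc i = k" using p(2) by (auto simp: k_def)
      have u: "narr s' ''ord'' (n - Suc i) = u" "u < n"
        using assms(2) p k bfs_prefix(3) by (simp_all add: u_def agreeD)
      have ch_later: "\<exists>k'. k < k' \<and> k' < n \<and> v = bfs.visit k'" if "v \<in> set (ch u)" for v
        using bfs.child_visited_later[of k v] that k by (auto simp: u_def)
      have inv: "size_ok (narr s' ''size'') (narr s' ''heavy'') (bfs.visit k')" if "k < k'" "k' < n" for k'
        using p(1) that k by (simp add: Inv_def)
      \<comment> \<open>Storing the results for \<open>u\<close> must not disturb the vertices
        already handled: \<open>u\<close> is neither one of them nor a child of one.\<close>
      have fresh: "u \<notin> set (ch (bfs.visit k'))" "u \<noteq> bfs.visit k'" if "k < k'" "k' < n" for k'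
      proof -
        show "u \<noteq> bfs.visit k'" using bfs.visit_inj[of k k'] that k by (auto simp: u_def)
        show "u \<notin> set (ch (bfs.visit k'))"
          using bfs.child_visited_later[of k' u] bfs.visit_inj[of k] that k
          by (metis card_verts not_less_iff_gr_or_eq order.strict_trans u_def)
      qed
      have fresh_u: "u \<notin> set (ch u)"
        using ch_later[of u] fresh(2) by blast
      let ?sz = "narr s' ''size''"
      show ?thesis
        apply (simp add: p u i' inpD)
        \<comment> \<open>The start values are sound: if the size of the first child does not exceed
          the initial 0 of \<open>best\<close>, then it equals \<open>best\<close>, and
          \<open>h = 0\<close> is already its position.\<close>
        apply (rule wp_For[where N = "length (ch u)" and Inv = "\<lambda>j s m''.
            narr s ''size'' = ?sz \<and> narr s ''heavy'' = narr s' ''heavy'' \<and>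
            reg s ''s'' = 1 + (\<Sum>v\<leftarrow>take j (ch u). ?sz v) \<and>
            (\<forall>v\<in>set (take j (ch u)). ?sz v \<le> reg s ''best'') \<and>
            (j = 0 \<longrightarrow> reg s ''h'' = 0 \<and> reg s ''best'' = 0) \<and>
            (0 < j \<longrightarrow> reg s ''h'' < j \<and> ?sz (ch u ! reg s ''h'') = reg s ''best'') \<and>
            m'' \<le> m' + 7 + 7 * j"])
        subgoal by simp
        subgoal by simp
        subgoal using i' u by (simp add: agreeD inpD)
        subgoal by simp
        subgoal premises q for j s'' m''
        proof -
          have z: "narr s'' ''child'' (reg s'' ''o'' + j) = ch u ! j" "narr s'' ''size'' = ?sz"
            using q i' u by (simp_all add: agreeD inpD)
          have "?sz v \<le> ?sz (ch u ! j)" if "v \<in> set (take j (ch u))" "reg s'' ''best'' < ?sz (ch u ! j)" for v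
            using q(1) that by (meson le_less_trans less_imp_le)
          then show ?thesis
            using q(1,2) by (simp add: z q(3) take_Suc_conv_app_nth) (auto simp: not_less intro: less_SucI)
        qed
        subgoal premises q for s'' m''
        proof -
          have "size_ok (?sz(u := reg s'' ''s'')) ((narr s' ''heavy'')(u := reg s'' ''h'')) u"
          proof -
            have "(\<Sum>v\<leftarrow>ch u. (?sz(u := reg s'' ''s'')) v) = (\<Sum>v\<leftarrow>ch u. ?sz v)"
              using fresh_u by (intro arg_cong[of _ _ sum_list] map_cong) auto
            moreover have "ch u ! reg s'' ''h'' \<noteq> u" if "ch u \<noteq> []"
              using fresh_u q that by (metis length_greater_0_conv nth_mem)
            ultimately show ?thesis
              using q fresh_u unfolding size_ok_def by auto
          qed
          moreover have "size_ok (?sz(u := x)) ((narr s' ''heavy'')(u := y)) (bfs.visit k')"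
            if "k < k'" "k' < n" for k' x y
          proof -
            let ?w = "bfs.visit k'"
            have "(\<Sum>v\<leftarrow>ch ?w. (?sz(u := x)) v) = (\<Sum>v\<leftarrow>ch ?w. ?sz v)"
              using fresh[OF that] by (intro arg_cong[of _ _ sum_list] map_cong) auto
            moreover have "ch ?w ! narr s' ''heavy'' ?w \<noteq> u" if "ch ?w \<noteq> []"
              using fresh[OF \<open>k < k'\<close> \<open>k' < n\<close>] inv[OF \<open>k < k'\<close> \<open>k' < n\<close>] that
              unfolding size_ok_def by (metis nth_mem)
            ultimately show ?thesis
              using inv[OF that] fresh[OF that] unfolding size_ok_def by auto
          qed
          ultimately have all: "size_ok (?sz(u := reg s'' ''s'')) ((narr s' ''heavy'')(u := reg s'' ''h'')) (bfs.visit k')"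
            if "k \<le> k'" "k' < n" for k'
            using that by (cases "k = k'") (auto simp: u_def)
          have arrs: "narr s'' ''size'' = ?sz" "narr s'' ''heavy'' = narr s' ''heavy''"
            and t: "m'' \<le> m' + 7 + 7 * length (ch u)"
            using q(1) by blast+
          have ru: "reg s'' ''u'' = u" using q(3) by (simp add: agreeD)
          have "m' \<le> m + 1 + (\<Sum>k\<in>{n - i..<n}. 12 + 7 * ?d k)" using p(1) by (simp add: Inv_def)
          moreover have "(\<Sum>j\<in>{k..<n}. 12 + 7 * ?d j) = 12 + 7 * ?d k + (\<Sum>j\<in>{Suc k..<n}. 12 + 7 * ?d j)"
            using k by (simp add: sum.atLeast_Suc_lessThan)
          ultimately show ?thesis
            using t all by (simp add: Inv_def k ru arrs u_def[symmetric])
        qed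
        done
    qed
    subgoal premises p for s' m'
    proof -
      have "(\<Sum>k\<in>{0..<n}. 12 + 7 * ?d k) = 12 * n + 7 * (\<Sum>k<n. ?d k)"
        by (simp add: sum.distrib sum_distrib_left atLeast0LessThan)
      then have "m' + 1 \<le> m + 30 * n"
        using p bfs.sum_length_children n_pos by (simp add: Inv_def)
      moreover have "size_ok (narr s' ''size'') (narr s' ''heavy'') u" if u: "u < n" for u
      proof -
        obtain k where "k < n" "u = bfs.visit k" using bfs.visit_obtain[of u] u verts by auto
        then show ?thesis using p by (simp add: Inv_def)
      qed
      ultimately show ?thesis by simp
    qed
    done
qed


section \<open>Sorting the rules by arity\<close>

text \<open>With one list per arity, a stack meets only rules whose arity fits its vertex, as
  \<open>branch_cost\<close> presupposes. Insertion at the front explains the \<open>rev\<close> in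
  \<open>bucket\<close>.\<close>

definition buckets_prog :: com where
  "buckets_prog =
     For ''r'' (Reg ''num_rules'') (
       ''d'' ::= Sub (Get ''rule_offset'' (Add (Reg ''r'') (Const 1))) (Get ''rule_offset'' (Reg ''r'')) ;;
       Put ''next_rule'' (Reg ''r'') (Get ''bucket'' (Reg ''d'')) ;;
       Put ''bucket'' (Reg ''d'') (Add (Reg ''r'') (Const 1)))"

definition bucket :: "nat \<Rightarrow> nat list" where
  "bucket d = rev (filter (\<lambda>r. arity r = d) [0..<length rs])"

lemma buckets_prog_wp:
  assumes "inp s" "narr s ''bucket'' = (\<lambda>_. 0)"
  shows "wp buckets_prog (\<lambda>s' m'. (\<forall>d. chain (narr s' ''next_rule'') (narr s' ''bucket'' d) (bucket d)) \<and>
    m' \<le> m + 2 + 5 * length rs) s m"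
  unfolding buckets_prog_def
  apply (rule wp_For[where N = "length rs" and Inv = "\<lambda>k s m'.
    (\<forall>d. chain (narr s ''next_rule'') (narr s ''bucket'' d) (rev (filter (\<lambda>r. arity r = d) [0..<k]))) \<and>
    m' \<le> m + 1 + 5 * k"])
  subgoal by simp
  subgoal by simp
  subgoal using assms by (simp add: agreeD inpD)
  subgoal using assms by simp
  subgoal premises p for r s' m'
  proof -
    have "inp s'" by (rule inp_agree[OF assms(1)]) (use p in \<open>auto\<close>)
    then show ?thesis using p by (simp add: inpD)
  qed
  subgoal by (simp add: bucket_def)
  done

end


context heavy_knap
begin

section \<open>Hash-consed stacks\<close>

text \<open>
  Stacks of states are stored in a trie: \<open>\<pi> st\<close> is the address of the node for \<open>st\<close>, or 0 if there
  is none, and the cell \<open>\<pi> st + q\<close> of the array \<open>''push''\<close> points to the node for \<open>q # st\<close>.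
\<close>

definition heap :: "(nat list \<Rightarrow> nat) \<Rightarrow> (nat \<Rightarrow> nat) \<Rightarrow> (nat \<Rightarrow> nat) \<Rightarrow> (nat \<Rightarrow> nat) \<Rightarrow> (nat \<Rightarrow> nat) \<Rightarrow> nat \<Rightarrow> bool" where
  "heap \<pi> pu tp bl mk fr \<longleftrightarrow> \<pi> [] = 1 \<and>
     (\<forall>st. \<pi> st \<noteq> 0 \<longrightarrow> \<pi> st + B \<le> fr) \<and>
     (\<forall>st st' q q'. \<pi> st \<noteq> 0 \<longrightarrow> \<pi> st' \<noteq> 0 \<longrightarrow> q < B \<longrightarrow> q' < B \<longrightarrow> \<pi> st + q = \<pi> st' + q' \<longrightarrow>
        st = st' \<and> q = q') \<and>
     (\<forall>st q. \<pi> st \<noteq> 0 \<longrightarrow> q < B \<longrightarrow> pu (\<pi> st + q) = \<pi> (q # st)) \<and>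
     (\<forall>st q. \<pi> (q # st) \<noteq> 0 \<longrightarrow>
        q < B \<and> \<pi> st \<noteq> 0 \<and> tp (\<pi> (q # st)) = q \<and> bl (\<pi> (q # st)) = \<pi> st) \<and>
     (\<forall>a\<ge>fr. pu a = 0 \<and> mk a = 0)"

abbreviation heap_of :: "(nat list \<Rightarrow> nat) \<Rightarrow> memory \<Rightarrow> bool" where
  "heap_of \<pi> s \<equiv> heap \<pi> (narr s ''push'') (narr s ''top'') (narr s ''below'') (narr s ''mark'') (reg s ''free'')"

lemma heapD:
  assumes "heap \<pi> pu tp bl mk fr"
  shows "\<pi> [] = 1" "\<pi> st \<noteq> 0 \<Longrightarrow> \<pi> st + B \<le> fr"
    "\<pi> st \<noteq> 0 \<Longrightarrow> \<pi> st' \<noteq> 0 \<Longrightarrow> q < B \<Longrightarrow> q' < B \<Longrightarrow> \<pi> st + q = \<pi> st' + q' \<Longrightarrow> st = st' \<and> q = q'"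
    "\<pi> st \<noteq> 0 \<Longrightarrow> q < B \<Longrightarrow> pu (\<pi> st + q) = \<pi> (q # st)"
    "\<pi> (q # st) \<noteq> 0 \<Longrightarrow> q < B \<and> \<pi> st \<noteq> 0 \<and> tp (\<pi> (q # st)) = q \<and> bl (\<pi> (q # st)) = \<pi> st"
    "fr \<le> a \<Longrightarrow> pu a = 0" "fr \<le> a \<Longrightarrow> mk a = 0"
  using assms unfolding heap_def by blast+

lemma heap_inj:
  assumes "heap \<pi> pu tp bl mk fr" "0 < B" "\<pi> st \<noteq> 0" "\<pi> st' = \<pi> st"
  shows "st' = st"
  using heapD(3)[OF assms(1), of st' st 0 0] assms by simp

text \<open>Growth of the trie that other structures survive: addresses held in registers and
  entries remain valid, and a new node is unmarked, so it belongs to no layer yet.\<close>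

definition extends :: "(nat list \<Rightarrow> nat) \<Rightarrow> (nat list \<Rightarrow> nat) \<Rightarrow> (nat \<Rightarrow> nat) \<Rightarrow> bool" where
  "extends \<pi> \<pi>' mk \<longleftrightarrow> (\<forall>st. \<pi> st \<noteq> 0 \<longrightarrow> \<pi>' st = \<pi> st) \<and>
     (\<forall>st. \<pi> st = 0 \<longrightarrow> \<pi>' st \<noteq> 0 \<longrightarrow> mk (\<pi>' st) = 0)"

lemma extends_refl: "extends \<pi> \<pi> mk" by (simp add: extends_def)

lemma extends_trans: "extends \<pi> \<pi>' mk \<Longrightarrow> extends \<pi>' \<pi>'' mk \<Longrightarrow> extends \<pi> \<pi>'' mk"
  unfolding extends_def by metis

text \<open>The new node takes the \<open>B\<close> cells from \<open>fr\<close> on, all still 0.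
  This is right because no extension of the new stack can be stored: stored stacks are closed under
  tails.\<close>

lemma heap_insert:
  assumes h: "heap \<pi> pu tp bl mk fr" and st: "\<pi> st \<noteq> 0" and q: "q < B" and new: "\<pi> (q # st) = 0"
  shows "heap (\<pi>(q # st := fr)) (pu(\<pi> st + q := fr)) (tp(fr := q)) (bl(fr := \<pi> st)) mk (fr + B)"
    "extends \<pi> (\<pi>(q # st := fr)) mk" "0 < fr"
proof -
  note hD = heapD[OF h]
  show fr: "0 < fr" using hD(2)[OF st] q by simp
  let ?\<pi> = "\<pi>(q # st := fr)"
  have below: "\<pi> st' < fr" "\<pi> st' + q' < fr" if "\<pi> st' \<noteq> 0" "q' < B" for st' q'
    using hD(2)[OF that(1)] that(2) by auto
  have tails: "\<pi> st' \<noteq> 0" if "\<pi> (q' # st') \<noteq> 0" for q' st' using hD(5) that by blast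
  have st_ne: "q # st \<noteq> []" "st \<noteq> q # st" by auto
  show "extends \<pi> ?\<pi> mk" using hD(7)[of fr] new by (auto simp: extends_def)
  show "heap ?\<pi> (pu(\<pi> st + q := fr)) (tp(fr := q)) (bl(fr := \<pi> st)) mk (fr + B)"
    unfolding heap_def
  proof (intro conjI allI impI)
    show "?\<pi> [] = 1" using hD(1) by simp
    show "?\<pi> st' + B \<le> fr + B" if "?\<pi> st' \<noteq> 0" for st'
      using that hD(2)[of st'] by (auto split: if_splits)
    show "st1 = st2" "q1 = q2" if "?\<pi> st1 \<noteq> 0" "?\<pi> st2 \<noteq> 0" "q1 < B" "q2 < B" "?\<pi> st1 + q1 = ?\<pi> st2 + q2"
      for st1 st2 q1 q2
      using that hD(3)[of st1 st2 q1 q2] below(2)[of st1 q1] below(2)[of st2 q2]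
      by (auto split: if_splits)
    show "(pu(\<pi> st + q := fr)) (?\<pi> st' + q') = ?\<pi> (q' # st')" if "?\<pi> st' \<noteq> 0" "q' < B" for st' q'
    proof (cases "st' = q # st")
      case True
      have "\<pi> (q' # st') = 0" using tails new True by blast
      then show ?thesis using True hD(6)[of "fr + q'"] below[OF st q] by auto
    next
      case False
      then show ?thesis using that hD(4)[of st' q'] hD(3)[OF _ st that(2) q] by auto
    qed
    fix st' q' assume a: "?\<pi> (q' # st') \<noteq> 0"
    have "\<pi> st' \<noteq> 0 \<and> st' \<noteq> q # st"
    proof (cases "q' # st' = q # st")
      case False
      then have "\<pi> (q' # st') \<noteq> 0" using a by (simp only: fun_upd_other not_False_eq_True)
      then show ?thesis using tails new by metis
    qed (use st in auto)
    moreover have "\<pi> (q' # st') \<noteq> fr" if "\<pi> (q' # st') \<noteq> 0"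
      using below(1)[OF that q] by simp
    ultimately show "q' < B" "?\<pi> st' \<noteq> 0" "(tp(fr := q)) (?\<pi> (q' # st')) = q'"
      "(bl(fr := \<pi> st)) (?\<pi> (q' # st')) = ?\<pi> st'"
      using hD(5)[of q' st'] a q by (auto split: if_splits)
  next
    show "(pu(\<pi> st + q := fr)) a = 0" if "fr + B \<le> a" for a
      using that hD(6) below(2)[OF st q] by auto
    show "mk a = 0" if "fr + B \<le> a" for a using that hD(7) by simp
  qed
qed

definition push_prog :: com where
  "push_prog =
     ''cell'' ::= Add (Reg ''y'') (Reg ''q'') ;;
     If (Less (Const 0) (Get ''push'' (Reg ''cell''))) Skip
       (Put ''push'' (Reg ''cell'') (Reg ''free'') ;;
        Put ''top'' (Reg ''free'') (Reg ''q'') ;;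
        Put ''below'' (Reg ''free'') (Reg ''y'') ;;
        ''free'' ::= Add (Reg ''free'') (Reg ''num_states'')) ;;
     ''y'' ::= Get ''push'' (Reg ''cell'')"

lemma writes_push [simp]: "wregs push_prog = {''cell'', ''free'', ''y''}"
  "wnarrs push_prog = {''push'', ''top'', ''below''}" "wrarrs push_prog = {}"
  by (auto simp: push_prog_def)

lemma push_prog_wp:
  assumes "heap_of \<pi> s" "\<pi> st \<noteq> 0" "reg s ''y'' = \<pi> st" "reg s ''q'' < B" "reg s ''num_states'' = B"
  shows "wp push_prog (\<lambda>s' m'. \<exists>\<pi>'. heap_of \<pi>' s' \<and> extends \<pi> \<pi>' (narr s ''mark'') \<and>
    \<pi>' (reg s ''q'' # st) \<noteq> 0 \<and> reg s' ''y'' = \<pi>' (reg s ''q'' # st) \<and> m' \<le> m + 7) s m"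
proof (cases "\<pi> (reg s ''q'' # st) = 0")
  case True
  note ins = heap_insert[OF assms(1,2,4) True]
  show ?thesis
    using True heapD(4)[OF assms(1,2,4)] heapD(2)[OF assms(1,2)] assms(3-5) ins
    by (auto simp: push_prog_def intro!: exI[of _ "\<pi>(reg s ''q'' # st := reg s ''free'')"])
next
  case False
  then show ?thesis
    using heapD(4)[OF assms(1,2,4)] assms
    by (auto simp: push_prog_def intro!: exI[of _ \<pi>] extends_refl)
qed

definition eq :: "nexp \<Rightarrow> nexp \<Rightarrow> bexp" where
  "eq e1 e2 = BAnd (BNot (Less e1 e2)) (BNot (Less e2 e1))"

lemma bval_eq [simp]: "bval (eq e1 e2) s \<longleftrightarrow> nval e1 s = nval e2 s"
  by (auto simp: eq_def)

definition push_rhs_prog :: com where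
  "push_rhs_prog =
     If (Less (Const 0) (Reg ''d''))
       (''q'' ::= Get ''rule_rhs'' (Add (Reg ''ro'') (Reg ''h'')) ;;
        push_prog ;;
        For ''j'' (Reg ''d'')
          (If (eq (Reg ''j'') (Reg ''h'')) Skip
            (''q'' ::= Get ''rule_rhs'' (Add (Reg ''ro'') (Reg ''j'')) ;; push_prog)))
       Skip"

lemma writes_push_rhs [simp]: "wregs push_rhs_prog = {''cell'', ''free'', ''y'', ''q'', ''j''}"
  "wnarrs push_rhs_prog = {''push'', ''top'', ''below''}" "wrarrs push_rhs_prog = {}"
  by (auto simp: push_rhs_prog_def)

lemma push_rhs_prog_wp:
  assumes inp: "inp s" and heap: "heap_of \<pi> s" and st: "\<pi> st \<noteq> 0" "reg s ''y'' = \<pi> st"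
    and u: "u < n" "reg s ''d'' = length (ch u)" "ch u \<noteq> [] \<Longrightarrow> reg s ''h'' = hv u"
    and r: "r < length rs" "arity r = length (ch u)" "reg s ''ro'' = narr s ''rule_offset'' r"
  shows "wp push_rhs_prog (\<lambda>s' m'. \<exists>\<pi>'. heap_of \<pi>' s' \<and> extends \<pi> \<pi>' (narr s ''mark'') \<and>
    \<pi>' (piece u (snd (snd (rs ! r))) @ st) \<noteq> 0 \<and>
    reg s' ''y'' = \<pi>' (piece u (snd (snd (rs ! r))) @ st) \<and> m' \<le> m + 12 + 12 * length (ch u)) s m"
proof -
  let ?qs = "snd (snd (rs ! r))" and ?d = "length (ch u)"
  have "(fst (rs ! r), fst (snd (rs ! r)), ?qs) \<in> set rs" using r(1) by simp
  then have "set ?qs \<subseteq> {..<B}" using rule_in_range(3)[of "fst (rs ! r)"] set_rs by blast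
  then have qs_less: "?qs ! j < B" if "j < ?d" for j
    using that r(2) by (metis lessThan_iff nth_mem subsetD)
  show ?thesis
  proof (cases "ch u = []")
    case True
    then show ?thesis
      using heap st u(2) extends_refl by (auto simp: push_rhs_prog_def piece_def pos_def)
  next
    case False
    have h: "reg s ''h'' = hv u" "hv u < ?d" using u(3) False hv_less[OF u(1)] by auto
    have d: "0 < ?d" using False by simp
    \<comment> \<open>The stack after the heavy position and the positions below \<open>j\<close>
      have been pushed; in round \<open>hv u\<close> it stays the same. For \<open>j = ?d\<close> it
      is the \<open>piece\<close> on top of \<open>st\<close>.\<close>
    define stk where "stk j = rev (map ((!) ?qs) (hv u # filter (\<lambda>j. j \<noteq> hv u) [0..<j])) @ st" for j
    define Inv where "Inv j s' m' \<longleftrightarrow> (\<exists>\<pi>'. heap_of \<pi>' s' \<and> extends \<pi> \<pi>' (narr s ''mark'') \<and>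
      \<pi>' (stk j) \<noteq> 0 \<and> reg s' ''y'' = \<pi>' (stk j) \<and> m' \<le> m + 10 + 12 * j)" for j m' and s' :: memory
    have rhs: "narr s ''rule_rhs'' (narr s ''rule_offset'' r + j) = ?qs ! j" if "j < ?d" for j
      using inp_rules(2)[OF inp r(1)] that r(2) by simp
    show ?thesis
      unfolding push_rhs_prog_def
      apply (simp add: u d False)
      apply (rule wp_conseq[OF push_prog_wp[where \<pi> = \<pi> and st = st]])
      subgoal using heap by simp
      subgoal using st by simp
      subgoal using st by simp
      subgoal using rhs[OF h(2)] qs_less[OF h(2)] h r by simp
      subgoal using inp by (simp add: inpD)
      subgoal premises p for s1 m1
        apply (rule wp_For[where Inv = Inv and N = ?d])
        subgoal by (simp add: Inv_def)
        subgoal by simp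
        subgoal using u p by (simp add: agreeD)
        subgoal using p(1) rhs[OF h(2)] h r by (auto simp: Inv_def stk_def)
        subgoal premises q for j s2 m2
        proof -
          have hj: "reg s2 ''h'' = hv u" "reg s2 ''ro'' = narr s ''rule_offset'' r" "reg s2 ''j'' = j"
             "narr s2 ''rule_rhs'' = narr s ''rule_rhs''" "reg s2 ''num_states'' = B"
             "narr s2 ''mark'' = narr s ''mark''"
            using p q h r inp by (simp_all add: agreeD inpD)
          obtain \<pi>2 where \<pi>2: "heap_of \<pi>2 s2" "extends \<pi> \<pi>2 (narr s ''mark'')"
            "\<pi>2 (stk j) \<noteq> 0" "reg s2 ''y'' = \<pi>2 (stk j)" "m2 \<le> m + 10 + 12 * j"
            using q(1) by (auto simp: Inv_def)
          show ?thesis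
          proof (cases "j = hv u")
            case True
            then have "stk (Suc j) = stk j" by (simp add: stk_def)
            then show ?thesis using True hj \<pi>2 by (auto simp: Inv_def)
          next
            case False
            have "stk (Suc j) = ?qs ! j # stk j" using False by (simp add: stk_def)
            note stkS = this
            show ?thesis
              apply (simp add: hj False rhs[OF q(2)])
              apply (rule wp_conseq[OF push_prog_wp[where \<pi> = \<pi>2 and st = "stk j"]])
              using \<pi>2 qs_less[OF q(2)] hj by (auto simp: Inv_def stkS intro: extends_trans)
          qed
        qed
        subgoal premises q for s2 m2
        proof -
          have "stk ?d = piece u ?qs @ st" using False by (simp add: stk_def piece_def pos_def)
          then show ?thesis using q(1) by (auto simp: Inv_def)
        qed
        done
      done
  qed
qed

end


text \<open>
  Lists of pairs (vertex, label) are stored as linked cells; the pointer 1 is the empty list, and the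
  pointer 0 in a table cell means that no list has the weight of this cell.
\<close>

fun list_at :: "(nat \<Rightarrow> nat) \<Rightarrow> (nat \<Rightarrow> nat) \<Rightarrow> (nat \<Rightarrow> nat) \<Rightarrow> nat \<Rightarrow> (nat \<times> nat) list \<Rightarrow> bool" where
  "list_at lv ls lx p [] \<longleftrightarrow> p = 1"
| "list_at lv ls lx p (x # l) \<longleftrightarrow>
     1 < p \<and> lv p = fst x \<and> ls p = snd x \<and> lx p < p \<and> list_at lv ls lx (lx p) l"

text \<open>Pointers decrease along a list, so a list that starts below \<open>f\<close> never
  reaches the cell \<open>f\<close>. Allocating at the top therefore preserves all older
  lists.\<close>

lemma list_at_upd:
  "list_at lv ls lx p l \<Longrightarrow> p < f \<Longrightarrow> list_at (lv(f := x)) (ls(f := y)) (lx(f := z)) p l"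
  by (induction lv ls lx p l rule: list_at.induct) auto

lemma block_address_eq:
  "c < k \<Longrightarrow> c' < k \<Longrightarrow> i * k + c = j * k + c' \<longleftrightarrow> i = j \<and> c = (c' :: nat)"
  by (metis add.commute add_cancel_right_left add_left_cancel div_less div_mult_self3 gr_implies_not_zero)

lemma block_address_less:
  assumes "c < k" "i < j" shows "i * k + c < j * (k :: nat)"
proof -
  have "Suc i * k \<le> j * k" using assms(2) by (intro mult_le_mono1) simp
  then show ?thesis using assms(1) by simp
qed

context heavy_knap
begin

section \<open>Layers of dynamic programming tables\<close>

text \<open>
  Entry number \<open>k\<close> consists of a stack and of a table at the addresses from \<open>k * Suc C\<close> to
  \<open>k * Suc C + C\<close>.  The entries from \<open>''lend''\<close> up to \<open>''ne''\<close> form the layer under construction;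
  a stack belongs to this layer iff its mark exceeds \<open>''lend''\<close>.
\<close>

definition entries :: "(nat list \<Rightarrow> nat) \<Rightarrow> (nat \<Rightarrow> nat) \<Rightarrow> (nat \<Rightarrow> nat) \<Rightarrow> (nat \<Rightarrow> nat) \<Rightarrow> nat \<Rightarrow> nat \<Rightarrow> nat \<Rightarrow>
    nat list list \<Rightarrow> bool" where
  "entries \<pi> node base mk lend ne bfree nxt \<longleftrightarrow>
     ne = lend + length nxt \<and> bfree = ne * Suc C \<and>
     (\<forall>k<length nxt. node (lend + k) = \<pi> (nxt ! k) \<and> \<pi> (nxt ! k) \<noteq> 0 \<and> mk (\<pi> (nxt ! k)) = Suc (lend + k)) \<and>
     (\<forall>k<ne. base k = k * Suc C) \<and>
     (\<forall>st. \<pi> st \<noteq> 0 \<longrightarrow> mk (\<pi> st) \<le> ne \<and> (lend < mk (\<pi> st) \<longrightarrow> st \<in> set nxt))"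

abbreviation entries_of :: "(nat list \<Rightarrow> nat) \<Rightarrow> nat list list \<Rightarrow> memory \<Rightarrow> bool" where
  "entries_of \<pi> nxt s \<equiv> entries \<pi> (narr s ''ent_node'') (narr s ''ent_base'') (narr s ''mark'')
     (reg s ''lend'') (reg s ''ne'') (reg s ''bfree'') nxt"

lemma entriesD:
  assumes "entries \<pi> node base mk lend ne bfree nxt"
  shows "ne = lend + length nxt" "bfree = (lend + length nxt) * Suc C"
    "k < length nxt \<Longrightarrow> node (lend + k) = \<pi> (nxt ! k)" "k < length nxt \<Longrightarrow> \<pi> (nxt ! k) \<noteq> 0"
    "k < length nxt \<Longrightarrow> mk (\<pi> (nxt ! k)) = Suc (lend + k)"
    "k < lend + length nxt \<Longrightarrow> base k = k * Suc C"
    "\<pi> st \<noteq> 0 \<Longrightarrow> mk (\<pi> st) \<le> lend + length nxt" "\<pi> st \<noteq> 0 \<Longrightarrow> lend < mk (\<pi> st) \<Longrightarrow> st \<in> set nxt"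
  using assms unfolding entries_def by auto

lemma entries_extends:
  assumes "entries \<pi> node base mk lend ne bfree nxt" "extends \<pi> \<pi>' mk"
  shows "entries \<pi>' node base mk lend ne bfree nxt"
proof -
  have same: "\<pi>' st = \<pi> st" if "\<pi> st \<noteq> 0" for st using assms(2) that by (simp add: extends_def)
  have old: "mk (\<pi>' st) \<le> ne \<and> (lend < mk (\<pi>' st) \<longrightarrow> st \<in> set nxt)" if "\<pi>' st \<noteq> 0" for st
  proof (cases "\<pi> st = 0")
    case True
    then have "mk (\<pi>' st) = 0" using assms(2) that by (simp add: extends_def)
    then show ?thesis by simp
  next
    case False
    then show ?thesis using entriesD(1,7,8)[OF assms(1)] same by simp
  qed
  show ?thesis
    unfolding entries_def
  proof (intro conjI allI impI)
    show "ne = lend + length nxt" "bfree = ne * Suc C"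
      using entriesD(1,2)[OF assms(1)] by blast+
    show "base k = k * Suc C" if "k < ne" for k
      using entriesD(6)[OF assms(1)] that entriesD(1)[OF assms(1)] by blast
    show "node (lend + k) = \<pi>' (nxt ! k)" "\<pi>' (nxt ! k) \<noteq> 0" "mk (\<pi>' (nxt ! k)) = Suc (lend + k)"
      if "k < length nxt" for k
      using entriesD(3-5)[OF assms(1) that] same[of "nxt ! k"] by simp_all
  qed (use old in blast)+
qed

lemma entries_distinct:
  assumes "entries \<pi> node base mk lend ne bfree nxt" shows "distinct nxt"
proof -
  have "i = j" if "i < length nxt" "j < length nxt" "nxt ! i = nxt ! j" for i j
  proof -
    have "Suc (lend + i) = mk (\<pi> (nxt ! i))" using entriesD(5)[OF assms that(1)] by (rule sym)
    also have "\<dots> = mk (\<pi> (nxt ! j))" by (simp only: that(3))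
    also have "\<dots> = Suc (lend + j)" by (rule entriesD(5)[OF assms that(2)])
    finally show ?thesis by simp
  qed
  then show ?thesis unfolding distinct_conv_nth by blast
qed

text \<open>Marks are never erased: one left by an earlier layer is at most \<open>lend\<close> and
  thus reads as absent. A mark is the entry number plus one. The base address is stored because
  \<open>ne * Suc C\<close> could not be multiplied out in one step.\<close>

definition entry_prog :: com where
  "entry_prog =
     If (Less (Reg ''lend'') (Get ''mark'' (Reg ''y''))) Skip
       (Put ''ent_node'' (Reg ''ne'') (Reg ''y'') ;;
        Put ''ent_base'' (Reg ''ne'') (Reg ''bfree'') ;;
        ''bfree'' ::= Add (Add (Reg ''bfree'') (Reg ''capacity'')) (Const 1) ;;
        ''ne'' ::= Add (Reg ''ne'') (Const 1) ;;
        Put ''mark'' (Reg ''y'') (Reg ''ne'')) ;;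
     ''b2'' ::= Get ''ent_base'' (Sub (Get ''mark'' (Reg ''y'')) (Const 1))"

lemma writes_entry [simp]: "wregs entry_prog = {''bfree'', ''ne'', ''b2''}"
  "wnarrs entry_prog = {''ent_node'', ''ent_base'', ''mark''}" "wrarrs entry_prog = {}"
  by (auto simp: entry_prog_def)

lemma entry_prog_wp:
  assumes heap: "heap_of \<pi> s" and ent: "entries_of \<pi> nxt s"
    and st: "\<pi> st \<noteq> 0" "reg s ''y'' = \<pi> st" and C: "reg s ''capacity'' = C" and B: "0 < B"
  shows "wp entry_prog (\<lambda>s' m'. heap_of \<pi> s' \<and> (\<exists>nxt' k. entries_of \<pi> nxt' s' \<and>
    k < length nxt' \<and> nxt' ! k = st \<and> reg s' ''b2'' = (reg s ''lend'' + k) * Suc C \<and>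
    (nxt' = nxt \<and> reg s' ''bfree'' = reg s ''bfree'' \<or>
     nxt' = nxt @ [st] \<and> st \<notin> set nxt \<and> reg s' ''bfree'' = reg s ''bfree'' + Suc C) \<and>
    (\<forall>j<reg s ''ne''. narr s' ''ent_node'' j = narr s ''ent_node'' j) \<and> m' \<le> m + 7)) s m"
proof (cases "reg s ''lend'' < narr s ''mark'' (\<pi> st)")
  case True
  then obtain k where k: "k < length nxt" "nxt ! k = st"
    using entriesD(8)[OF ent st(1)] by (auto simp: in_set_conv_nth)
  then have "narr s ''mark'' (\<pi> st) = Suc (reg s ''lend'' + k)" using entriesD(5)[OF ent] by blast
  then show ?thesis
    using True k st heap ent entriesD(6)[OF ent, of "reg s ''lend'' + k"]
    by (auto simp: entry_prog_def intro!: exI[of _ nxt] exI[of _ k])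
next
  case False
  have new: "st \<notin> set nxt"
  proof
    assume "st \<in> set nxt"
    then obtain k where "k < length nxt" "nxt ! k = st" by (auto simp: in_set_conv_nth)
    then show False using entriesD(5)[OF ent, of k] False by auto
  qed
  have fr: "\<pi> st < reg s ''free''" using heapD(2)[OF heap st(1)] B by simp
  define mk where "mk = (narr s ''mark'')(\<pi> st := Suc (reg s ''ne''))"
  have ne: "reg s ''ne'' = reg s ''lend'' + length nxt" using entriesD(1)[OF ent] .
  have heap': "heap \<pi> (narr s ''push'') (narr s ''top'') (narr s ''below'') mk (reg s ''free'')"
    using heap fr unfolding heap_def mk_def by auto
  have inj: "st' = st" if "\<pi> st' = \<pi> st" for st' using heap_inj[OF heap B st(1) that] .
  have mk_eq: "mk (\<pi> st') = (if st' = st then Suc (reg s ''ne'') else narr s ''mark'' (\<pi> st'))" for st'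
    using inj by (auto simp: mk_def)
  have "entries \<pi> ((narr s ''ent_node'')(reg s ''ne'' := \<pi> st))
     ((narr s ''ent_base'')(reg s ''ne'' := reg s ''bfree'')) mk
     (reg s ''lend'') (Suc (reg s ''ne'')) (reg s ''bfree'' + Suc C) (nxt @ [st])"
    using ent new st(1) unfolding entries_def mk_eq
    by (auto simp: nth_append less_Suc_eq ne intro: le_SucI)
  then show ?thesis
    using False st C heap' ne entriesD(2)[OF ent]
    by (auto simp: entry_prog_def mk_def intro!: exI[of _ "nxt @ [st]"] exI[of _ "length nxt"] new)
qed

text \<open>A cell stands for the exact weight \<open>c\<close>, so different cells compete only in
  the final output. The bound \<open>p < lf\<close> keeps the list out of reach of later
  allocations.\<close>

definition best :: "(nat \<Rightarrow> nat) \<Rightarrow> (nat \<Rightarrow> nat) \<Rightarrow> (nat \<Rightarrow> nat) \<Rightarrow> nat \<Rightarrow> nat \<Rightarrow> real \<Rightarrow> nat \<Rightarrow>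
    (nat \<times> nat) list set \<Rightarrow> bool" where
  "best lv ls lx lf p v c P \<longleftrightarrow>
     (if p = 0 then \<forall>l\<in>P. total (weight I) l \<noteq> c
      else p < lf \<and> (\<exists>l\<in>P. list_at lv ls lx p l \<and> total (weight I) l = c \<and> total (profit I) l = v) \<and>
        (\<forall>l\<in>P. total (weight I) l = c \<longrightarrow> total (profit I) l \<le> v))"

definition table where
  "table lst vl lv ls lx lf b P \<longleftrightarrow> (\<forall>c\<le>C. best lv ls lx lf (lst (b + c)) (vl (b + c)) c P)"

abbreviation table_of :: "memory \<Rightarrow> nat \<Rightarrow> (nat \<times> nat) list set \<Rightarrow> bool" where
  "table_of s \<equiv> table (narr s ''lst'') (rarr s ''val'') (narr s ''lv'') (narr s ''ls'') (narr s ''lx'') (reg s ''lf'')"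

definition layer where
  "layer lst vl lv ls lx lf lend bfree nxt F \<longleftrightarrow>
     (\<forall>k<length nxt. table lst vl lv ls lx lf ((lend + k) * Suc C) {l. (l, nxt ! k) \<in> F}) \<and>
     (\<forall>a\<ge>bfree. lst a = (0 :: nat)) \<and> 1 < lf"

abbreviation layer_of :: "memory \<Rightarrow> nat list list \<Rightarrow> ((nat \<times> nat) list \<times> nat list) set \<Rightarrow> bool" where
  "layer_of s \<equiv> layer (narr s ''lst'') (rarr s ''val'') (narr s ''lv'') (narr s ''ls'') (narr s ''lx'')
     (reg s ''lf'') (reg s ''lend'') (reg s ''bfree'')"

lemma best_grow:
  assumes "best lv ls lx lf p v c P"
  shows "best (lv(lf := x)) (ls(lf := y)) (lx(lf := z)) (Suc lf) p v c P"
  using assms list_at_upd[of lv ls lx p _ lf] unfolding best_def by (auto split: if_splits) blast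

lemma best_irrelevant:
  assumes "\<And>l. l \<in> N \<Longrightarrow> total (weight I) l \<noteq> c"
  shows "best lv ls lx lf p v c (P \<union> N) \<longleftrightarrow> best lv ls lx lf p v c P"
  using assms unfolding best_def by auto

lemma best_keep:
  assumes "best lv ls lx lf p v c P" "p \<noteq> 0"
    "\<And>l. l \<in> N \<Longrightarrow> total (weight I) l = c \<Longrightarrow> total (profit I) l \<le> v"
  shows "best lv ls lx lf p v c (P \<union> N)"
  using assms unfolding best_def by auto

lemma best_replace:
  assumes "best lv ls lx lf p v c P" "p = 0 \<or> v < v'"
    "\<And>l. l \<in> N \<Longrightarrow> total (weight I) l = c \<Longrightarrow> total (profit I) l \<le> v'"
    "x \<in> N" "total (weight I) x = c" "total (profit I) x = v'"
    "list_at lv' ls' lx' p' x" "0 < p'" "p' < lf'"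
  shows "best lv' ls' lx' lf' p' v' c (P \<union> N)"
  using assms unfolding best_def by (auto split: if_splits; force)

lemma table_empty: "(\<And>c. c \<le> C \<Longrightarrow> lst (b + c) = 0) \<Longrightarrow> table lst vl lv ls lx lf b {}"
  by (simp add: table_def best_def)

text \<open>Cells from \<open>bfree\<close> on are still 0, and a table of zeros is already correct
  for a stack without lists; creating an entry needs no initialisation of its \<open>Suc C\<close>
  cells.\<close>

lemma layer_append:
  assumes "layer lst vl lv ls lx lf lend bfree nxt F" "bfree = (lend + length nxt) * Suc C"
    "\<And>l. (l, st) \<notin> F"
  shows "layer lst vl lv ls lx lf lend (bfree + Suc C) (nxt @ [st]) F"
  using assms table_empty[of lst bfree] by (auto simp: layer_def nth_append less_Suc_eq)

definition relax_prog :: com where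
  "relax_prog =
     For ''c'' (Add (Reg ''capacity'') (Const 1)) (
       ''p'' ::= Get ''lst'' (Add (Reg ''b'') (Reg ''c'')) ;;
       ''c2'' ::= Add (Reg ''c'') (Get ''wgt'' (Reg ''a'')) ;;
       If (BAnd (Less (Const 0) (Reg ''p'')) (BNot (Less (Reg ''capacity'') (Reg ''c2''))))
         (RPut ''cand'' (Const 0) (RAdd (RGet ''val'' (Add (Reg ''b'') (Reg ''c''))) (RGet ''gain'' (Reg ''a''))) ;;
          If (BAnd (Less (Const 0) (Get ''lst'' (Add (Reg ''b2'') (Reg ''c2''))))
               (BNot (RLess (RGet ''val'' (Add (Reg ''b2'') (Reg ''c2''))) (RGet ''cand'' (Const 0)))))
            Skip
            (Put ''lv'' (Reg ''lf'') (Reg ''u'') ;;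
             Put ''ls'' (Reg ''lf'') (Reg ''a'') ;;
             Put ''lx'' (Reg ''lf'') (Reg ''p'') ;;
             Put ''lst'' (Add (Reg ''b2'') (Reg ''c2'')) (Reg ''lf'') ;;
             RPut ''val'' (Add (Reg ''b2'') (Reg ''c2'')) (RGet ''cand'' (Const 0)) ;;
             ''lf'' ::= Add (Reg ''lf'') (Const 1)))
         Skip)"

lemma writes_relax [simp]: "wregs relax_prog = {''c'', ''p'', ''c2'', ''lf''}"
  "wnarrs relax_prog = {''lv'', ''ls'', ''lx'', ''lst''}" "wrarrs relax_prog = {''val'', ''cand''}"
  by (auto simp: relax_prog_def)

definition tables_kept :: "memory \<Rightarrow> memory \<Rightarrow> bool" where
  "tables_kept s s' \<longleftrightarrow> (\<forall>j<reg s ''lend''. \<forall>P. table_of s (j * Suc C) P \<longrightarrow> table_of s' (j * Suc C) P)"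

text \<open>The source table has a number below \<open>lend\<close> and the target one from
  \<open>lend\<close> on, so reading and writing do not interfere and the tables of the current
  layer survive.\<close>

lemma relax_prog_wp:
  assumes lay: "layer_of s nxt F" and k: "k < length nxt" and d: "distinct nxt"
    and b2: "reg s ''b2'' = (reg s ''lend'' + k) * Suc C"
    and bf: "reg s ''bfree'' = (reg s ''lend'' + length nxt) * Suc C"
    and b: "kb < reg s ''lend''" "reg s ''b'' = kb * Suc C" "table_of s (kb * Suc C) P"
    and u: "reg s ''u'' = u" "reg s ''a'' = a" "reg s ''capacity'' = C"
      "narr s ''wgt'' a = (if a = 1 then weight I u else 0)"
      "rarr s ''gain'' a = (if a = 1 then profit I u else 0)"
  shows "wp relax_prog (\<lambda>s' m'. layer_of s' nxt (F \<union> {((u, a) # l, nxt ! k) | l. l \<in> P}) \<and>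
    tables_kept s s' \<and> m' \<le> m + 16 + 14 * C) s m"
proof -
  let ?w = "if a = 1 then weight I u else 0" and ?g = "if a = 1 then profit I u else 0"
  let ?b2 = "(reg s ''lend'' + k) * Suc C"
  \<comment> \<open>Before round \<open>c\<close> exactly the lists of weight below \<open>c\<close>
    have been carried over. Those of weight \<open>c\<close> all move to the single cell
    \<open>c + ?w\<close>, so only the best of them has to be compared.\<close>
  define Q where "Q c = {(u, a) # l | l. l \<in> P \<and> total (weight I) l < c}" for c
  define Fc where "Fc c = F \<union> (\<lambda>x. (x, nxt ! k)) ` Q c" for c
  have FcS: "{l. (l, nxt ! j) \<in> Fc c} = (if j = k then {l. (l, nxt ! k) \<in> F} \<union> Q c else {l. (l, nxt ! j) \<in> F})"
    if "j < length nxt" for j c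
    using that d k by (auto simp: Fc_def nth_eq_iff_index_eq)
  define Inv where "Inv c s' m' \<longleftrightarrow> layer_of s' nxt (Fc c) \<and> tables_kept s s' \<and> m' \<le> m + 1 + 13 * c"
    for c m' and s' :: memory
  show ?thesis
    unfolding relax_prog_def
    apply (rule wp_For[where Inv = Inv and N = "Suc C"])
    subgoal by (simp add: Inv_def tables_kept_def)
    subgoal by simp
    subgoal using u by (simp add: agreeD)
    subgoal using lay by (simp add: Inv_def Fc_def Q_def tables_kept_def)
    subgoal premises p for c s1 m1
    proof -
      have regs: "reg s1 ''c'' = c" "reg s1 ''b'' = kb * Suc C" "reg s1 ''a'' = a" "reg s1 ''u'' = u"
        "reg s1 ''capacity'' = C" "reg s1 ''b2'' = ?b2" "narr s1 ''wgt'' a = ?w" "rarr s1 ''gain'' a = ?g"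
        "reg s1 ''lend'' = reg s ''lend''" "reg s1 ''bfree'' = reg s ''bfree''"
        using p b b2 u by (simp_all add: agreeD)
      have lay1: "layer_of s1 nxt (Fc c)" and kept: "tables_kept s s1" and m1: "m1 \<le> m + 1 + 13 * c"
        using p(1) by (auto simp: Inv_def)
      have c: "c \<le> C" using p(2) by simp
      let ?p = "narr s1 ''lst'' (kb * Suc C + c)" and ?v = "rarr s1 ''val'' (kb * Suc C + c)"
      let ?c2 = "c + ?w"
      let ?p2 = "narr s1 ''lst'' (?b2 + ?c2)" and ?v2 = "rarr s1 ''val'' (?b2 + ?c2)"
      have src: "best (narr s1 ''lv'') (narr s1 ''ls'') (narr s1 ''lx'') (reg s1 ''lf'') ?p ?v c P"
        using kept b c unfolding tables_kept_def table_def by blast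
      define N where "N = {(u, a) # l | l. l \<in> P \<and> total (weight I) l = c}"
      have QS: "Q (Suc c) = Q c \<union> N" by (auto simp: Q_def N_def less_Suc_eq)
      have wN: "total (weight I) x = ?c2" if "x \<in> N" for x using that by (auto simp: N_def)
      have FcN: "{l. (l, nxt ! j) \<in> Fc (Suc c)} =
          {l. (l, nxt ! j) \<in> Fc c} \<union> (if j = k then N else {})" if "j < length nxt" for j
        using that by (simp add: FcS QS Un_assoc)
      have tab1: "best (narr s1 ''lv'') (narr s1 ''ls'') (narr s1 ''lx'') (reg s1 ''lf'')
          (narr s1 ''lst'' ((reg s ''lend'' + j) * Suc C + c')) (rarr s1 ''val'' ((reg s ''lend'' + j) * Suc C + c'))
          c' {l. (l, nxt ! j) \<in> Fc c}" if "j < length nxt" "c' \<le> C" for j c'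
        using lay1 that regs by (auto simp: layer_def table_def)
      consider (none) "?p = 0" | (over) "?p \<noteq> 0" "C < ?c2"
        | (keep) "?p \<noteq> 0" "?c2 \<le> C" "?p2 \<noteq> 0" "\<not> ?v2 < ?v + ?g"
        | (repl) "?p \<noteq> 0" "?c2 \<le> C" "?p2 = 0 \<or> ?v2 < ?v + ?g" by linarith
      then show ?thesis
      proof cases
        case none
        then have "N = {}" using src by (auto simp: best_def N_def)
        then have "Fc (Suc c) = Fc c" by (simp add: Fc_def QS)
        then show ?thesis using none lay1 kept m1 by (simp add: regs Inv_def tables_kept_def)
      next
        case over
        have "layer_of s1 nxt (Fc (Suc c))"
          unfolding layer_def table_def
        proof (intro conjI allI impI)
          fix j c' assume j: "j < length nxt" "c' \<le> C"
          have "total (weight I) x \<noteq> c'" if "x \<in> (if j = k then N else {})" for x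
            using that wN over j by (auto split: if_splits)
          then show "best (narr s1 ''lv'') (narr s1 ''ls'') (narr s1 ''lx'') (reg s1 ''lf'')
            (narr s1 ''lst'' ((reg s1 ''lend'' + j) * Suc C + c')) (rarr s1 ''val'' ((reg s1 ''lend'' + j) * Suc C + c'))
            c' {l. (l, nxt ! j) \<in> Fc (Suc c)}"
            unfolding FcN[OF j(1)] regs using tab1[OF j] best_irrelevant by blast
        qed (use lay1 in \<open>auto simp: layer_def\<close>)
        then show ?thesis using over kept m1 by (simp add: regs Inv_def tables_kept_def)
      next
        case keep
        have pN: "total (profit I) x \<le> ?v + ?g" if "x \<in> N" for x
          using that src keep(1) by (auto simp: N_def best_def)
        have "layer_of s1 nxt (Fc (Suc c))"
          unfolding layer_def table_def
        proof (intro conjI allI impI)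
          fix j c' assume j: "j < length nxt" "c' \<le> C"
          show "best (narr s1 ''lv'') (narr s1 ''ls'') (narr s1 ''lx'') (reg s1 ''lf'')
            (narr s1 ''lst'' ((reg s1 ''lend'' + j) * Suc C + c')) (rarr s1 ''val'' ((reg s1 ''lend'' + j) * Suc C + c'))
            c' {l. (l, nxt ! j) \<in> Fc (Suc c)}"
          proof (cases "j = k \<and> c' = ?c2")
            case True
            then show ?thesis
              unfolding FcN[OF j(1)] regs using tab1[OF j] keep pN
              by (intro best_keep) (force split: if_splits)+
          next
            case False
            then have "total (weight I) x \<noteq> c'" if "x \<in> (if j = k then N else {})" for x
              using that wN by (auto split: if_splits)
            then show ?thesis
              unfolding FcN[OF j(1)] regs using tab1[OF j] best_irrelevant by blast
          qed
        qed (use lay1 in \<open>auto simp: layer_def\<close>)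
        then show ?thesis using keep kept m1 by (simp add: regs Inv_def tables_kept_def)
      next
        case repl
        obtain l0 where l0: "l0 \<in> P" "list_at (narr s1 ''lv'') (narr s1 ''ls'') (narr s1 ''lx'') ?p l0"
          "total (weight I) l0 = c" "total (profit I) l0 = ?v" and p_lf: "?p < reg s1 ''lf''"
          using src repl(1) by (auto simp: best_def)
        have pN: "total (profit I) x \<le> ?v + ?g" if "x \<in> N" for x
          using that src repl(1) by (auto simp: N_def best_def)
        have lf: "1 < reg s1 ''lf''" using lay1 by (simp add: layer_def)
        let ?f = "reg s1 ''lf''"
        let ?lv = "(narr s1 ''lv'')(?f := u)" and ?ls = "(narr s1 ''ls'')(?f := a)"
          and ?lx = "(narr s1 ''lx'')(?f := ?p)"
        let ?lst = "(narr s1 ''lst'')(?b2 + ?c2 := ?f)" and ?val = "(rarr s1 ''val'')(?b2 + ?c2 := ?v + ?g)"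
        \<comment> \<open>The new list shares its tail with the list of the source cell, which makes
          the update constant-time.\<close>
        have new_list: "list_at ?lv ?ls ?lx ?f ((u, a) # l0)"
          using list_at_upd[OF l0(2) p_lf] p_lf lf by simp
        have other: "?lst (j * Suc C + c') = narr s1 ''lst'' (j * Suc C + c')"
          "?val (j * Suc C + c') = rarr s1 ''val'' (j * Suc C + c')"
          if "c' \<le> C" "j \<noteq> reg s ''lend'' + k \<or> c' \<noteq> ?c2" for j c'
          using that repl(2) block_address_eq[of c' "Suc C" ?c2 j "reg s ''lend'' + k"]
          by (auto simp del: mult_Suc_right)
        have "layer ?lst ?val ?lv ?ls ?lx (Suc ?f) (reg s ''lend'') (reg s ''bfree'') nxt (Fc (Suc c))"
          unfolding layer_def table_def
        proof (intro conjI allI impI)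
          fix j c' assume j: "j < length nxt" "c' \<le> C"
          show "best ?lv ?ls ?lx (Suc ?f) (?lst ((reg s ''lend'' + j) * Suc C + c'))
            (?val ((reg s ''lend'' + j) * Suc C + c')) c' {l. (l, nxt ! j) \<in> Fc (Suc c)}"
          proof (cases "j = k \<and> c' = ?c2")
            case True
            have "best ?lv ?ls ?lx (Suc ?f) ?f (?v + ?g) ?c2 ({l. (l, nxt ! k) \<in> Fc c} \<union> N)"
              by (rule best_replace[OF tab1[of k ?c2] repl(3) pN _ _ _ new_list])
                (use k repl(2) l0 lf in \<open>auto simp: N_def\<close>)
            then show ?thesis using True FcN[OF k] by simp
          next
            case False
            then have "total (weight I) x \<noteq> c'" if "x \<in> (if j = k then N else {})" for x
              using that wN by (auto split: if_splits)
            moreover have "reg s ''lend'' + j \<noteq> reg s ''lend'' + k \<or> c' \<noteq> ?c2" using False by auto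
            ultimately show ?thesis
              unfolding FcN[OF j(1)] other[OF j(2) \<open>reg s ''lend'' + j \<noteq> reg s ''lend'' + k \<or> c' \<noteq> ?c2\<close>]
              using best_grow[OF tab1[OF j]] best_irrelevant by blast
          qed
        next
          fix x assume "reg s ''bfree'' \<le> x"
          moreover have "?b2 + ?c2 < reg s ''bfree''"
            unfolding bf using k repl(2) by (intro block_address_less) auto
          ultimately show "?lst x = 0" using lay1 regs by (auto simp: layer_def)
        qed (use lf in simp)
        moreover have "table ?lst ?val ?lv ?ls ?lx (Suc ?f) (j * Suc C) P'"
          if "j < reg s ''lend''" "table_of s (j * Suc C) P'" for j P'
        proof -
          have "table_of s1 (j * Suc C) P'" using kept that by (simp add: tables_kept_def)
          then show ?thesis
            unfolding table_def using that(1) other[of _ j] best_grow by auto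
        qed
        moreover have "m1 + 13 \<le> m + 1 + 13 * Suc c" using m1 by simp
        ultimately show ?thesis
          using repl kept by (auto simp: regs Inv_def tables_kept_def simp del: mult_Suc_right)
      qed
    qed
    subgoal premises p for s1 m1
    proof -
      have "layer_of s1 nxt (Fc (Suc C))" "tables_kept s s1" "m1 \<le> m + 1 + 13 * Suc C"
        using p(1) by (auto simp: Inv_def)
      moreover have "layer_of s1 nxt (F \<union> {((u, a) # l, nxt ! k) | l. l \<in> P})"
        unfolding layer_def table_def
      proof (intro conjI allI impI)
        fix j c' assume j: "j < length nxt" "c' \<le> C"
        \<comment> \<open>Lists of weight above \<open>C\<close> were never carried over, but their
          extensions fit no cell, so the tables are correct for the full set as well.\<close>
        let ?N = "{(u, a) # l | l. l \<in> P \<and> C < total (weight I) l}"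
        have "{l. (l, nxt ! j) \<in> F \<union> {((u, a) # l, nxt ! k) | l. l \<in> P}}
          = {l. (l, nxt ! j) \<in> Fc (Suc C)} \<union> (if j = k then ?N else {})"
          unfolding FcS[OF j(1)] using j k d
          by (auto simp: Q_def nth_eq_iff_index_eq less_Suc_eq_le not_le)
        moreover have "total (weight I) x \<noteq> c'" if "x \<in> (if j = k then ?N else {})" for x
          using that j by (auto split: if_splits)
        moreover have "best (narr s1 ''lv'') (narr s1 ''ls'') (narr s1 ''lx'') (reg s1 ''lf'')
          (narr s1 ''lst'' ((reg s1 ''lend'' + j) * Suc C + c')) (rarr s1 ''val'' ((reg s1 ''lend'' + j) * Suc C + c'))
          c' {l. (l, nxt ! j) \<in> Fc (Suc C)}"
          using \<open>layer_of s1 nxt (Fc (Suc C))\<close> j by (simp add: layer_def table_def)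
        ultimately show "best (narr s1 ''lv'') (narr s1 ''ls'') (narr s1 ''lx'') (reg s1 ''lf'')
          (narr s1 ''lst'' ((reg s1 ''lend'' + j) * Suc C + c')) (rarr s1 ''val'' ((reg s1 ''lend'' + j) * Suc C + c'))
          c' {l. (l, nxt ! j) \<in> F \<union> {((u, a) # l, nxt ! k) | l. l \<in> P}}"
          using best_irrelevant by presburger
      qed (use \<open>layer_of s1 nxt (Fc (Suc C))\<close> in \<open>auto simp: layer_def\<close>)
      ultimately show ?thesis by simp
    qed
    done
qed

end


lemma agree_disjoint:
  "agree c s s' \<Longrightarrow> wregs c \<inter> X = {} \<Longrightarrow> x \<in> X \<Longrightarrow> reg s' x = reg s x"
  "agree c s s' \<Longrightarrow> wnarrs c \<inter> X = {} \<Longrightarrow> x \<in> X \<Longrightarrow> narr s' x = narr s x"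
  by (auto simp: agree_def)

context heavy_knap
begin

section \<open>Processing one layer\<close>

text \<open>
  \<open>cur\<close> lists the stacks of the current layer \<open>i\<close>, whose tables are final; \<open>F\<close> is the part of
  \<open>conf (Suc i)\<close> already accounted for in the tables of the next layer.
\<close>

definition work :: "nat \<Rightarrow> nat list list \<Rightarrow> ((nat \<times> nat) list \<times> nat list) set \<Rightarrow> (nat list \<Rightarrow> nat) \<Rightarrow>
    memory \<Rightarrow> bool" where
  "work i cur F \<pi> s \<longleftrightarrow> heap_of \<pi> s \<and>
     (\<exists>nxt. entries_of \<pi> nxt s \<and> layer_of s nxt F \<and> set nxt = snd ` F) \<and>
     reg s ''lend'' = reg s ''lbeg'' + length cur \<and> distinct cur \<and> set cur = stacks i \<and>
     (\<forall>k<length cur. narr s ''ent_node'' (reg s ''lbeg'' + k) = \<pi> (cur ! k) \<and> \<pi> (cur ! k) \<noteq> 0 \<and>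
        table_of s ((reg s ''lbeg'' + k) * Suc C) {l. (l, cur ! k) \<in> conf i})"

lemma workD:
  assumes "work i cur F \<pi> s"
  shows "heap_of \<pi> s" "\<exists>nxt. entries_of \<pi> nxt s \<and> layer_of s nxt F \<and> set nxt = snd ` F"
    "reg s ''lend'' = reg s ''lbeg'' + length cur" "distinct cur" "set cur = stacks i"
    "k < length cur \<Longrightarrow> narr s ''ent_node'' (reg s ''lbeg'' + k) = \<pi> (cur ! k)"
    "k < length cur \<Longrightarrow> \<pi> (cur ! k) \<noteq> 0"
    "k < length cur \<Longrightarrow> table_of s ((reg s ''lbeg'' + k) * Suc C) {l. (l, cur ! k) \<in> conf i}"
proof -
  note * = assms[unfolded work_def]
  show "heap_of \<pi> s" by (rule *[THEN conjunct1])
  show "\<exists>nxt. entries_of \<pi> nxt s \<and> layer_of s nxt F \<and> set nxt = snd ` F"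
    by (rule *[THEN conjunct2, THEN conjunct1])
  show "reg s ''lend'' = reg s ''lbeg'' + length cur" by (rule *[THEN conjunct2, THEN conjunct2, THEN conjunct1])
  show "distinct cur" by (rule *[THEN conjunct2, THEN conjunct2, THEN conjunct2, THEN conjunct1])
  show "set cur = stacks i" by (rule *[THEN conjunct2, THEN conjunct2, THEN conjunct2, THEN conjunct2, THEN conjunct1])
  have "\<forall>k<length cur. narr s ''ent_node'' (reg s ''lbeg'' + k) = \<pi> (cur ! k) \<and> \<pi> (cur ! k) \<noteq> 0 \<and>
        table_of s ((reg s ''lbeg'' + k) * Suc C) {l. (l, cur ! k) \<in> conf i}"
    by (rule *[THEN conjunct2, THEN conjunct2, THEN conjunct2, THEN conjunct2, THEN conjunct2])
  then show "k < length cur \<Longrightarrow> narr s ''ent_node'' (reg s ''lbeg'' + k) = \<pi> (cur ! k)"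
    "k < length cur \<Longrightarrow> \<pi> (cur ! k) \<noteq> 0"
    "k < length cur \<Longrightarrow> table_of s ((reg s ''lbeg'' + k) * Suc C) {l. (l, cur ! k) \<in> conf i}"
    by simp_all
qed

lemma work_agree:
  assumes "agree c s s'" "wregs c \<inter> {''free'', ''lend'', ''ne'', ''bfree'', ''lf'', ''lbeg''} = {}"
    "wnarrs c \<inter> {''push'', ''top'', ''below'', ''mark'', ''ent_node'', ''ent_base'', ''lst'', ''lv'', ''ls'', ''lx''} = {}"
    "''val'' \<notin> wrarrs c"
  shows "work i cur F \<pi> s' \<longleftrightarrow> work i cur F \<pi> s"
proof -
  have 1: "reg s' ''free'' = reg s ''free''" "reg s' ''lend'' = reg s ''lend''" "reg s' ''ne'' = reg s ''ne''" "reg s' ''bfree'' = reg s ''bfree''" "reg s' ''lf'' = reg s ''lf''" "reg s' ''lbeg'' = reg s ''lbeg''"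
    by (rule agree_disjoint(1)[OF assms(1,2)], simp)+
  have 2: "narr s' ''push'' = narr s ''push''" "narr s' ''top'' = narr s ''top''" "narr s' ''below'' = narr s ''below''" "narr s' ''mark'' = narr s ''mark''" "narr s' ''ent_node'' = narr s ''ent_node''" "narr s' ''ent_base'' = narr s ''ent_base''" "narr s' ''lst'' = narr s ''lst''" "narr s' ''lv'' = narr s ''lv''" "narr s' ''ls'' = narr s ''ls''" "narr s' ''lx'' = narr s ''lx''"
    by (rule agree_disjoint(2)[OF assms(1,3)], simp)+
  have 3: "rarr s' ''val'' = rarr s ''val''"
    by (rule agree_rarr[OF assms(1,4)])
  show ?thesis unfolding work_def by (simp only: 1 2 3)
qed

lemma work_regs [simp]:
  assumes "\<forall>x\<in>{''free'', ''lend'', ''ne'', ''bfree'', ''lf'', ''lbeg''}. f x = reg s x"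
  shows "work i cur F \<pi> (s\<lparr>reg := f\<rparr>) \<longleftrightarrow> work i cur F \<pi> s"
proof -
  have 1: "f ''free'' = reg s ''free''" "f ''lend'' = reg s ''lend''" "f ''ne'' = reg s ''ne''"
    "f ''bfree'' = reg s ''bfree''" "f ''lf'' = reg s ''lf''" "f ''lbeg'' = reg s ''lbeg''"
    using assms by simp_all
  show ?thesis unfolding work_def by (simp add: 1)
qed

definition contrib :: "nat \<Rightarrow> nat list \<Rightarrow> nat \<Rightarrow> ((nat \<times> nat) list \<times> nat list) set" where
  "contrib i st r = {((visit i, fst (snd (rs ! r))) # l, piece (visit i) (snd (snd (rs ! r))) @ tl st) | l.
     (l, st) \<in> conf i \<and> st \<noteq> [] \<and> hd st = fst (rs ! r)}"

definition rule_prog :: com where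
  "rule_prog =
     If (eq (Get ''rule_state'' (Reg ''r1'')) (Reg ''hq''))
       (''ro'' ::= Get ''rule_offset'' (Reg ''r1'') ;;
        ''a'' ::= Get ''rule_symbol'' (Reg ''r1'') ;;
        ''y'' ::= Reg ''z'' ;;
        push_rhs_prog ;;
        entry_prog ;;
        relax_prog)
       Skip"

lemma writes_rule [simp]:
  "wregs rule_prog = {''ro'', ''a'', ''y'', ''cell'', ''free'', ''q'', ''j'', ''bfree'', ''ne'', ''b2'', ''c'', ''p'', ''c2'', ''lf''}"
  "wnarrs rule_prog = {''push'', ''top'', ''below'', ''ent_node'', ''ent_base'', ''mark'', ''lv'', ''ls'', ''lx'', ''lst''}"
  "wrarrs rule_prog = {''val'', ''cand''}"
  by (auto simp: rule_prog_def)

text \<open>\<open>wgt\<close> and \<open>gain\<close> are indexed by the label. Their entry 0 is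
  never written and remains 0, so relaxation need not distinguish the labels.\<close>

definition vertex_loaded :: "nat \<Rightarrow> memory \<Rightarrow> bool" where
  "vertex_loaded u s \<longleftrightarrow> reg s ''u'' = u \<and> reg s ''d'' = length (ch u) \<and>
     (ch u \<noteq> [] \<longrightarrow> reg s ''h'' = hv u) \<and>
     narr s ''wgt'' 0 = 0 \<and> narr s ''wgt'' 1 = weight I u \<and>
     rarr s ''gain'' 0 = 0 \<and> rarr s ''gain'' 1 = profit I u"

text \<open>The parts take 4 steps, \<open>12 + 12 * d\<close> for the pushes, 7 for the entry and
  \<open>16 + 14 * C\<close> for the relaxation; the constant 39 is rounded up to 40.\<close>

definition rule_time :: "nat \<Rightarrow> nat" where
  "rule_time d = 40 + 12 * d + 14 * C"

lemma rule_prog_wp: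
  assumes work: "work i cur F \<pi> s" and inp: "inp s" and i: "i < n" and B: "0 < B"
    and k: "k < length cur" "cur ! k = q # st"
    and s: "vertex_loaded (visit i) s" "reg s ''hq'' = q" "reg s ''z'' = \<pi> st" "\<pi> st \<noteq> 0"
      "reg s ''b'' = (reg s ''lbeg'' + k) * Suc C"
    and r: "r < length rs" "reg s ''r1'' = r" "arity r = length (ch (visit i))"
  shows "wp rule_prog (\<lambda>s' m'. (\<exists>\<pi>'. work i cur (F \<union> contrib i (q # st) r) \<pi>' s' \<and>
    (\<forall>t. \<pi> t \<noteq> 0 \<longrightarrow> \<pi>' t = \<pi> t)) \<and> m' \<le> m + rule_time (length (ch (visit i)))) s m"
proof (cases "fst (rs ! r) = q")
  case False
  then have "contrib i (q # st) r = {}" by (auto simp: contrib_def)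
  then show ?thesis using False work s r inp by (auto simp: rule_prog_def inpD rule_time_def)
next
  case True
  let ?u = "visit i"
  let ?d = "length (ch ?u)" and ?a = "fst (snd (rs ! r))" and ?qs = "snd (snd (rs ! r))"
  let ?st = "piece ?u ?qs @ st"
  let ?P = "{l. (l, q # st) \<in> conf i}"
  have u: "?u < n" using vst_eq(2)[OF i] .
  have a: "?a = 0 \<or> ?a = 1"
    using r(1) rule_in_range(2)[of "fst (rs ! r)" ?a ?qs] set_rs[of "fst (rs ! r)" ?a ?qs] by simp
  have "q # st \<in> stacks i" using k workD(5)[OF work] nth_mem[OF k(1)] by simp
  \<comment> \<open>An entry is created for the new stack even before a list is moved; it is
    justified because some list does lead to it. Otherwise \<open>nxt\<close> could contain
    unreachable stacks and escape the bound on \<open>stacks\<close>.\<close>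
  then have P_ne: "?P \<noteq> {}" by (auto simp: stacks_def)
  have con: "contrib i (q # st) r = {((?u, ?a) # l, ?st) | l. l \<in> ?P}"
    using True by (auto simp: contrib_def)
  obtain nxt where nxt: "entries_of \<pi> nxt s" "layer_of s nxt F" "set nxt = snd ` F"
    and heap: "heap_of \<pi> s" using workD(1,2)[OF work] by (elim exE conjE) (rule that)
  have cur: "reg s ''lend'' = reg s ''lbeg'' + length cur" "distinct cur" "set cur = stacks i"
    "\<And>k. k < length cur \<Longrightarrow> narr s ''ent_node'' (reg s ''lbeg'' + k) = \<pi> (cur ! k) \<and> \<pi> (cur ! k) \<noteq> 0 \<and>
        table_of s ((reg s ''lbeg'' + k) * Suc C) {l. (l, cur ! k) \<in> conf i}"
    using workD[OF work] by blast+
  show ?thesis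
    unfolding rule_prog_def
    apply (simp add: r s inp True inpD)
    apply (rule wp_conseq[OF push_rhs_prog_wp[where \<pi> = \<pi> and st = st and u = ?u and r = r]])
    subgoal using inp by (simp add: inp_def)
    subgoal using heap by simp
    subgoal using s by simp
    subgoal by simp
    subgoal using u .
    subgoal using s by (simp add: vertex_loaded_def)
    subgoal using s by (simp add: vertex_loaded_def)
    subgoal using r by simp
    subgoal using r by simp
    subgoal by simp
    subgoal premises p1 for s1 m1
    proof -
      note ag1 = p1(2)
      obtain \<pi>1 where \<pi>1: "heap_of \<pi>1 s1" "extends \<pi> \<pi>1 (narr s ''mark'')" "\<pi>1 ?st \<noteq> 0"
        "reg s1 ''y'' = \<pi>1 ?st" and m1: "m1 \<le> m + 16 + 12 * ?d"
        using p1(1) by auto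
      have \<pi>1_eq: "\<pi>1 t = \<pi> t" if "\<pi> t \<noteq> 0" for t using \<pi>1(2) that by (simp add: extends_def)
      have ent1: "entries_of \<pi>1 nxt s1"
        using entries_extends[OF nxt(1) \<pi>1(2)] ag1 by (simp add: agreeD)
      have lay1: "layer_of s1 nxt F" using nxt(2) ag1 by (simp add: agreeD)
      show ?thesis
        apply (simp only: wp_Seq)
        apply (rule wp_conseq[OF entry_prog_wp[OF \<pi>1(1) ent1 \<pi>1(3,4) _ B]])
        subgoal using ag1 inp by (simp add: agreeD inpD)
        subgoal premises p2 for s2 m2
        proof -
          note ag2 = p2(2)
          obtain nxt' k' where heap2: "heap_of \<pi>1 s2" and ent2: "entries_of \<pi>1 nxt' s2"
            and k': "k' < length nxt'" "nxt' ! k' = ?st"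
            and b2: "reg s2 ''b2'' = (reg s1 ''lend'' + k') * Suc C"
            and nx: "nxt' = nxt \<and> reg s2 ''bfree'' = reg s1 ''bfree'' \<or>
               nxt' = nxt @ [?st] \<and> ?st \<notin> set nxt \<and> reg s2 ''bfree'' = reg s1 ''bfree'' + Suc C"
            and node: "\<forall>j<reg s1 ''ne''. narr s2 ''ent_node'' j = narr s1 ''ent_node'' j"
            and m2: "m2 \<le> m1 + 7"
            using p2(1) by auto
          have lay2: "layer_of s2 nxt' F"
          proof (cases "nxt' = nxt \<and> reg s2 ''bfree'' = reg s1 ''bfree''")
            case True
            then show ?thesis using lay1 ag2 by (simp add: agreeD)
          next
            case False
            then have new: "nxt' = nxt @ [?st]" "?st \<notin> set nxt" "reg s2 ''bfree'' = reg s1 ''bfree'' + Suc C"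
              using nx by auto
            have "(l, ?st) \<notin> F" for l using new(2) nxt(3) by force
            from layer_append[OF lay1 entriesD(2)[OF ent1] this]
            show ?thesis using new ag2 by (simp add: agreeD)
          qed
          have set': "set nxt' = insert ?st (snd ` F)"
            using nx nxt(3) nth_mem[OF k'(1)] k'(2) by (elim disjE conjE) (auto simp: insert_absorb)
          have src: "table_of s2 ((reg s ''lbeg'' + k) * Suc C) ?P"
            using cur(4)[OF k(1)] k(2) ag1 ag2 by (simp add: agreeD)
          have lend2: "reg s2 ''lend'' = reg s ''lend''" "reg s2 ''lbeg'' = reg s ''lbeg''"
            "reg s1 ''lend'' = reg s ''lend''" "reg s1 ''ne'' = reg s ''ne''"
            using ag1 ag2 by (simp_all add: agreeD)
          show ?thesis
            apply (rule wp_conseq[OF relax_prog_wp[where P = ?P and kb = "reg s ''lbeg'' + k" and k = k' and nxt = nxt'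
                and F = F and u = ?u and a = ?a]])
            subgoal using lay2 .
            subgoal using k'(1) .
            subgoal using entries_distinct[OF ent2] .
            subgoal using b2 lend2 by simp
            subgoal using entriesD(2)[OF ent2] .
            subgoal using lend2 cur(1) k(1) by simp
            subgoal using s(5) ag1 ag2 by (simp add: agreeD)
            subgoal using src .
            subgoal using s(1) ag1 ag2 by (simp add: agreeD vertex_loaded_def)
            subgoal using r ag1 ag2 inp by (simp add: agreeD)
            subgoal using ag1 ag2 inp by (simp add: agreeD inpD)
            subgoal using s(1) ag1 ag2 a by (auto simp add: agreeD vertex_loaded_def)
            subgoal using s(1) ag1 ag2 a by (auto simp add: agreeD vertex_loaded_def)
            subgoal premises p3 for s3 m3
            proof -
              note ag3 = p3(2)
              have kept: "tables_kept s2 s3" using p3(1) by simp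
              have "narr s3 ''ent_node'' (reg s3 ''lbeg'' + j) = \<pi>1 (cur ! j) \<and> \<pi>1 (cur ! j) \<noteq> 0 \<and>
                table_of s3 ((reg s3 ''lbeg'' + j) * Suc C) {l. (l, cur ! j) \<in> conf i}"
                if "j < length cur" for j
              proof -
                have "reg s ''lbeg'' + j < reg s1 ''ne''"
                  using that cur(1) lend2 entriesD(1)[OF nxt(1)] by simp
                then have "narr s3 ''ent_node'' (reg s3 ''lbeg'' + j) = \<pi> (cur ! j)"
                  using node cur(4)[OF that] ag1 ag2 ag3 lend2 by (simp add: agreeD)
                moreover have "table_of s2 ((reg s ''lbeg'' + j) * Suc C) {l. (l, cur ! j) \<in> conf i}"
                  using cur(4)[OF that] ag1 ag2 by (simp add: agreeD)
                then have "table_of s3 ((reg s ''lbeg'' + j) * Suc C) {l. (l, cur ! j) \<in> conf i}"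
                  using kept that lend2 cur(1) unfolding tables_kept_def by simp
                ultimately show ?thesis
                  using \<pi>1_eq cur(4)[OF that] ag3 lend2 by (simp add: agreeD)
              qed
              moreover have "heap_of \<pi>1 s3" "entries_of \<pi>1 nxt' s3" "reg s3 ''lend'' = reg s3 ''lbeg'' + length cur"
                using heap2 ent2 ag3 cur(1) lend2 by (simp_all add: agreeD)
              moreover have "set nxt' = snd ` (F \<union> contrib i (q # st) r)"
                unfolding con set' using P_ne by (auto simp: image_Un image_iff)
              moreover have "layer_of s3 nxt' (F \<union> contrib i (q # st) r)"
                unfolding con using p3(1) k'(2) by simp
              ultimately have "work i cur (F \<union> contrib i (q # st) r) \<pi>1 s3"
                using cur(2,3) unfolding work_def by blast
              then show ?thesis
                using \<pi>1_eq p3(1) m1 m2 by (auto simp: rule_time_def)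
            qed
            done
        qed
        done
    qed
    done
qed

definition entry_loop_prog :: com where
  "entry_loop_prog =
     ''x'' ::= Get ''ent_node'' (Add (Reg ''lbeg'') (Reg ''k'')) ;;
     ''b'' ::= Get ''ent_base'' (Add (Reg ''lbeg'') (Reg ''k'')) ;;
     ''hq'' ::= Get ''top'' (Reg ''x'') ;;
     ''z'' ::= Get ''below'' (Reg ''x'') ;;
     ''r'' ::= Get ''bucket'' (Reg ''d'') ;;
     While (Less (Const 0) (Reg ''r'')) (
       ''r1'' ::= Sub (Reg ''r'') (Const 1) ;;
       rule_prog ;;
       ''r'' ::= Get ''next_rule'' (Reg ''r1''))"

lemma writes_entry_loop [simp]:
  "wregs entry_loop_prog = {''x'', ''b'', ''hq'', ''z'', ''r'', ''r1'', ''ro'', ''a'', ''y'', ''cell'', ''free'',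
     ''q'', ''j'', ''bfree'', ''ne'', ''b2'', ''c'', ''p'', ''c2'', ''lf''}"
  "wnarrs entry_loop_prog = {''push'', ''top'', ''below'', ''ent_node'', ''ent_base'', ''mark'', ''lv'', ''ls'', ''lx'', ''lst''}"
  "wrarrs entry_loop_prog = {''val'', ''cand''}"
  by (auto simp: entry_loop_prog_def)

definition chains :: "memory \<Rightarrow> bool" where
  "chains s \<longleftrightarrow> (\<forall>d. chain (narr s ''next_rule'') (narr s ''bucket'' d) (bucket d))"

lemma bucket_less: "r \<in> set (bucket d) \<Longrightarrow> r < length rs" "r \<in> set (bucket d) \<Longrightarrow> arity r = d"
  by (auto simp: bucket_def)

lemma entry_loop_wp:
  assumes work: "work i cur F \<pi> s" and inp: "inp s" and i: "i < n" and B: "0 < B"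
    and k: "k < length cur" "reg s ''k'' = k"
    and s: "vertex_loaded (visit i) s" "chains s"
  defines "d \<equiv> length (ch (visit i))"
  shows "wp entry_loop_prog (\<lambda>s' m'.
    (\<exists>\<pi>'. work i cur (F \<union> (\<Union>r\<in>set (bucket d). contrib i (cur ! k) r)) \<pi>' s') \<and>
    m' \<le> m + 6 + (rule_time d + 3) * length (bucket d)) s m"
proof -
  have cur: "narr s ''ent_node'' (reg s ''lbeg'' + k) = \<pi> (cur ! k)" "\<pi> (cur ! k) \<noteq> 0"
    "cur ! k \<in> stacks i" and lend: "reg s ''lend'' = reg s ''lbeg'' + length cur"
    using workD(3,5)[OF work] workD(6,7)[OF work k(1)] nth_mem[OF k(1)] by simp_all
  obtain nxt where ent: "entries_of \<pi> nxt s" and heap: "heap_of \<pi> s"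
    using workD(1,2)[OF work] by (elim exE conjE) (rule that)
  have base: "narr s ''ent_base'' (reg s ''lbeg'' + k) = (reg s ''lbeg'' + k) * Suc C"
    by (rule entriesD(6)[OF ent]) (use lend k in simp)
  have "length (cur ! k) = length (vst i)" using length_stack cur(3) i by simp
  then have "cur ! k \<noteq> []" using vst_eq(1)[OF i] by (metis length_0_conv list.distinct(1))
  then obtain q st where st: "cur ! k = q # st" by (cases "cur ! k") auto
  note h = heapD(5)[OF heap, of q st]
  have h': "narr s ''top'' (\<pi> (q # st)) = q" "narr s ''below'' (\<pi> (q # st)) = \<pi> st" "\<pi> st \<noteq> 0"
    using h cur(2) st by auto
  \<comment> \<open>The clause on old addresses is needed because \<open>z\<close> is read once
    before the loop and must still be the address of \<open>st\<close> after the trie has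
    grown.\<close>
  define Inv where "Inv j s' m' \<longleftrightarrow> (\<exists>done ts \<pi>'. bucket d = done @ ts \<and> j = length ts \<and>
     chain (narr s' ''next_rule'') (reg s' ''r'') ts \<and>
     work i cur (F \<union> (\<Union>r\<in>set done. contrib i (cur ! k) r)) \<pi>' s' \<and>
     (\<forall>t. \<pi> t \<noteq> 0 \<longrightarrow> \<pi>' t = \<pi> t) \<and>
     m' \<le> m + 5 + (rule_time d + 3) * length done)" for j m' and s' :: memory
  have rd: "reg s ''d'' = d" using s by (simp add: vertex_loaded_def d_def)
  show ?thesis
    unfolding entry_loop_prog_def
    apply (simp add: k(2) cur(1) base st h' rd)
    apply (rule wp_While[where k = "length (bucket d)" and Inv = Inv])
    subgoal
      unfolding Inv_def
      by (rule exI[of _ "[]"], rule exI[of _ "bucket d"], rule exI[of _ \<pi>],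
          use work s(2) in \<open>simp add: chains_def\<close>)
    subgoal premises p for j s1 m1
    proof -
      note ag = p(2)
      obtain dn ts \<pi>1 where I: "bucket d = dn @ ts" "j = length ts" "chain (narr s1 ''next_rule'') (reg s1 ''r'') ts"
        "work i cur (F \<union> (\<Union>r\<in>set dn. contrib i (cur ! k) r)) \<pi>1 s1"
        "\<forall>t. \<pi> t \<noteq> 0 \<longrightarrow> \<pi>1 t = \<pi> t" "m1 \<le> m + 5 + (rule_time d + 3) * length dn"
        using p(1) unfolding Inv_def by blast
      obtain r ts' where ts: "ts = r # ts'" "reg s1 ''r'' = Suc r" "chain (narr s1 ''next_rule'') (narr s1 ''next_rule'' r) ts'"
        using I(3) p(3) by (cases ts) auto
      have r: "r < length rs" "arity r = d" using bucket_less[of r d] I(1) ts(1) by auto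
      have inp1: "inp s1"
        by (rule inp_agree[OF _ ag]) (use inp in \<open>auto simp: inp_def\<close>)
      show ?thesis
        apply (simp add: ts)
        apply (rule wp_conseq[OF rule_prog_wp[where i = i and cur = cur and \<pi> = \<pi>1 and k = k and q = q and st = st and r = r
            and F = "F \<union> (\<Union>r\<in>set dn. contrib i (cur ! k) r)"]])
        subgoal using I(4) by simp
        subgoal using inp1 by (simp add: inp_def)
        subgoal using i .
        subgoal using B .
        subgoal using k by simp
        subgoal using st .
        subgoal using s ag by (simp add: vertex_loaded_def agreeD)
        subgoal using ag by (simp add: agreeD)
        subgoal using ag I(5) h' by (simp add: agreeD)
        subgoal using I(5) h' by simp
        subgoal using ag by (simp add: agreeD)
        subgoal using r by simp
        subgoal by simp
        subgoal using r by (simp add: d_def)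
        subgoal premises q for s2 m2
        proof -
          obtain \<pi>2 where \<pi>2: "work i cur (F \<union> (\<Union>r\<in>set dn. contrib i (cur ! k) r) \<union> contrib i (q # st) r) \<pi>2 s2"
            "\<forall>t. \<pi>1 t \<noteq> 0 \<longrightarrow> \<pi>2 t = \<pi>1 t" and m2: "m2 \<le> m1 + 2 + rule_time d"
            using q(1) d_def by auto
          have "F \<union> (\<Union>r\<in>set dn. contrib i (cur ! k) r) \<union> contrib i (q # st) r
            = F \<union> (\<Union>r\<in>set (dn @ [r]). contrib i (cur ! k) r)" using st by auto
          with \<pi>2(1) have "work i cur (F \<union> (\<Union>r\<in>set (dn @ [r]). contrib i (cur ! k) r)) \<pi>2 s2" by simp
          moreover have "chain (narr s2 ''next_rule'') (narr s2 ''next_rule'' (reg s2 ''r1'')) ts'"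
            using ts(3) q(2) by (simp add: agreeD)
          moreover have "\<forall>t. \<pi> t \<noteq> 0 \<longrightarrow> \<pi>2 t = \<pi> t" using \<pi>2(2) I(5) by metis
          moreover have "m2 + 1 \<le> m + 5 + (rule_time d + 3) * length (dn @ [r])"
            using m2 I(6) by simp
          ultimately have "Inv (length ts') (s2\<lparr>reg := (reg s2)(''r'' := narr s2 ''next_rule'' (reg s2 ''r1''))\<rparr>) (Suc m2)"
            unfolding Inv_def
            by - (rule exI[of _ "dn @ [r]"], rule exI[of _ ts'], rule exI[of _ \<pi>2],
              use I(1) ts(1) in simp)
          then show ?thesis using I(2) ts(1) by auto
        qed
        done
    qed
    subgoal premises p for j s1 m1
    proof -
      obtain dn ts \<pi>1 where I: "bucket d = dn @ ts" "chain (narr s1 ''next_rule'') (reg s1 ''r'') ts"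
        "work i cur (F \<union> (\<Union>r\<in>set dn. contrib i (cur ! k) r)) \<pi>1 s1"
        "m1 \<le> m + 5 + (rule_time d + 3) * length dn"
        using p(1) unfolding Inv_def by blast
      have "ts = []" using I(2) p(3) by (cases ts) auto
      then show ?thesis using I st by auto
    qed
    done
qed

text \<open>The decomposition that the two nested loops follow: over the stacks of the layer, and
  for each one over the rules of fitting arity.\<close>

lemma conf_Suc_contrib:
  assumes "i < n"
  shows "conf (Suc i) = (\<Union>st\<in>stacks i. \<Union>r\<in>set (bucket (length (ch (visit i)))). contrib i st r)"
proof (intro equalityI subsetI)
  fix x assume "x \<in> conf (Suc i)"
  then obtain l q rest a qs where x: "x = ((visit i, a) # l, piece (visit i) qs @ rest)"
    "(l, q # rest) \<in> conf i" "(q, a, qs) \<in> set rs" "length qs = length (ch (visit i))"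
    unfolding vst_eq(4)[OF assms] conf_step_def by blast
  obtain r where r: "r < length rs" "rs ! r = (q, a, qs)" using x(3) by (auto simp: in_set_conv_nth)
  have "q # rest \<in> stacks i" using x(2) by (force simp: stacks_def)
  moreover have "r \<in> set (bucket (length (ch (visit i))))" using r x(4) by (simp add: bucket_def)
  moreover have "x \<in> contrib i (q # rest) r" using x(1,2) r(2) by (auto simp: contrib_def)
  ultimately show "x \<in> (\<Union>st\<in>stacks i. \<Union>r\<in>set (bucket (length (ch (visit i)))). contrib i st r)" by blast
next
  fix x assume "x \<in> (\<Union>st\<in>stacks i. \<Union>r\<in>set (bucket (length (ch (visit i)))). contrib i st r)"
  then obtain st r where r: "r \<in> set (bucket (length (ch (visit i))))" "x \<in> contrib i st r" by blast
  obtain q a qs where rule: "rs ! r = (q, a, qs)" by (cases "rs ! r")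
  then obtain l where x: "x = ((visit i, a) # l, piece (visit i) qs @ tl st)" "(l, st) \<in> conf i" "st \<noteq> []" "hd st = q"
    using r(2) by (auto simp: contrib_def)
  have "(q, a, qs) \<in> set rs" "length qs = length (ch (visit i))"
    using bucket_less[OF r(1)] rule by (metis nth_mem, simp)
  moreover have "(l, q # tl st) \<in> conf i" using x by (cases st) auto
  ultimately show "x \<in> conf (Suc i)"
    unfolding vst_eq(4)[OF assms] conf_step_def using x(1) by blast
qed

end


section \<open>The loop over the vertices\<close>

context heavy_knap
begin

definition vertices_prog :: com where
  "vertices_prog =
     If (Less (Const 0) (Reg ''d''))
       (Put ''vstk'' (Reg ''sp'') (Get ''child'' (Add (Reg ''o'') (Reg ''h''))) ;;
        ''sp'' ::= Add (Reg ''sp'') (Const 1) ;;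
        For ''j'' (Reg ''d'')
          (If (eq (Reg ''j'') (Reg ''h'')) Skip
            (Put ''vstk'' (Reg ''sp'') (Get ''child'' (Add (Reg ''o'') (Reg ''j''))) ;;
             ''sp'' ::= Add (Reg ''sp'') (Const 1))))
       Skip"

lemma writes_vertices [simp]: "wregs vertices_prog = {''sp'', ''j''}"
  "wnarrs vertices_prog = {''vstk''}" "wrarrs vertices_prog = {}"
  by (auto simp: vertices_prog_def)

text \<open>The array stores the bottom of the vertex stack first, hence the
  \<open>rev\<close>.\<close>

lemma vertices_prog_wp:
  assumes inp: "inp s" and u: "u < n" "reg s ''d'' = length (ch u)" "reg s ''h'' = hv u"
    and o: "reg s ''o'' = narr s ''child_offset'' u"
    and vs: "map (narr s ''vstk'') [0..<reg s ''sp''] = rev rest"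
  shows "wp vertices_prog (\<lambda>s' m'. map (narr s' ''vstk'') [0..<reg s' ''sp''] = rev (piece u (ch u) @ rest) \<and>
    m' \<le> m + 6 + 6 * length (ch u)) s m"
proof (cases "ch u = []")
  case True
  then show ?thesis using u vs by (simp add: vertices_prog_def piece_def pos_def)
next
  case False
  have hv: "hv u < length (ch u)" using hv_less[OF u(1) False] .
  have child: "narr s ''child'' (narr s ''child_offset'' u + j) = ch u ! j" if "j < length (ch u)" for j
    using inp_children(2)[OF inp u(1) that] .
  show ?thesis
    unfolding vertices_prog_def
    apply (simp add: u o False child[OF hv])
    apply (rule wp_For[where N = "length (ch u)" and Inv = "\<lambda>j s' m'.
      map (narr s' ''vstk'') [0..<reg s' ''sp''] =
        rev rest @ map ((!) (ch u)) (hv u # filter (\<lambda>j. j \<noteq> hv u) [0..<j]) \<and> m' \<le> m + 4 + 5 * j"])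
    subgoal by simp
    subgoal by simp
    subgoal using u by (simp add: agreeD)
    subgoal using vs by simp
    subgoal premises p for j s1 m1
      using p u o child[OF p(2)] by (simp add: agreeD)
    subgoal premises p for s1 m1
      using p(1) False by (simp add: piece_def pos_def)
    done
qed

definition layer_prog :: com where
  "layer_prog =
     ''sp'' ::= Sub (Reg ''sp'') (Const 1) ;;
     ''u'' ::= Get ''vstk'' (Reg ''sp'') ;;
     ''o'' ::= Get ''child_offset'' (Reg ''u'') ;;
     ''d'' ::= Sub (Get ''child_offset'' (Add (Reg ''u'') (Const 1))) (Reg ''o'') ;;
     ''h'' ::= Get ''heavy'' (Reg ''u'') ;;
     vertices_prog ;;
     Put ''wgt'' (Const 1) (Get ''weight'' (Reg ''u'')) ;;
     RPut ''gain'' (Const 1) (RGet ''profit'' (Reg ''u'')) ;;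
     ''cnt'' ::= Sub (Reg ''lend'') (Reg ''lbeg'') ;;
     For ''k'' (Reg ''cnt'') entry_loop_prog ;;
     ''lbeg'' ::= Reg ''lend'' ;;
     ''lend'' ::= Reg ''ne''"

lemma writes_layer [simp]:
  "wregs layer_prog = {''sp'', ''u'', ''o'', ''d'', ''h'', ''cnt'', ''k'', ''lbeg'', ''lend'',
     ''x'', ''b'', ''hq'', ''z'', ''r'', ''r1'', ''ro'', ''a'', ''y'', ''cell'', ''free'',
     ''q'', ''j'', ''bfree'', ''ne'', ''b2'', ''c'', ''p'', ''c2'', ''lf''}"
  "wnarrs layer_prog = {''vstk'', ''wgt'', ''push'', ''top'', ''below'', ''ent_node'', ''ent_base'', ''mark'',
     ''lv'', ''ls'', ''lx'', ''lst''}"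
  "wrarrs layer_prog = {''gain'', ''val'', ''cand''}"
  by (auto simp: layer_prog_def)

definition layer_time :: "nat \<Rightarrow> nat" where
  "layer_time i = (let d = length (ch (visit i)) in
     30 + 6 * d + card (stacks i) * (8 + (rule_time d + 3) * length (bucket d)))"

text \<open>Raising \<open>lend\<close> to \<open>ne\<close> does everything at once: the finished
  tables become the current layer, and as no mark exceeds \<open>ne\<close>, the next layer starts
  out empty.\<close>

lemma work_advance:
  assumes "heap_of \<pi> s" and ent: "entries_of \<pi> nxt s" and lay: "layer_of s nxt (conf i)"
    and set: "set nxt = stacks i"
  shows "work i nxt {} \<pi> (s\<lparr>reg := (reg s)(''lbeg'' := reg s ''lend'', ''lend'' := reg s ''ne'')\<rparr>)"
proof -
  have "entries \<pi> (narr s ''ent_node'') (narr s ''ent_base'') (narr s ''mark'') (reg s ''ne'') (reg s ''ne'')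
      (reg s ''bfree'') []"
    using entriesD(1,2,6,7)[OF ent] unfolding entries_def by (auto simp: not_less)
  moreover have "layer (narr s ''lst'') (rarr s ''val'') (narr s ''lv'') (narr s ''ls'') (narr s ''lx'')
     (reg s ''lf'') (reg s ''ne'') (reg s ''bfree'') [] {}"
    using lay by (simp add: layer_def)
  moreover have "table_of s ((reg s ''lend'' + k) * Suc C) {l. (l, nxt ! k) \<in> conf i}" if "k < length nxt" for k
    using lay that by (simp add: layer_def)
  ultimately show ?thesis
    using assms(1) entriesD(1)[OF ent] entriesD(3,4)[OF ent] entries_distinct[OF ent] set
    unfolding work_def by simp
qed

lemma layer_prog_wp:
  assumes work: "work i cur {} \<pi> s" and inp: "inp s" and i: "i < n" and B: "0 < B"
    and ch: "chains s" and hv: "\<forall>u<n. narr s ''heavy'' u = hv u"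
    and vs: "map (narr s ''vstk'') [0..<reg s ''sp''] = rev (vst i)"
    and zero: "narr s ''wgt'' 0 = 0" "rarr s ''gain'' 0 = 0"
  shows "wp layer_prog (\<lambda>s' m'. (\<exists>\<pi>' cur'. work (Suc i) cur' {} \<pi>' s') \<and>
    map (narr s' ''vstk'') [0..<reg s' ''sp''] = rev (vst (Suc i)) \<and>
    narr s' ''wgt'' 0 = 0 \<and> rarr s' ''gain'' 0 = 0 \<and> m' \<le> m + layer_time i) s m"
proof -
  let ?u = "visit i"
  let ?d = "length (ch ?u)"
  let ?con = "\<lambda>st. \<Union>r\<in>set (bucket ?d). contrib i st r"
  have u: "?u < n" using vst_eq(2)[OF i] .
  define us where "us = tl (vst i)"
  have "rev (vst i) = rev us @ [?u]" by (subst vst_eq(1)[OF i]) (simp add: us_def)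
  with vs have vs': "map (narr s ''vstk'') [0..<reg s ''sp''] = rev us @ [?u]" by (rule trans)
  have len: "reg s ''sp'' = Suc (length us)"
    using arg_cong[OF vs', of length] by simp
  note vs' = vs'[unfolded len]
  then have top: "narr s ''vstk'' (length us) = ?u"
    and rest: "map (narr s ''vstk'') [0..<length us] = rev us" using vs' by (simp_all del: length_tl)
  define T where "T = 8 + (rule_time ?d + 3) * length (bucket ?d)"
  show ?thesis
    unfolding layer_prog_def
    apply (simp add: len top u inp inpD hv)
    apply (rule wp_conseq[OF vertices_prog_wp[where u = ?u and rest = us]])
    subgoal using inp by (simp add: inp_def)
    subgoal by (rule u)
    subgoal by simp
    subgoal by simp
    subgoal by simp
    subgoal using rest by simp
    subgoal premises p1 for s1 m1
    proof -
      note ag1 = p1(2)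
      have regs1: "reg s1 ''u'' = ?u" "reg s1 ''d'' = ?d" "reg s1 ''h'' = hv ?u"
        "reg s1 ''lend'' = reg s ''lend''" "reg s1 ''lbeg'' = reg s ''lbeg''"
        using ag1 by (simp_all add: agreeD)
      have inp1: "inp s1"
        by (rule inp_agree[OF _ ag1]) (use inp in \<open>auto simp: inp_def\<close>)
      have work1: "work i cur {} \<pi> s1"
        using work_agree[OF ag1] work by simp
      have cur: "reg s ''lend'' = reg s ''lbeg'' + length cur" "length cur = card (stacks i)"
        using workD(3-5)[OF work] distinct_card by fastforce+
      show ?thesis
        apply (simp add: regs1 cur(1) inp1 u inpD)
        apply (rule wp_For[where N = "length cur" and Inv = "\<lambda>k s' m'.
          (\<exists>\<pi>'. work i cur (\<Union>st\<in>set (take k cur). ?con st) \<pi>' s') \<and> m' \<le> m1 + 4 + T * k"])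
        subgoal by simp
        subgoal by simp
        subgoal by (simp add: agreeD)
        subgoal using work1 by (auto simp: work_def)
        subgoal premises p for k s2 m2
        proof -
          note ag2 = p(4)
          obtain \<pi>2 where \<pi>2: "work i cur (\<Union>st\<in>set (take k cur). ?con st) \<pi>2 s2" and m2: "m2 \<le> m1 + 4 + T * k"
            using p(1) by blast
          have "inp s2"
            by (rule inp_agree[OF _ ag2]) (use inp1 in \<open>auto simp: inp_def\<close>)
          moreover have "vertex_loaded ?u s2"
            using ag2 regs1 ag1 zero inp1 u unfolding vertex_loaded_def by (simp add: agreeD inpD)
          moreover have "chains s2" using ch ag1 ag2 by (simp add: chains_def agreeD)
          moreover have "(\<Union>st\<in>set (take (Suc k) cur). ?con st) = (\<Union>st\<in>set (take k cur). ?con st) \<union> ?con (cur ! k)"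
            using p(2) by (simp add: take_Suc_conv_app_nth Un_commute)
          ultimately show ?thesis
            using m2 by (intro wp_mono[OF entry_loop_wp[OF \<pi>2 _ i B p(2,3)]]) (auto simp: T_def)
        qed
        subgoal premises p for s2 m2
        proof -
          note ag2 = p(3)
          obtain \<pi>2 where "work i cur (\<Union>st\<in>set (take (length cur) cur). ?con st) \<pi>2 s2"
            and m2: "m2 \<le> m1 + 4 + T * length cur"
            using p(1) by blast
          then have w2: "work i cur (conf (Suc i)) \<pi>2 s2"
            using workD(5)[OF work] conf_Suc_contrib[OF i] by simp
          then obtain nxt where "entries_of \<pi>2 nxt s2" "layer_of s2 nxt (conf (Suc i))" "set nxt = stacks (Suc i)"
            using workD(2)[OF w2, folded stacks_def] by (elim exE conjE) (rule that)
          from work_advance[OF workD(1)[OF w2] this]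
          have "work (Suc i) nxt {} \<pi>2 (s2\<lparr>reg := (reg s2)(''lbeg'' := reg s2 ''lend'', ''lend'' := reg s2 ''ne'')\<rparr>)" .
          moreover have "map (narr s2 ''vstk'') [0..<reg s2 ''sp''] = rev (vst (Suc i))"
            using p1(1) ag2 vst_eq(3)[OF i, folded us_def] by (simp add: agreeD)
          moreover have "narr s2 ''wgt'' 0 = 0" "rarr s2 ''gain'' 0 = 0"
            using ag2 ag1 zero by (simp_all add: agreeD)
          moreover have "m2 + 3 \<le> m + layer_time i"
            using m2 p1(1) cur(2) by (simp add: layer_time_def T_def Let_def mult.commute)
          ultimately show ?thesis by (auto simp: numeral_3_eq_3)
        qed
        done
    qed
    done
qed

definition layers_prog :: com where
  "layers_prog = For ''i'' (Reg ''n'') layer_prog"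

lemma layers_prog_wp:
  assumes work: "work 0 cur {} \<pi> s" and inp: "inp s" and B: "0 < B"
    and ch: "chains s" and hv: "\<forall>u<n. narr s ''heavy'' u = hv u"
    and vs: "map (narr s ''vstk'') [0..<reg s ''sp''] = [root (tree I)]"
    and zero: "narr s ''wgt'' 0 = 0" "rarr s ''gain'' 0 = 0"
  shows "wp layers_prog (\<lambda>s' m'. (\<exists>\<pi>' cur'. work n cur' {} \<pi>' s') \<and>
    m' \<le> m + 2 + (\<Sum>i<n. layer_time i + 2)) s m"
  unfolding layers_prog_def
  apply (rule wp_For[where N = n and Inv = "\<lambda>i s m'. (\<exists>\<pi> cur. work i cur {} \<pi> s) \<and>
     map (narr s ''vstk'') [0..<reg s ''sp''] = rev (vst i) \<and>
     narr s ''wgt'' 0 = 0 \<and> rarr s ''gain'' 0 = 0 \<and> m' \<le> m + 1 + (\<Sum>j<i. layer_time j + 2)"])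
  subgoal by simp
  subgoal by simp
  subgoal using inp by (simp add: agreeD inpD)
  subgoal using work vs zero by auto
  subgoal premises p for i s1 m1
  proof -
    note ag = p(4)
    obtain \<pi>1 cur1 where w: "work i cur1 {} \<pi>1 s1" using p(1) by blast
    have "inp s1"
      by (rule inp_agree[OF inp ag]) auto
    moreover have "chains s1" using ch ag by (simp add: chains_def agreeD)
    moreover have "\<forall>u<n. narr s1 ''heavy'' u = hv u" using hv ag by (simp add: agreeD)
    ultimately show ?thesis
      using p(1) by (intro wp_mono[OF layer_prog_wp[OF w _ p(2) B]]) auto
  qed
  subgoal by auto
  done

text \<open>Address 0 is null and the empty stack owns the cells from 1 to \<open>B\<close>, so
  \<open>free\<close> starts at \<open>B + 1\<close>; list pointers 0 and 1 are taken, so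
  \<open>lf\<close> starts at 2. Real expressions have no constants, so the profit 0 is copied from
  the untouched entry 0 of \<open>gain\<close>.\<close>

definition init_prog :: com where
  "init_prog =
     ''free'' ::= Add (Reg ''num_states'') (Const 1) ;;
     ''lf'' ::= Const 2 ;;
     ''ne'' ::= Const 0 ;;
     ''bfree'' ::= Const 0 ;;
     ''lend'' ::= Const 0 ;;
     Put ''vstk'' (Const 0) (Reg ''root'') ;;
     ''sp'' ::= Const 1 ;;
     For ''k'' (Reg ''num_states'')
       (If (Less (Const 0) (Get ''initial'' (Reg ''k'')))
         (''y'' ::= Const 1 ;;
          ''q'' ::= Reg ''k'' ;;
          push_prog ;;
          entry_prog ;;
          Put ''lst'' (Reg ''b2'') (Const 1) ;;
          RPut ''val'' (Reg ''b2'') (RGet ''gain'' (Const 0)))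
         Skip) ;;
     ''lbeg'' ::= Reg ''lend'' ;;
     ''lend'' ::= Reg ''ne''"

lemma writes_init [simp]:
  "wregs init_prog = {''free'', ''lf'', ''ne'', ''bfree'', ''lend'', ''sp'', ''k'', ''y'', ''q'', ''cell'', ''b2'', ''lbeg''}"
  "wnarrs init_prog = {''vstk'', ''push'', ''top'', ''below'', ''ent_node'', ''ent_base'', ''mark'', ''lst''}"
  "wrarrs init_prog = {''val''}"
  by (auto simp: init_prog_def)

lemma init_prog_wp:
  assumes inp: "inp s" and B: "0 < B"
    and zero: "narr s ''push'' = (\<lambda>_. 0)" "narr s ''mark'' = (\<lambda>_. 0)" "narr s ''lst'' = (\<lambda>_. 0)"
      "rarr s ''gain'' 0 = 0"
  shows "wp init_prog (\<lambda>s' m'. (\<exists>\<pi> cur. work 0 cur {} \<pi> s') \<and>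
    map (narr s' ''vstk'') [0..<reg s' ''sp''] = [root (tree I)] \<and> m' \<le> m + 12 + 22 * B) s m"
proof -
  define Fk :: "nat \<Rightarrow> ((nat \<times> nat) list \<times> nat list) set"
    where "Fk k = {([], [q]) | q. q < k \<and> q \<in> inits}" for k
  define Inv where "Inv k s' m' \<longleftrightarrow> (\<exists>\<pi> nxt. heap_of \<pi> s' \<and> entries_of \<pi> nxt s' \<and>
    layer_of s' nxt (Fk k) \<and> set nxt = snd ` Fk k) \<and> reg s' ''lend'' = 0 \<and> m' \<le> m + 8 + 22 * k"
    for k m' and s' :: memory
  define \<pi>0 :: "nat list \<Rightarrow> nat" where "\<pi>0 st = (if st = [] then 1 else 0)" for st
  have heap0: "heap \<pi>0 (\<lambda>_. 0) tp bl (\<lambda>_. 0) (Suc B)" for tp bl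
    by (auto simp: heap_def \<pi>0_def)
  have ent0: "entries \<pi>0 node base (\<lambda>_. 0) 0 0 0 []" for node base
    by (simp add: entries_def)
  have lay0: "layer (\<lambda>_. 0) vl lv ls lx 2 0 0 [] (Fk 0)" for vl lv ls lx
    by (simp add: layer_def Fk_def)
  show ?thesis
    unfolding init_prog_def
    apply (simp add: inp inpD)
    apply (rule wp_For[where N = B and Inv = Inv])
    subgoal by (simp add: Inv_def)
    subgoal by simp
    subgoal using inp by (simp add: agreeD inpD)
    subgoal
      using heap0 ent0 lay0 unfolding Inv_def by (auto simp: zero Fk_def intro!: exI[of _ \<pi>0] exI[of _ "[]"])
    subgoal premises p for k s1 m1
    proof -
      note ag = p(4)
      have inp1: "inp s1"
        by (rule inp_agree[OF _ ag]) (use inp in \<open>auto simp: inp_def\<close>)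
      obtain \<pi>1 nxt where I: "heap_of \<pi>1 s1" "entries_of \<pi>1 nxt s1" "layer_of s1 nxt (Fk k)" "set nxt = snd ` Fk k"
        and lend: "reg s1 ''lend'' = 0" and m1: "m1 \<le> m + 8 + 22 * k"
        using p(1) unfolding Inv_def by blast
      show ?thesis
      proof (cases "k \<in> inits")
        case False
        then have "Fk (Suc k) = Fk k" by (auto simp: Fk_def less_Suc_eq)
        then show ?thesis using False p inp1 I lend m1 by (auto simp: inpD Inv_def)
      next
        case True
        note k_init = True
        have FS: "Fk (Suc k) = insert ([], [k]) (Fk k)" using True by (auto simp: Fk_def less_Suc_eq)
        have new: "[k] \<notin> set nxt" using I(4) by (auto simp: Fk_def)
        show ?thesis
          apply (simp add: p(2,3) inp1 inpD True)
          apply (rule wp_conseq[OF push_prog_wp[where \<pi> = \<pi>1 and st = "[]"]])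
          subgoal using I by simp
          subgoal using heapD(1)[OF I(1)] by simp
          subgoal using heapD(1)[OF I(1)] by simp
          subgoal using p(2) by simp
          subgoal using inp1 by (simp add: inpD)
          subgoal premises q for s2 m2
          proof -
            note ag2 = q(2)
            obtain \<pi>2 where \<pi>2: "heap_of \<pi>2 s2" "extends \<pi>1 \<pi>2 (narr s1 ''mark'')" "\<pi>2 [k] \<noteq> 0"
              "reg s2 ''y'' = \<pi>2 [k]" and m2: "m2 \<le> m1 + 11" using q(1) by auto
            have ent2: "entries_of \<pi>2 nxt s2"
              using entries_extends[OF I(2) \<pi>2(2)] ag2 by (simp add: agreeD)
            show ?thesis
              apply (simp only: wp_Seq)
              apply (rule wp_conseq[OF entry_prog_wp[OF \<pi>2(1) ent2 \<pi>2(3,4) _ B]])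
              subgoal using ag2 inp1 by (simp add: agreeD inpD)
              subgoal premises r for s3 m3
              proof -
                note ag3 = r(2)
                obtain k' where ent3: "heap_of \<pi>2 s3" "entries_of \<pi>2 (nxt @ [[k]]) s3"
                   and k': "k' < Suc (length nxt)" "(nxt @ [[k]]) ! k' = [k]"
                   and b2: "reg s3 ''b2'' = k' * Suc C" and bf: "reg s3 ''bfree'' = reg s1 ''bfree'' + Suc C"
                   and m3: "m3 \<le> m2 + 7"
                proof -
                  from r(1) obtain nxt' k' where e: "heap_of \<pi>2 s3" "entries_of \<pi>2 nxt' s3"
                    "k' < length nxt'" "nxt' ! k' = [k]" "reg s3 ''b2'' = (reg s2 ''lend'' + k') * Suc C"
                    "nxt' = nxt \<and> reg s3 ''bfree'' = reg s2 ''bfree'' \<or>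
                     nxt' = nxt @ [[k]] \<and> [k] \<notin> set nxt \<and> reg s3 ''bfree'' = reg s2 ''bfree'' + Suc C"
                    "m3 \<le> m2 + 7" by (elim exE conjE) (rule that)
                  have "nxt' \<noteq> nxt" using new e(3,4) nth_mem by metis
                  then have "nxt' = nxt @ [[k]]" "reg s3 ''bfree'' = reg s1 ''bfree'' + Suc C"
                    using e(6) ag2 by (auto simp: agreeD)
                  then show ?thesis using e ag2 lend by (intro that[of k']) (auto simp: agreeD)
                qed
                have k'_eq: "k' = length nxt"
                  using k' new by (metis less_Suc_eq nth_append nth_mem)
                have bfree1: "reg s1 ''bfree'' = length nxt * Suc C" using entriesD(2)[OF I(2)] lend by simp
                have arrs: "narr s3 ''lst'' = narr s1 ''lst''" "rarr s3 ''val'' = rarr s1 ''val''"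
                  "narr s3 ''lv'' = narr s1 ''lv''" "narr s3 ''ls'' = narr s1 ''ls''" "narr s3 ''lx'' = narr s1 ''lx''"
                  "reg s3 ''lf'' = reg s1 ''lf''" "reg s3 ''lend'' = 0" "rarr s3 ''gain'' 0 = 0"
                  using ag ag2 ag3 lend zero by (simp_all add: agreeD)
                have lst0: "narr s1 ''lst'' (length nxt * Suc C + c) = 0" for c
                  using I(3) bfree1 by (simp add: layer_def)
                let ?lst = "(narr s1 ''lst'')(length nxt * Suc C := 1)"
                let ?val = "(rarr s1 ''val'')(length nxt * Suc C := 0)"
                have lf: "1 < reg s1 ''lf''" using I(3) by (simp add: layer_def)
                have "layer ?lst ?val (narr s1 ''lv'') (narr s1 ''ls'') (narr s1 ''lx'') (reg s1 ''lf'') 0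
                   (reg s1 ''bfree'' + Suc C) (nxt @ [[k]]) (Fk (Suc k))"
                  unfolding layer_def
                proof (intro conjI allI impI)
                  fix j assume j: "j < length (nxt @ [[k]])"
                  show "table ?lst ?val (narr s1 ''lv'') (narr s1 ''ls'') (narr s1 ''lx'') (reg s1 ''lf'')
                    ((0 + j) * Suc C) {l. (l, (nxt @ [[k]]) ! j) \<in> Fk (Suc k)}"
                  proof (cases "j = length nxt")
                    case True
                    have "{l. (l, (nxt @ [[k]]) ! j) \<in> Fk (Suc k)} = {[]}"
                      using True k_init by (auto simp: FS Fk_def)
                    then show ?thesis
                      using True lst0 lf unfolding table_def best_def by auto
                  next
                    case False
                    then have j': "j < length nxt" using j by simp
                    then have ne: "nxt ! j \<noteq> [k]" using new nth_mem by metis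
                    have "table_of s1 (j * Suc C) {l. (l, nxt ! j) \<in> Fk k}"
                      using I(3) j' lend by (simp add: layer_def)
                    moreover have "j * Suc C + c \<noteq> length nxt * Suc C" if "c \<le> C" for c
                      using block_address_less[of c "Suc C" j "length nxt"] j' that by simp
                    moreover have "{l. (l, (nxt @ [[k]]) ! j) \<in> Fk (Suc k)} = {l. (l, nxt ! j) \<in> Fk k}"
                      using j' ne by (auto simp: FS nth_append)
                    ultimately show ?thesis by (simp add: table_def)
                  qed
                next
                  fix a assume "reg s1 ''bfree'' + Suc C \<le> a"
                  then show "?lst a = 0" using I(3) bfree1 by (simp add: layer_def)
                qed (use lf in simp)
                moreover have "set (nxt @ [[k]]) = snd ` Fk (Suc k)" using I(4) FS by auto
                moreover have "m3 + 3 \<le> m + 8 + 22 * Suc k" using m1 m2 m3 by simp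
                ultimately have "Inv (Suc k) (s3\<lparr>narr := (narr s3)(''lst'' := (narr s3 ''lst'')(reg s3 ''b2'' := 1)),
                   rarr := (rarr s3)(''val'' := (rarr s3 ''val'')(reg s3 ''b2'' := 0))\<rparr>) (m3 + 3)"
                  unfolding Inv_def using ent3
                  by (intro conjI exI[of _ \<pi>2] exI[of _ "nxt @ [[k]]"])
                    (simp_all add: arrs b2 k'_eq bf del: mult_Suc_right add_Suc_right set_append)
                then show ?thesis by (simp add: arrs numeral_3_eq_3)
              qed
              done
          qed
          done
      qed
    qed
    subgoal premises p for s1 m1
    proof -
      obtain \<pi>1 nxt where I: "heap_of \<pi>1 s1" "entries_of \<pi>1 nxt s1" "layer_of s1 nxt (Fk B)" "set nxt = snd ` Fk B"
        and m1: "m1 \<le> m + 8 + 22 * B"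
        using p(1) unfolding Inv_def by blast
      have "Fk B = conf 0" using inits_less by (auto simp: Fk_def)
      then have "work 0 nxt {} \<pi>1 (s1\<lparr>reg := (reg s1)(''lbeg'' := reg s1 ''lend'', ''lend'' := reg s1 ''ne'')\<rparr>)"
        using work_advance[OF I(1,2)] I(3,4) by (simp add: stacks_def)
      moreover have "map (narr s1 ''vstk'') [0..<reg s1 ''sp''] = [root (tree I)]"
        using p(3) by (simp add: agreeD)
      ultimately show ?thesis using m1 by auto
    qed
    done
qed

end


context heavy_knap
begin

section \<open>Reading off an optimal set\<close>

text \<open>After the last vertex the empty stack is the only possible one, so the layer has at most
  one table. Its cells stand for exact weights, hence the optimum is the best of all cells up to
  \<open>C\<close>.\<close>

definition output_prog :: com where
  "output_prog =
     If (Less (Reg ''lbeg'') (Reg ''lend''))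
       (''b'' ::= Get ''ent_base'' (Reg ''lbeg'') ;;
        ''found'' ::= Const 0 ;;
        ''bc'' ::= Const 0 ;;
        For ''c'' (Add (Reg ''capacity'') (Const 1))
          (If (BAnd (Less (Const 0) (Get ''lst'' (Add (Reg ''b'') (Reg ''c''))))
                 (BNot (BAnd (Less (Const 0) (Reg ''found''))
                   (BNot (RLess (RGet ''val'' (Add (Reg ''b'') (Reg ''bc''))) (RGet ''val'' (Add (Reg ''b'') (Reg ''c''))))))))
            (''found'' ::= Const 1 ;; ''bc'' ::= Reg ''c'') Skip) ;;
        If (Less (Const 0) (Reg ''found''))
          (''feasible'' ::= Const 1 ;;
           ''p'' ::= Get ''lst'' (Add (Reg ''b'') (Reg ''bc'')) ;;
           For ''i'' (Reg ''n'')
             (Put ''solution'' (Get ''lv'' (Reg ''p'')) (Get ''ls'' (Reg ''p'')) ;;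
              ''p'' ::= Get ''lx'' (Reg ''p'')))
          Skip)
       Skip"

lemma output_prog_wp:
  assumes work: "work n cur F \<pi> s" and inp: "inp s"
    and zero: "reg s ''feasible'' = 0" "narr s ''solution'' = (\<lambda>_. 0)"
  shows "wp output_prog (\<lambda>s' m'. correct_output I s' \<and> m' \<le> m + 20 + 10 * Suc C + 10 * n) s m"
proof (cases "cur = []")
  case True
  then have "stacks n = {}" using workD(5)[OF work] by simp
  then have "conf n = {}" by (simp add: stacks_def)
  then have "\<not> feasible I X" for X by (simp add: feasible_iff)
  then show ?thesis using True workD(3)[OF work] zero by (simp add: output_prog_def correct_output_def)
next
  case False
  let ?b = "reg s ''lbeg'' * Suc C"
  let ?P = "{l. (l, []) \<in> conf n}"
  have lend: "reg s ''lbeg'' < reg s ''lend''" using False workD(3)[OF work] by simp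
  have "cur ! 0 \<in> stacks n" using False workD(5)[OF work] nth_mem[of 0 cur] by simp
  then have "cur ! 0 = []" using length_stack[of n "cur ! 0"] pend_all by simp
  then have tab: "table_of s ?b ?P" using workD(8)[OF work, of 0] False by simp
  obtain nxt where ent: "entries_of \<pi> nxt s" using workD(2)[OF work] by (elim exE conjE) (rule that)
  have base: "narr s ''ent_base'' (reg s ''lbeg'') = ?b"
    by (rule entriesD(6)[OF ent]) (use lend in simp)
  let ?lst = "\<lambda>c. narr s ''lst'' (?b + c)" and ?val = "\<lambda>c. rarr s ''val'' (?b + c)"
  have cell: "best (narr s ''lv'') (narr s ''ls'') (narr s ''lx'') (reg s ''lf'') (?lst c) (?val c) c ?P"
    if "c \<le> C" for c
    using tab that by (simp add: table_def)
  define Inv where "Inv c s' m' \<longleftrightarrow>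
    (reg s' ''found'' = 0 \<and> (\<forall>c'<c. ?lst c' = 0) \<or>
     reg s' ''found'' = 1 \<and> reg s' ''bc'' < c \<and> ?lst (reg s' ''bc'') \<noteq> 0 \<and>
       (\<forall>c'<c. ?lst c' \<noteq> 0 \<longrightarrow> ?val c' \<le> ?val (reg s' ''bc''))) \<and>
    m' \<le> m + 5 + 6 * c" for c m' and s' :: memory
  show ?thesis
    unfolding output_prog_def
    apply (simp add: lend base del: mult_Suc_right)
    apply (rule wp_For[where N = "Suc C" and Inv = Inv])
    subgoal by (simp add: Inv_def)
    subgoal by simp
    subgoal using inp by (simp add: agreeD inpD)
    subgoal by (simp add: Inv_def)
    subgoal premises p for c s1 m1
    proof -
      have b: "reg s1 ''b'' = ?b" "narr s1 ''lst'' = narr s ''lst''" "rarr s1 ''val'' = rarr s ''val''"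
        using p(4) by (simp_all add: agreeD)
      show ?thesis
        using p(1) unfolding Inv_def
        by (auto simp: b p(3) less_Suc_eq not_less simp del: mult_Suc_right) force+
    qed
    subgoal premises p for s1 m1
    proof -
      note ag = p(3)
      have b: "reg s1 ''b'' = ?b" "narr s1 ''lst'' = narr s ''lst''" "reg s1 ''feasible'' = 0"
        "narr s1 ''solution'' = (\<lambda>_. 0)"
        "narr s1 ''lv'' = narr s ''lv''" "narr s1 ''ls'' = narr s ''ls''" "narr s1 ''lx'' = narr s ''lx''"
        using ag zero by (simp_all add: agreeD)
      have inp1: "inp s1"
        by (rule inp_agree[OF _ ag]) (use inp in \<open>auto simp: inp_def\<close>)
      have m1: "m1 \<le> m + 5 + 6 * Suc C" using p(1) by (simp add: Inv_def)
      consider (none) "reg s1 ''found'' = 0" "\<forall>c\<le>C. ?lst c = 0"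
        | (some) "reg s1 ''found'' = 1" "reg s1 ''bc'' \<le> C" "?lst (reg s1 ''bc'') \<noteq> 0"
          "\<forall>c\<le>C. ?lst c \<noteq> 0 \<longrightarrow> ?val c \<le> ?val (reg s1 ''bc'')"
        using p(1)[unfolded Inv_def less_Suc_eq_le, THEN conjunct1]
        by (elim disjE conjE) ((rule that(1); assumption), (rule that(2); assumption))
      then show ?thesis
      proof cases
        case none
        have "\<not> feasible I X" for X
        proof
          assume "feasible I X"
          then obtain l where l: "l \<in> ?P" "total (weight I) l \<le> C" unfolding feasible_iff by blast
          have "\<forall>l'\<in>?P. total (weight I) l' \<noteq> total (weight I) l"
            using cell[OF l(2)] none(2)[rule_format, OF l(2)] by (simp only: best_def simp_thms if_True)
          then show False using l(1) by blast
        qed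
        then show ?thesis using none(1) b m1 by (simp add: correct_output_def)
      next
        case some
        let ?bc = "reg s1 ''bc''"
        let ?p = "narr s ''lst'' (?b + ?bc)"
        obtain l where l: "(l, []) \<in> conf n" "list_at (narr s ''lv'') (narr s ''ls'') (narr s ''lx'') ?p l"
          "total (weight I) l = ?bc" "total (profit I) l = ?val ?bc"
          using cell[OF some(2)] some(3) by (auto simp: best_def)
        have opt: "optimal I (selected l)"
        proof (rule optimalI[OF l(1)])
          show "total (weight I) l \<le> C" using l(3) some(2) by simp
          fix l' assume l': "(l', []) \<in> conf n" "total (weight I) l' \<le> C"
          then have "?lst (total (weight I) l') \<noteq> 0"
            "total (profit I) l' \<le> ?val (total (weight I) l')"
            using cell[OF l'(2)] by (auto simp: best_def split: if_splits)
          then show "total (profit I) l' \<le> total (profit I) l"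
            using some(4) l'(2) l(4) by fastforce
        qed
        have len: "length l = n" using arg_cong[OF conf_fst[OF _ l(1)], of length] by simp
        have dist: "distinct (map fst l)" using conf_final_distinct[OF l(1)] .
        have sub: "selected l \<subseteq> {..<n}"
          using conf_accepted[OF l(1)] by (simp add: accepted_sets_def verts)
        show ?thesis
          apply (simp add: some b del: mult_Suc_right)
          apply (rule wp_For[where N = n and Inv = "\<lambda>i s' m'.
            list_at (narr s ''lv'') (narr s ''ls'') (narr s ''lx'') (reg s' ''p'') (drop i l) \<and>
            {v. narr s' ''solution'' v = 1} = selected (take i l) \<and> m' \<le> m1 + 5 + 4 * i"])
          subgoal by simp
          subgoal by simp
          subgoal using inp1 by (simp add: agreeD inpD)
          subgoal using l(2) b by (simp add: selected_def)
          subgoal premises q for i s2 m2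
          proof -
            note ag2 = q(4)
            have arrs: "narr s2 ''lv'' = narr s ''lv''" "narr s2 ''ls'' = narr s ''ls''" "narr s2 ''lx'' = narr s ''lx''"
              using ag2 b by (simp_all add: agreeD)
            obtain v a where va: "l ! i = (v, a)" by (cases "l ! i")
            have il: "i < length l" using q(2) len by simp
            have dr: "drop i l = (v, a) # drop (Suc i) l" using va il by (metis Cons_nth_drop_Suc)
            have tk: "take (Suc i) l = take i l @ [(v, a)]" using va il by (simp add: take_Suc_conv_app_nth)
            \<comment> \<open>No vertex occurs twice in \<open>l\<close>, so this write cannot undo
              an earlier one.\<close>
            have "distinct (map fst (take i l @ (v, a) # drop (Suc i) l))"
              using dist dr by (metis append_take_drop_id)
            then have "v \<notin> fst ` set (take i l)" by auto
            then have "v \<notin> selected (take i l)" by (force simp: selected_def)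
            moreover have "selected (take (Suc i) l) = (if a = 1 then insert v (selected (take i l)) else selected (take i l))"
              by (auto simp: tk selected_def)
            ultimately show ?thesis
              using q(1) unfolding dr by (auto simp: arrs)
          qed
          subgoal premises q for s2 m2
          proof -
            have "{v. narr s2 ''solution'' v = 1} = selected l" using q(1) len by simp
            then have "output_set I s2 = selected l"
              using sub by (auto simp: output_set_def verts)
            moreover have "reg s2 ''feasible'' = 1" using q(3) by (simp add: agreeD)
            moreover have "\<exists>X. feasible I X" using opt by (auto simp: optimal_def)
            ultimately have "correct_output I s2" using opt by (simp add: correct_output_def)
            then show ?thesis using q(1) m1 by simp
          qed
          done
      qed
    qed
    done
qed

text \<open>The part of the program that presupposes heavy children; it is treated apart because the
  locale parameters can be instantiated only once the sizes have been computed.\<close>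

lemma backend_wp:
  assumes inp: "inp s" and B: "0 < B" and hv: "\<forall>u<n. narr s ''heavy'' u = hv u"
    and zero: "narr s ''bucket'' = (\<lambda>_. 0)" "narr s ''push'' = (\<lambda>_. 0)" "narr s ''mark'' = (\<lambda>_. 0)"
      "narr s ''lst'' = (\<lambda>_. 0)" "narr s ''wgt'' 0 = 0" "rarr s ''gain'' 0 = 0"
      "reg s ''feasible'' = 0" "narr s ''solution'' = (\<lambda>_. 0)"
  shows "wp (buckets_prog ;; init_prog ;; layers_prog ;; output_prog) (\<lambda>s' m'. correct_output I s' \<and>
    m' \<le> m + 40 + 5 * length rs + 22 * B + (\<Sum>i<n. layer_time i + 2) + 10 * Suc C + 10 * n) s m"
proof -
  have w: "wregs buckets_prog = {''r'', ''d''}" "wnarrs buckets_prog = {''next_rule'', ''bucket''}"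
    "wrarrs buckets_prog = {}"
    "wregs layers_prog = insert ''i'' (wregs layer_prog)" "wnarrs layers_prog = wnarrs layer_prog"
    "wrarrs layers_prog = wrarrs layer_prog"
    by (auto simp: buckets_prog_def layers_prog_def)
  show ?thesis
    apply (simp only: wp_Seq)
    apply (rule wp_conseq[OF buckets_prog_wp[OF inp zero(1)]])
    subgoal premises p1 for s1 m1
    proof -
      note ag1 = p1(2)
      have inp1: "inp s1" by (rule inp_agree[OF inp ag1]) (auto simp: w)
      show ?thesis
        apply (simp only: wp_Seq)
        apply (rule wp_conseq[OF init_prog_wp[OF inp1 B]])
        subgoal using ag1 zero by (simp add: agreeD w)
        subgoal using ag1 zero by (simp add: agreeD w)
        subgoal using ag1 zero by (simp add: agreeD w)
        subgoal using ag1 zero by (simp add: agreeD w)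
        subgoal premises p2 for s2 m2
        proof -
          note ag2 = p2(2)
          have inp2: "inp s2" by (rule inp_agree[OF inp1 ag2]) auto
          obtain \<pi>2 cur2 where w2: "work 0 cur2 {} \<pi>2 s2" using p2 by blast
          have ch2: "chains s2" using p1(1) ag2 by (simp add: chains_def agreeD)
          show ?thesis
            apply (simp only: wp_Seq)
            apply (rule wp_conseq[OF layers_prog_wp[OF w2 inp2 B ch2]])
            subgoal using hv ag1 ag2 by (simp add: agreeD w)
            subgoal using p2 by simp
            subgoal using zero ag1 ag2 by (simp add: agreeD w)
            subgoal using zero ag1 ag2 by (simp add: agreeD w)
            subgoal premises p3 for s3 m3
            proof -
              note ag3 = p3(2)
              have inp3: "inp s3" by (rule inp_agree[OF inp2 ag3]) (auto simp: w)
              obtain \<pi>3 cur3 where w3: "work n cur3 {} \<pi>3 s3" using p3(1) by blast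
              show ?thesis
                apply (rule wp_mono[OF output_prog_wp[OF w3 inp3]])
                subgoal using zero ag1 ag2 ag3 by (simp add: agreeD w)
                subgoal using zero ag1 ag2 ag3 by (simp add: agreeD w)
                subgoal using p1(1) p2 p3(1) by simp
                done
            qed
            done
        qed
        done
    qed
    done
qed

lemma sum_layer_time:
  assumes "1 \<le> \<delta>" "0 < B"
  shows "real (\<Sum>i<n. layer_time i + 2) \<le>
    38 * real n + 114 * (real B)\<^sup>2 * real (max 1 C) * rate * real n powr expo"
proof -
  define M where "M = max 1 C"
  have M: "1 \<le> M" "C \<le> M" by (simp_all add: M_def)
  let ?d = "\<lambda>i. length (ch (visit i))"
  have "layer_time i \<le> 30 + 6 * ?d i + 114 * B\<^sup>2 * M * (hd (copies i) * branch_cost (visit i))"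
    if i: "i < n" for i
  proof -
    let ?N = "card (rhss (?d i))"
    have "length (bucket (?d i)) = card (set (bucket (?d i)))"
      by (rule distinct_card[symmetric]) (simp add: bucket_def)
    also have "set (bucket (?d i)) = {r. r < length rs \<and> arity r = ?d i}" by (auto simp: bucket_def)
    finally have L: "length (bucket (?d i)) \<le> 2 * B * ?N" using card_rules_of_arity by simp
    \<comment> \<open>The maximum of 1 and \<open>C\<close> is needed because a table for
      \<open>C = 0\<close> still has one cell. The constant 114 is \<open>43 + 14 = 57\<close>,
      doubled by the two symbols in the bound on the bucket.\<close>
    have "rule_time (?d i) + 3 \<le> 43 * (?d i + 1) + 14 * C" by (simp add: rule_time_def)
    also have "\<dots> \<le> 43 * ((?d i + 1) * M) + 14 * ((?d i + 1) * M)"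
    proof -
      have "(?d i + 1) * 1 \<le> (?d i + 1) * M" using M by (intro mult_le_mono2)
      moreover have "1 * C \<le> (?d i + 1) * M" using M by (intro mult_le_mono) auto
      ultimately show ?thesis by linarith
    qed
    finally have "rule_time (?d i) + 3 \<le> 57 * ((?d i + 1) * M)" by linarith
    from mult_le_mono[OF this L]
    have "8 + (rule_time (?d i) + 3) * length (bucket (?d i)) \<le> 8 + 114 * (B * M * ((?d i + 1) * ?N))"
      by (simp add: algebra_simps)
    also have "\<dots> \<le> 114 * (B * M) + 114 * (B * M * ((?d i + 1) * ?N))"
    proof -
      have "1 * 1 \<le> B * M" using assms M by (intro mult_le_mono) auto
      then show ?thesis by linarith
    qed
    also have "\<dots> = 114 * B * M * branch_cost (visit i)"
      by (simp add: branch_cost_def algebra_simps)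
    finally have "card (stacks i) * (8 + (rule_time (?d i) + 3) * length (bucket (?d i)))
      \<le> (B * hd (copies i)) * (114 * B * M * branch_cost (visit i))"
      by (intro mult_le_mono card_stacks i)
    then show ?thesis by (simp add: layer_time_def Let_def power2_eq_square algebra_simps)
  qed
  then have "(\<Sum>i<n. layer_time i + 2) \<le>
      (\<Sum>i<n. 32 + 6 * ?d i + 114 * B\<^sup>2 * M * (hd (copies i) * branch_cost (visit i)))"
    by (intro sum_mono) fastforce
  also have "\<dots> = 32 * n + 6 * (\<Sum>i<n. ?d i) + 114 * B\<^sup>2 * M * (\<Sum>i<n. hd (copies i) * branch_cost (visit i))"
    by (simp add: sum.distrib sum_distrib_left)
  also have "\<dots> \<le> 38 * n + 114 * B\<^sup>2 * M * (\<Sum>i<n. hd (copies i) * branch_cost (visit i))"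
    using sum_length_children by simp
  finally have "real (\<Sum>i<n. layer_time i + 2) \<le>
      real (38 * n + 114 * B\<^sup>2 * M * (\<Sum>i<n. hd (copies i) * branch_cost (visit i)))"
    by (rule of_nat_mono)
  also have "\<dots> = 38 * real n + 114 * (real B)\<^sup>2 * real M * (\<Sum>i<n. real (hd (copies i)) * real (branch_cost (visit i)))"
    by simp
  also have "\<dots> \<le> 38 * real n + 114 * (real B)\<^sup>2 * real M * (rate * real n powr expo)"
    using sum_branch_cost[OF assms(1)] by (intro add_left_mono mult_left_mono) auto
  finally show ?thesis by (simp add: mult.assoc M_def)
qed

end


section \<open>The algorithm\<close>

text \<open>The programs mention no locale parameter, so this is one fixed program for all
  instances. Without listed rules \<open>\<delta>\<close> is 0 and the time bound no longer grows
  with \<open>n\<close>, so this case must be answered before the tree is even read.\<close>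

definition solver :: com where
  "solver =
     If (Less (Const 0) (Reg ''num_rules''))
       (knap.order_prog ;; knap.sizes_prog ;; knap.buckets_prog ;; heavy_knap.init_prog ;;
        heavy_knap.layers_prog ;; heavy_knap.output_prog)
       Skip"

text \<open>The summands pay for the terms linear in \<open>n\<close> and \<open>C\<close>, for the
  initial states, for sorting the rules (5 steps each, by \<open>num_rules_le\<close>), and for the
  layers with \<open>rate\<close> written out.\<close>

definition solver_const :: "nat \<Rightarrow> real" where
  "solver_const K = 200 + 22 * real K + 20 * real K * (real K + 2) + 114 * (real K)\<^sup>2 * (2 * real K + 6)"

lemma solver_const_mono: "k \<le> K \<Longrightarrow> solver_const k \<le> solver_const K"
  unfolding solver_const_def by (intro add_mono mult_mono power_mono) auto

lemma solver_const_ge: "200 \<le> solver_const K"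
  unfolding solver_const_def by simp

context knap
begin

text \<open>About \<open>n * \<delta>\<close> right-hand sides can exist. For
  \<open>n \<ge> 2\<close>, \<open>\<delta> < 2 powr a\<close> and
  \<open>2 powr (a - 1) \<le> n powr (a - 1)\<close> with \<open>a = log 2 (1 + \<delta>)\<close>
  give \<open>n * \<delta> \<le> 2 * n powr a\<close>. For \<open>n = 1\<close> the power is 1, but
  only arities 0 and 1 count and \<open>\<delta> \<le> B\<close>.\<close>

lemma num_rules_le:
  assumes "1 \<le> \<delta>" "0 < B"
  shows "real (length rs) \<le> 4 * real B * (real B + 2) * real n powr log 2 (1 + real \<delta>)"
proof -
  have a: "1 \<le> log 2 (1 + real \<delta>)"
  proof -
    have "log 2 2 \<le> log 2 (1 + real \<delta>)" using assms by (subst log_le_cancel_iff) auto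
    then show ?thesis by simp
  qed
  have "{..<length rs} = (\<Union>d\<le>n. {r. r < length rs \<and> arity r = d})"
  proof -
    have "arity r \<le> n" if "r < length rs" for r
      using that set_rs[of "fst (rs ! r)" "fst (snd (rs ! r))" "snd (snd (rs ! r))"] by simp
    then show ?thesis by auto
  qed
  then have "length rs = card (\<Union>d\<le>n. {r. r < length rs \<and> arity r = d})" by (metis card_lessThan)
  also have "\<dots> \<le> (\<Sum>d\<le>n. card {r. r < length rs \<and> arity r = d})" by (rule card_UN_le) simp
  also have "\<dots> \<le> (\<Sum>d\<le>n. 2 * B * \<delta>)"
  proof (rule sum_mono)
    fix d assume "d \<in> {..n}"
    then have "2 * B * card (rhss d) \<le> 2 * B * \<delta>"
      using card_rhss_le_diversity by (intro mult_le_mono2) auto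
    then show "card {r. r < length rs \<and> arity r = d} \<le> 2 * B * \<delta>"
      using card_rules_of_arity[of d] by linarith
  qed
  also have "\<dots> = (n + 1) * (2 * B * \<delta>)" by simp
  also have "\<dots> \<le> (2 * n) * (2 * B * \<delta>)" using n_pos by (intro mult_le_mono1) simp
  finally have "length rs \<le> 4 * B * (n * \<delta>)" by (simp add: algebra_simps)
  then have "real (length rs) \<le> real (4 * B * (n * \<delta>))" by (rule of_nat_mono)
  then have 1: "real (length rs) \<le> 4 * real B * (real n * real \<delta>)" by simp
  have 2: "real n * real \<delta> \<le> (real B + 2) * real n powr log 2 (1 + real \<delta>)"
  proof (cases "n = 1")
    case True
    have "\<delta> \<le> B"
    proof -
      have "card {qs. length qs = m \<and> (\<exists>q a. (q, a, qs) \<in> rules (automaton I))} \<le> B" if "m \<le> n" for m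
      proof -
        have "m = 0 \<or> m = 1" using that True by auto
        then have "B ^ m \<le> B" using assms(2) by auto
        then show ?thesis using card_rhss_le_power[of m] by (simp add: rhss_def)
      qed
      then show ?thesis unfolding diversity_def by (subst Max_le_iff) auto
    qed
    then show ?thesis using True by simp
  next
    case False
    then have n2: "2 \<le> real n" using n_pos by simp
    have "real \<delta> \<le> 2 * 2 powr (log 2 (1 + real \<delta>) - 1)"
      by (simp add: powr_diff powr_log_cancel)
    also have "\<dots> \<le> 2 * real n powr (log 2 (1 + real \<delta>) - 1)"
      using n2 a by (intro mult_left_mono powr_mono2) auto
    finally have "real n * real \<delta> \<le> real n * (2 * real n powr (log 2 (1 + real \<delta>) - 1))"
      by (intro mult_left_mono) auto
    also have "\<dots> = 2 * real n powr log 2 (1 + real \<delta>)"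
      using n2 by (simp add: powr_diff)
    also have "\<dots> \<le> (real B + 2) * real n powr log 2 (1 + real \<delta>)"
      by (intro mult_right_mono) auto
    finally show ?thesis .
  qed
  have "4 * real B * (real n * real \<delta>) \<le> 4 * real B * ((real B + 2) * real n powr log 2 (1 + real \<delta>))"
    using 2 by (intro mult_left_mono) auto
  with 1 show ?thesis by (simp add: mult.assoc)
qed

lemma solver_correct:
  "solves_within solver I rs
     (solver_const B * real n powr log 2 (1 + real \<delta>) * real (max 1 C))"
proof (cases "rs = []")
  case True
  let ?bound = "solver_const B * real n powr log 2 (1 + real \<delta>) * real (max 1 C)"
  have "(1::real) \<le> real n powr log 2 (1 + real \<delta>)" using n_pos by (intro ge_one_powr_ge_zero) auto
  then have "200 * 1 * 1 \<le> ?bound"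
    using solver_const_ge[of B] by (intro mult_mono) auto
  moreover have "exec solver mem (1 + 1) mem"
    unfolding solver_def using mem_reg(4) unfolding True by (intro exec.IfFalse exec.Skip) simp
  moreover have "\<not> feasible I X" for X
  proof
    assume "feasible I X"
    then obtain \<rho> where "(\<rho> (root (tree I)), labelling X (root (tree I)), map \<rho> (ch (root (tree I))))
        \<in> rules (automaton I)"
      using root_less verts
      by (auto simp: feasible_def accepted_sets_def accepts_def successful_run_def)
    then show False using set_rs length_ch[OF root_less] True by fastforce
  qed
  then have "correct_output I mem" by (simp add: correct_output_def input_memory_def Let_def)
  ultimately show ?thesis unfolding solves_within_def by (intro exI[of _ "1 + 1"] exI[of _ mem]) auto
next
  case False
  note B = states_pos[OF False] and delta = diversity_pos[OF False]
  let ?a = "log 2 (1 + real \<delta>)" and ?M = "real (max 1 C)"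
  let ?X = "real n powr ?a * ?M"
  have zero: "narr mem ''bucket'' = (\<lambda>_. 0)" "narr mem ''push'' = (\<lambda>_. 0)" "narr mem ''mark'' = (\<lambda>_. 0)"
    "narr mem ''lst'' = (\<lambda>_. 0)" "narr mem ''wgt'' = (\<lambda>_. 0)" "rarr mem ''gain'' = (\<lambda>_. 0)"
    "reg mem ''feasible'' = 0" "narr mem ''solution'' = (\<lambda>_. 0)"
    by (simp_all add: input_memory_def Let_def)
  have w: "wregs order_prog = {''e'', ''i'', ''u'', ''o'', ''j''}" "wnarrs order_prog = {''ord''}" "wrarrs order_prog = {}"
    "wregs sizes_prog = {''i'', ''u'', ''o'', ''s'', ''best'', ''h'', ''j'', ''z''}"
    "wnarrs sizes_prog = {''size'', ''heavy''}" "wrarrs sizes_prog = {}"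
    by (auto simp: order_prog_def sizes_prog_def)
  have "wp solver (\<lambda>s' m'. correct_output I s' \<and> real m' \<le> solver_const B * ?X) mem 0"
    unfolding solver_def
    apply (simp add: mem_reg False)
    apply (rule wp_conseq[OF order_prog_wp[OF inp_mem]])
    subgoal premises p1 for s1 m1
    proof -
      note ag1 = p1(2)
      have inp1: "inp s1" by (rule inp_agree[OF inp_mem ag1]) (auto simp: w)
      show ?thesis
        apply (simp only: wp_Seq)
        apply (rule wp_conseq[OF sizes_prog_wp[OF inp1]])
        subgoal using p1(1) by blast
        subgoal premises p2 for s2 m2
        proof -
          note ag2 = p2(2)
          have inp2: "inp s2" by (rule inp_agree[OF inp1 ag2]) (auto simp: w)
          \<comment> \<open>The parameters become the arrays just computed, so the analysis applies
            to the choice of heavy children actually made.\<close>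
          interpret H: heavy_knap I rs "narr s2 ''size''" "narr s2 ''heavy''"
            using p2(1) by unfold_locales (auto simp: size_ok_def)
          have bound: "real m' \<le> solver_const B * ?X"
            if m': "m' \<le> m2 + 40 + 5 * length rs + 22 * B + (\<Sum>i<n. H.layer_time i + 2) + 10 * Suc C + 10 * n" for m'
          proof -
            have a1: "1 \<le> ?a" using H.expo_ge_1[OF delta] by (simp add: H.expo_def)
            have "real n powr 1 \<le> real n powr ?a" using n_pos a1 by (intro powr_mono) auto
            then have nX: "real n \<le> real n powr ?a" using n_pos by simp
            have "real n powr ?a * 1 \<le> ?X" by (intro mult_left_mono) auto
            then have 1: "real n powr ?a \<le> ?X" by simp
            have M: "?M \<le> ?X"
              using mult_right_mono[of 1 "real n powr ?a" ?M] nX n_pos by simp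
            have "1 \<le> real n" using n_pos by simp
            then have X: "1 \<le> ?X" using 1 nX by linarith
            have "5 * real (length rs) \<le> 5 * (4 * real B * (real B + 2) * real n powr ?a)"
              using num_rules_le[OF delta B] by simp
            also have "\<dots> = (20 * real B * (real B + 2)) * real n powr ?a" by simp
            also have "\<dots> \<le> (20 * real B * (real B + 2)) * ?X" using 1 by (intro mult_left_mono) auto
            finally have R: "5 * real (length rs) \<le> (20 * real B * (real B + 2)) * ?X" .
            have L: "real (\<Sum>i<n. H.layer_time i + 2) \<le> 38 * real n + (114 * (real B)\<^sup>2 * (2 * real B + 6)) * ?X"
              using H.sum_layer_time[OF delta B] by (simp add: H.rate_def H.expo_def mult.assoc mult.left_commute mult.commute)
            have BX: "22 * real B \<le> 22 * real B * ?X" using mult_left_mono[OF X, of "22 * real B"] by simp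
            have C: "real C \<le> ?M" by simp
            have "m2 \<le> 1 + 50 * n" using p1(1) p2(1) by simp
            then have "m' \<le> 1 + 50 * n + 40 + 5 * length rs + 22 * B + (\<Sum>i<n. H.layer_time i + 2) + 10 * Suc C + 10 * n"
              using m' by linarith
            then have "real m' \<le> real (1 + 50 * n + 40 + 5 * length rs + 22 * B + (\<Sum>i<n. H.layer_time i + 2) + 10 * Suc C + 10 * n)"
              by (rule of_nat_mono)
            also have "\<dots> = 51 + 60 * real n + 5 * real (length rs) + 22 * real B
                + real (\<Sum>i<n. H.layer_time i + 2) + 10 * real C"
              by simp
            also have "\<dots> \<le> 51 * ?X + 60 * ?X + (20 * real B * (real B + 2)) * ?X + 22 * real B * ?X
                + (38 * ?X + (114 * (real B)\<^sup>2 * (2 * real B + 6)) * ?X) + 10 * ?X"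
              using R L BX C M X nX 1 by linarith
            also have "\<dots> \<le> solver_const B * ?X"
              using X by (simp add: solver_const_def algebra_simps)
            finally show ?thesis .
          qed
          show ?thesis
            apply (rule wp_mono[OF H.backend_wp[OF inp2 B]])
            using zero ag1 ag2 bound by (auto simp: agreeD w)
        qed
        done
    qed
    done
  then show ?thesis unfolding wp_def solves_within_def by (auto simp: mult.assoc)
qed

end

theorem theorem1:
  "\<exists>prog :: com.
     (\<forall>K :: nat. \<exists>c :: real. \<forall>I rs.
        is_knapsack I \<and> lists_rules rs I \<and> num_states I \<le> K \<longrightarrow>
        solves_within prog I rs
          (c * real (num_verts I) powr log 2 (1 + real (diversity (automaton I) (num_verts I)))
             * real (max 1 (capacity I)))) \<and>
     (\<forall>K D :: nat. \<exists>(c :: real) (e :: nat). \<forall>I rs.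
        is_knapsack I \<and> lists_rules rs I \<and> num_states I \<le> K \<and>
        diversity (automaton I) (num_verts I) \<le> D \<longrightarrow>
        solves_within prog I rs
          (c * real (num_verts I) ^ e * real (max 1 (capacity I))))"
proof (intro exI[of _ solver] conjI allI)
  have mono: "solves_within solver I rs b" if "solves_within solver I rs a" "a \<le> b" for I rs a b
    using that unfolding solves_within_def by (meson order_trans)
  have main: "solves_within solver I rs
      (solver_const K * real (num_verts I) powr log 2 (1 + real (diversity (automaton I) (num_verts I)))
        * real (max 1 (capacity I)))"
    if "is_knapsack I" "lists_rules rs I" "num_states I \<le> K" for I rs K
  proof -
    interpret knap I rs using that by unfold_locales
    show ?thesis
      by (rule mono[OF solver_correct]) (intro mult_right_mono solver_const_mono that(3); simp)
  qed
  show "\<exists>c. \<forall>I rs. is_knapsack I \<and> lists_rules rs I \<and> num_states I \<le> K \<longrightarrow>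
      solves_within solver I rs
        (c * real (num_verts I) powr log 2 (1 + real (diversity (automaton I) (num_verts I)))
          * real (max 1 (capacity I)))" for K
    using main by blast
  show "\<exists>c e. \<forall>I rs. is_knapsack I \<and> lists_rules rs I \<and> num_states I \<le> K \<and>
      diversity (automaton I) (num_verts I) \<le> D \<longrightarrow>
      solves_within solver I rs (c * real (num_verts I) ^ e * real (max 1 (capacity I)))" for K D
  proof (intro exI[of _ "solver_const K"] exI[of _ D] allI impI, elim conjE)
    fix I rs
    assume I: "is_knapsack I" "lists_rules rs I" "num_states I \<le> K"
      and D: "diversity (automaton I) (num_verts I) \<le> D"
    interpret knap I rs using I by unfold_locales
    \<comment> \<open>A crude exponent suffices for a polynomial bound:
      \<open>1 + D \<le> 2 ^ D\<close> allows the natural number \<open>D\<close> itself.\<close>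
    have "1 + real \<delta> \<le> 2 ^ D"
    proof -
      have "1 + \<delta> \<le> 2 ^ D" using D less_exp[of D] by linarith
      then have "real (1 + \<delta>) \<le> real (2 ^ D)" by (rule of_nat_mono)
      then show ?thesis by simp
    qed
    then have "log 2 (1 + real \<delta>) \<le> log 2 (2 ^ D)" by (subst log_le_cancel_iff) auto
    then have "log 2 (1 + real \<delta>) \<le> real D" by (simp add: log_nat_power)
    then have "real n powr log 2 (1 + real \<delta>) \<le> real n powr real D"
      using n_pos by (intro powr_mono) auto
    then have "real n powr log 2 (1 + real \<delta>) \<le> real n ^ D"
      using n_pos by (simp add: powr_realpow)
    then show "solves_within solver I rs (solver_const K * real (num_verts I) ^ D * real (max 1 (capacity I)))"
      using solver_const_ge[of K]
      by (intro mono[OF main[OF I]] mult_right_mono mult_left_mono) auto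
  qed
qed

end
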